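(* Let $M\ge 1$ and $S=M+1$. The ADER-IWF-RK-GLB method with $S$ stages (built on $S=M+1$ Gauss–Lobatto subtimenodes, which are also used as quadrature points) is of order $2S-2$.
   Context: Consider the ODE system $\frac{d}{dt}\boldsymbol{u}=\boldsymbol{G}(t,\boldsymbol{u})$, with $\boldsymbol{u}(t)\in\mathbb{R}^Q$ and $\boldsymbol{G}$ continuous and Lipschitz in $\boldsymbol{u}$ uniformly in $t$. An $S$-stage (implicit) Runge–Kutta (RK) method with coefficients $A=(a_{s,r})$, $\boldsymbol{b}=(b_r)$, $\boldsymbol{c}=(c_r)$, $s,r=0,\dots,S-1$, computes from $\boldsymbol{u}_n\approx \boldsymbol{u}(t_n)$ the approximation $\boldsymbol{u}_{n+1}\approx\boldsymbol{u}(t_n+\Delta t)$ through $$\boldsymbol{y}^s=\boldsymbol{u}_n+\Delta t\sum_{r=0}^{S-1}a_{s,r}\boldsymbol{G}(t_n+c_r\Delta t,\boldsymbol{y}^r),\ s=0,\dots,S-1,\qquad \boldsymbol{u}_{n+1}=\boldsymbol{u}_n+\Delta t\sum_{r=0}^{S-1}b_r\boldsymbol{G}(t_n+c_r\Delta t,\boldsymbol{y}^r).$$ It is of order $p$ if, for sufficiently smooth $\boldsymbol{G}$ and $\boldsymbol{u}_n=\boldsymbol{u}(t_n)$, one has $\boldsymbol{u}_{n+1}-\boldsymbol{u}(t_n+\Delta t)=O(\Delta t^{p+1})$ as $\Delta t\to0$. ADER-IWF-RK-GLB method: let $0=\xi^0<\dots<\xi^M=1$ be the $M+1$ Gauss–Lobatto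 (GLB) points on $[0,1]$ (the endpoints and the roots of the derivative of the degree-$M$ Legendre polynomial shifted to $[0,1]$), let $\widehat\psi^m$, $m=0,\dots,M$, be the associated Lagrange basis polynomials of degree $M$, and let $w_m=\int_0^1\widehat\psi^m(\xi)\,d\xi$ be the quadrature weights (the quadrature with nodes $\xi^m$ and weights $w_m$ is exact for polynomials of degree at most $2M-1=2S-3$). Define the $(M+1)\times(M+1)$ matrices, with all integrals computed by this quadrature, $$B_{\ell,m}=\widehat\psi^\ell(1)\widehat\psi^m(1)-\sum_{q=0}^M w_q\Big(\tfrac{d}{d\xi}\widehat\psi^\ell\Big)(\xi^q)\,\widehat\psi^m(\xi^q),\qquad \Lambda_{\ell,m}=\sum_{q=0}^M w_q\widehat\psi^\ell(\xi^q)\widehat\psi^m(\xi^q)=w_\ell\delta_{\ell,m}.$$ The method is the RK method with $S=M+1$ stages, $A=B^{-1}\Lambda$, $c_m=\xi^m$, $b_m=w_m$. *)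

theory Defs
  imports
    "HOL-Analysis.Analysis"
    "HOL-Library.Landau_Symbols"
    "Jordan_Normal_Form.Gauss_Jordan_Elimination"
begin

text \<open>
  \<open>C_k k f\<close>: \<open>f\<close> is \<open>k\<close> times continuously differentiable on the whole space.  On a
  finite-dimensional domain this is the usual notion: the Frechet derivative exists and all
  directional derivatives are of class \<open>C\<^sup>k\<^sup>-\<^sup>1\<close>.
\<close>

primrec C_k ::
  "nat \<Rightarrow> ('a::euclidean_space \<Rightarrow> 'b::real_normed_vector) \<Rightarrow> bool" where
  "C_k 0 f \<longleftrightarrow> continuous_on UNIV f"
| "C_k (Suc k) f \<longleftrightarrow>
     (\<exists>f'. (\<forall>x. (f has_derivative f' x) (at x)) \<and> (\<forall>v. C_k k (\<lambda>x. f' x v)))"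

text \<open>
  \<open>rk_step S A b c G t h x x'\<close>: \<open>x'\<close> is a result of one step of size \<open>h\<close>, started in
  \<open>x\<close> at time \<open>t\<close>, of the \<open>S\<close>-stage method \<open>(A, b, c)\<close>.  It is a relation since the stages
  \<open>y\<close> are only given implicitly.
\<close>

definition rk_step ::
  "nat \<Rightarrow> real mat \<Rightarrow> (nat \<Rightarrow> real) \<Rightarrow> (nat \<Rightarrow> real) \<Rightarrow>
   (real \<Rightarrow> 'a::real_normed_vector \<Rightarrow> 'a) \<Rightarrow> real \<Rightarrow> real \<Rightarrow> 'a \<Rightarrow> 'a \<Rightarrow> bool" where
  "rk_step S A b c G t h x x' \<longleftrightarrow>
     (\<exists>y :: nat \<Rightarrow> 'a.
        (\<forall>s<S. y s = x + h *\<^sub>R (\<Sum>r<S. (A $$ (s, r)) *\<^sub>R G (t + c r * h) (y r))) \<and>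
        x' = x + h *\<^sub>R (\<Sum>r<S. b r *\<^sub>R G (t + c r * h) (y r)))"

text \<open>
  Order (at least) \<open>p\<close> for systems with state space \<open>'a\<close>.  ``Sufficiently smooth'' means
  of class \<open>C\<^sup>k\<close> for some \<open>k\<close> which does not depend on the problem.  The step is required to
  be solvable for all small \<open>h\<close>, and the error estimate to hold for every choice \<open>\<Phi>\<close> of
  solutions of the implicit equations.  Both signs of \<open>h\<close> are admitted.
\<close>

definition rk_of_order ::
  "'a::euclidean_space itself \<Rightarrow> nat \<Rightarrow> real mat \<Rightarrow> (nat \<Rightarrow> real) \<Rightarrow> (nat \<Rightarrow> real) \<Rightarrow> nat \<Rightarrow> bool"
  where
  "rk_of_order T S A b c p \<longleftrightarrow>
     (\<exists>k. \<forall>(G :: real \<Rightarrow> 'a \<Rightarrow> 'a) L u t\<^sub>0.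
        C_k k (\<lambda>(t, x). G t x) \<longrightarrow>
        continuous_on UNIV (\<lambda>(t, x). G t x) \<longrightarrow>
        (\<forall>t. L-lipschitz_on UNIV (G t)) \<longrightarrow>
        (\<forall>\<^sub>F t in nhds t\<^sub>0. (u has_vector_derivative G t (u t)) (at t)) \<longrightarrow>
          (\<forall>\<^sub>F h in at 0. \<exists>x'. rk_step S A b c G t\<^sub>0 h (u t\<^sub>0) x') \<and>
          (\<forall>\<Phi>. (\<forall>\<^sub>F h in at 0. rk_step S A b c G t\<^sub>0 h (u t\<^sub>0) (\<Phi> h)) \<longrightarrow>
             (\<lambda>h. norm (\<Phi> h - u (t\<^sub>0 + h))) \<in> O[at 0](\<lambda>h. h ^ (p + 1))))"

text \<open>Legendre polynomials on \<open>[-1, 1]\<close>, by Rodrigues' formula\<close>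

definition legendre :: "nat \<Rightarrow> real poly" where
  "legendre n = Polynomial.smult (1 / (2 ^ n * fact n)) ((pderiv ^^ n) ([:-1, 0, 1:] ^ n))"

definition shifted_legendre :: "nat \<Rightarrow> real poly" where
  "shifted_legendre n = pcompose (legendre n) [:-1, 2:]"

text \<open>
  The Gauss--Lobatto points on \<open>[0, 1]\<close>.  For \<open>M \<ge> 1\<close> there are \<open>M + 1\<close> of them, so
  \<open>glb_node M m\<close> is meaningful for \<open>m \<le> M\<close>, and increasing in \<open>m\<close>.
\<close>

definition glb_points :: "nat \<Rightarrow> real set" where
  "glb_points M = {0, 1} \<union> {x. poly (pderiv (shifted_legendre M)) x = 0}"

definition glb_node :: "nat \<Rightarrow> nat \<Rightarrow> real" where
  "glb_node M m = sorted_list_of_set (glb_points M) ! m"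

definition glb_basis :: "nat \<Rightarrow> nat \<Rightarrow> real poly" where
  "glb_basis M m =
     (\<Prod>j\<in>{..M} - {m}. Polynomial.smult (1 / (glb_node M m - glb_node M j)) [:- glb_node M j, 1:])"

definition glb_weight :: "nat \<Rightarrow> nat \<Rightarrow> real" where
  "glb_weight M m = integral {0..1} (\<lambda>x. poly (glb_basis M m) x)"

definition ader_B :: "nat \<Rightarrow> real mat" where
  "ader_B M = Matrix.mat (M + 1) (M + 1) (\<lambda>(l, m).
     poly (glb_basis M l) 1 * poly (glb_basis M m) 1 -
     (\<Sum>q\<le>M. glb_weight M q * poly (pderiv (glb_basis M l)) (glb_node M q)
            * poly (glb_basis M m) (glb_node M q)))"

definition ader_Lambda :: "nat \<Rightarrow> real mat" where
  "ader_Lambda M = Matrix.mat (M + 1) (M + 1) (\<lambda>(l, m).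
     \<Sum>q\<le>M. glb_weight M q * poly (glb_basis M l) (glb_node M q)
            * poly (glb_basis M m) (glb_node M q))"

text \<open>
  \<open>mat_inverse\<close> yields \<open>None\<close>, and hence \<open>the\<close> an unspecified matrix, only if
  \<open>ader_B M\<close> is singular.
\<close>

definition ader_A :: "nat \<Rightarrow> real mat" where
  "ader_A M = the (mat_inverse (ader_B M)) * ader_Lambda M"

end

theory Submission
  imports Defs "Jordan_Normal_Form.Determinant"
begin

text \<open>
  The method is a discontinuous collocation method (Lobatto IIIC).  Let \<open>Y\<close> be the polynomial of
  degree \<open>M\<close> through the stages and \<open>r = Y' - h G(Y)\<close> its residual, both in the local time
  \<open>\<xi> \<in> [0, 1]\<close>.  Since the quadrature integrates \<open>\<psi>\<^sub>l' \<psi>\<^sub>m\<close> exactly, the stage equations say that \<open>r\<close>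
  vanishes at \<open>\<xi>\<^sub>1, \<dots>, \<xi>\<^sub>M\<close> and that \<open>Y(0) - u\<^sub>n = - w\<^sub>0 r(0)\<close>; moreover the step returns \<open>Y(1)\<close>.
  Let \<open>e\<close> be the difference of \<open>Y\<close> and the exact solution, so that \<open>e' = h Q e + r\<close> for some matrix
  \<open>Q\<close>, and let \<open>\<phi>\<close> solve the adjoint equation \<open>\<phi>' = - h Q\<^sup>T \<phi>\<close> with \<open>\<phi>(1)\<close> a unit vector.  Then
  \<open>(\<phi> \<bullet> e)' = \<phi> \<bullet> r\<close>, and \<open>\<integral> \<phi> \<bullet> r\<close> agrees up to the quadrature error with
  \<open>w\<^sub>0 \<phi>(0) \<bullet> r(0) = - \<phi>(0) \<bullet> e(0)\<close>.  Hence a component of \<open>e(1)\<close> is a quadrature error, and this is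
  \<open>O(h\<^sup>2\<^sup>M\<^sup>+\<^sup>1)\<close> because \<open>\<phi> \<bullet> r\<close> is \<open>h\<close> times a function of \<open>h \<xi>\<close> which is a polynomial of degree less than
  \<open>2 M\<close> with bounded coefficients up to \<open>O(h\<^sup>2\<^sup>M)\<close>.
\<close>

section \<open>Polynomials and Gauss--Lobatto quadrature\<close>

text \<open>The stage equations are solved for each \<open>h\<close> separately and the selection
  \<open>\<Phi>\<close> is arbitrary, so nothing is known about the regularity of the stages in
  \<open>h\<close>. Only bounds uniform in \<xi> are therefore used, and expansions are polynomials
  in \<open>h * \<xi>\<close> whose coefficients may jump with \<open>h\<close>. Local time keeps
  the interval at [0, 1] for either sign of \<open>h\<close>. The obstacle is that bounding the
  quadrature error takes information of order 2 M on the stage polynomial, while collocation at M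
  nodes can be bootstrapped only to order M + 1. For a polynomial of degree M this already suffices:
  it is then exactly a polynomial in physical time with bounded coefficients, hence almost
  polynomial to every order. \<open>G\<close> enters through one Taylor polynomial with remainder
  O(h^(2 M)). This makes \<open>Q\<close> an algebraic expression in both arguments, and it lets
  \<phi> be a polynomial that satisfies the adjoint equation up to O(h^(2 M)) with exact end value.
  The factor \<open>h\<close> in front of the right-hand side supplies the last power, so 2 M
  derivatives are enough.\<close>

lemma poly_roots_pderiv:
  fixes p :: "real poly"
  assumes "finite A" "A \<noteq> {}" "\<And>x. x \<in> A \<Longrightarrow> poly p x = 0"
  shows "\<exists>B \<subseteq> {Min A<..<Max A}. finite B \<and> card B = card A - 1 \<and> (\<forall>x\<in>B. poly (pderiv p) x = 0)"
  using assms
proof (induction A rule: finite_linorder_max_induct)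
  case empty
  then show ?case by simp
next
  case (insert b A)
  show ?case
  proof (cases "A = {}")
    case True
    then show ?thesis by (intro exI[of _ "{}"]) auto
  next
    case False
    then obtain B where B: "B \<subseteq> {Min A<..<Max A}" "finite B" "card B = card A - 1"
      "\<forall>x\<in>B. poly (pderiv p) x = 0"
      using insert by auto
    have less: "Max A < b" and mem: "Max A \<in> A" using insert False by auto
    \<comment> \<open>Rolle between the two largest roots; the new root lies beyond
      \<open>Max A\<close>, hence differs from all of \<open>B\<close>.\<close>
    obtain x where x: "Max A < x" "x < b" "poly p b - poly p (Max A) = (b - Max A) * poly (pderiv p) x"
      using poly_MVT[OF less] by blast
    have x0: "poly (pderiv p) x = 0" using x less insert.prems mem by simp
    have mx: "Max (insert b A) = b" using less insert.hyps False by (simp add: max.absorb1)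
    have "Min A \<le> Max A" using insert.hyps False by simp
    then have mn: "Min (insert b A) = Min A" using less insert.hyps False by (simp add: min.absorb2)
    have "x \<notin> B" using B(1) x(1) by auto
    moreover have "card A \<noteq> 0" "b \<notin> A" using insert.hyps False by auto
    ultimately show ?thesis
      using B x x0 less insert.hyps \<open>Min A \<le> Max A\<close> unfolding mx mn
      by (intro exI[of _ "insert x B"]) fastforce
  qed
qed

lemma power_Suc_dvd_pderiv:
  fixes p q :: "real poly"
  assumes "q ^ Suc n dvd p"
  shows "q ^ n dvd pderiv p"
proof -
  obtain r where "p = q ^ Suc n * r" using assms by (elim dvdE)
  then have "pderiv p = q ^ n * (q * pderiv r + r * Polynomial.smult (of_nat (Suc n)) (pderiv q))"
    by (simp only: pderiv_mult pderiv_power_Suc) (simp add: algebra_simps)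
  then show ?thesis by simp
qed

lemma power_dvd_higher_pderiv:
  fixes p q :: "real poly"
  assumes "q ^ (n + j) dvd p"
  shows "q ^ n dvd (pderiv ^^ j) p"
  using assms
proof (induction j arbitrary: n)
  case (Suc j)
  then have "q ^ Suc n dvd (pderiv ^^ j) p" by (metis add_Suc add_Suc_right)
  then show ?case by (simp add: power_Suc_dvd_pderiv del: power_Suc)
qed simp

section \<open>Integrals of polynomials over [0, 1]\<close>

definition poly_int :: "real poly \<Rightarrow> real" where
  "poly_int p = integral {0..1} (poly p)"

lemma poly_integrable: "(poly p) integrable_on {0..1::real}"
  by (intro integrable_continuous_real continuous_intros)

lemma poly_int_add: "poly_int (p + q) = poly_int p + poly_int q"
  unfolding poly_int_def using integral_add[OF poly_integrable poly_integrable, of p q]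
  by (simp add: poly_add[abs_def])

lemma poly_int_smult: "poly_int (Polynomial.smult c p) = c * poly_int p"
  unfolding poly_int_def by (simp add: poly_smult[abs_def])

lemma poly_int_sum: "poly_int (sum f A) = (\<Sum>a\<in>A. poly_int (f a))"
proof -
  have "poly_int 0 = 0" using poly_int_smult[of 0 0] by simp
  then show ?thesis
    by (induction A rule: infinite_finite_induct) (auto simp: poly_int_add)
qed

lemma poly_int_pderiv: "poly_int (pderiv p) = poly p 1 - poly p 0"
  unfolding poly_int_def
  by (intro integral_unique fundamental_theorem_of_calculus)
    (auto simp: has_real_derivative_iff_has_vector_derivative[symmetric]
      intro: DERIV_subset poly_DERIV)

lemma poly_int_by_parts:
  "poly_int (pderiv p * q) = poly p 1 * poly q 1 - poly p 0 * poly q 0 - poly_int (p * pderiv q)"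
  using poly_int_pderiv[of "p * q"] by (simp add: pderiv_mult poly_int_add mult.commute)

text \<open>A nonnegative continuous function with integral zero vanishes on [0, 1], which would
  give \<open>p\<close> infinitely many roots.\<close>

lemma poly_int_pos:
  assumes "p \<noteq> 0" "\<And>x. 0 \<le> x \<Longrightarrow> x \<le> 1 \<Longrightarrow> poly p x \<ge> 0"
  shows "poly_int p > 0"
proof -
  have "poly_int p \<ge> 0" unfolding poly_int_def
    using assms by (intro integral_nonneg poly_integrable) auto
  moreover have "poly_int p \<noteq> 0"
  proof
    assume "poly_int p = 0"
    then have "\<forall>x\<in>{0..1}. poly p x = 0"
      unfolding poly_int_def using assms
      by (subst (asm) integral_eq_0_iff) (auto intro!: continuous_intros)
    then have "{0..1} \<subseteq> {x. poly p x = 0}" by auto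
    then have "finite {0..1::real}" using poly_roots_finite[OF assms(1)] by (rule finite_subset)
    then show False by (simp add: infinite_Icc)
  qed
  ultimately show ?thesis by linarith
qed

lemma higher_pderiv_eq_0_iff:
  fixes p :: "real poly"
  assumes "p \<noteq> 0" shows "(pderiv ^^ n) p = 0 \<longleftrightarrow> Polynomial.degree p < n"
proof (cases "Polynomial.degree p < n")
  case True
  then have "(pderiv ^^ n) p = 0"
    by (intro poly_eqI) (simp add: coeff_higher_pderiv coeff_eq_0)
  then show ?thesis using True by simp
next
  case False
  then have "poly.coeff ((pderiv ^^ n) p) (Polynomial.degree p - n) \<noteq> 0"
    using assms by (simp add: coeff_higher_pderiv pochhammer_eq_0_iff)
  then show ?thesis using False by auto
qed

text \<open>
  Rodrigues' polynomial transported to \<open>[0, 1]\<close>: its \<open>M\<close>-th derivative is the shifted Legendre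
  polynomial up to a factor.
\<close>

definition glb_rodrigues :: "nat \<Rightarrow> real poly" where
  "glb_rodrigues M = [:0, -1, 1:] ^ M"

text \<open>The substitution 2 \<xi> - 1 turns x^2 - 1 into 4 (\<xi>^2 - \<xi>), and each derivative
  contributes a factor 1/2. Only roots matter later, so the nonzero factor stays
  existential.\<close>

lemma shifted_legendre_eq:
  "\<exists>c. c \<noteq> 0 \<and> shifted_legendre M = Polynomial.smult c ((pderiv ^^ M) (glb_rodrigues M))"
proof -
  have *: "pcompose ((pderiv ^^ n) p) [:-1, 2:] =
      Polynomial.smult (1 / 2 ^ n) ((pderiv ^^ n) (pcompose p [:-1, 2:]))" for n and p :: "real poly"
  proof (induction n arbitrary: p)
    case (Suc n)
    have "pderiv (pcompose p [:-1, 2:]) = Polynomial.smult 2 (pcompose (pderiv p) [:-1, 2:])"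
      by (simp add: pderiv_pcompose pderiv_pCons)
    then show ?case
      by (simp add: Suc funpow_Suc_right higher_pderiv_smult del: funpow.simps)
  qed simp
  have "pcompose [:-1, 0, 1:] [:-1, 2:] = Polynomial.smult 4 [:0, -1, 1::real:]"
    by (simp add: pcompose_pCons)
  moreover have "pcompose (p ^ n) q = pcompose p q ^ n" for p q :: "real poly" and n
    by (induction n) (simp_all only: pcompose_mult power_Suc power_0 pcompose_1)
  ultimately have "pcompose ([:-1, 0, 1:] ^ M) [:-1, 2:] = Polynomial.smult (4 ^ M) (glb_rodrigues M)"
    by (simp only: smult_power glb_rodrigues_def)
  then show ?thesis
    unfolding shifted_legendre_def legendre_def
    by (intro exI[of _ "1 / (2 ^ M * fact M) * (1 / 2 ^ M * 4 ^ M)"])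
      (simp add: pcompose_smult * higher_pderiv_smult)
qed

lemma degree_glb_rodrigues: "Polynomial.degree (glb_rodrigues M) = 2 * M" "glb_rodrigues M \<noteq> 0"
  by (auto simp: glb_rodrigues_def degree_power_eq)

text \<open>After fewer than M differentiations a factor \<xi> (\<xi> - 1) survives.\<close>

lemma poly_glb_rodrigues_boundary:
  assumes "j < M"
  shows "poly ((pderiv ^^ j) (glb_rodrigues M)) 0 = 0" "poly ((pderiv ^^ j) (glb_rodrigues M)) 1 = 0"
proof -
  have "[:0, -1, 1:] ^ (M - j) dvd (pderiv ^^ j) (glb_rodrigues M)"
    using assms by (intro power_dvd_higher_pderiv) (simp add: glb_rodrigues_def)
  moreover have "[:0, -1, 1::real:] dvd [:0, -1, 1:] ^ (M - j)"
    using assms by (simp add: dvd_power)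
  ultimately obtain r where "(pderiv ^^ j) (glb_rodrigues M) = [:0, -1, 1:] * r"
    by (meson dvdE dvd_trans)
  then show "poly ((pderiv ^^ j) (glb_rodrigues M)) 0 = 0"
    "poly ((pderiv ^^ j) (glb_rodrigues M)) 1 = 0" by simp_all
qed

text \<open>Orthogonality of Legendre polynomials to lower degrees: j integrations by parts move all
  derivatives onto \<open>q\<close>, and the boundary terms involve only orders below M, where they
  vanish.\<close>

lemma poly_int_glb_rodrigues:
  assumes "j \<le> M" "(pderiv ^^ j) q = 0"
  shows "poly_int ((pderiv ^^ j) (glb_rodrigues M) * q) = 0"
  using assms
proof (induction j arbitrary: q)
  case (Suc j)
  then have "poly_int ((pderiv ^^ j) (glb_rodrigues M) * pderiv q) = 0"
    by (simp add: funpow_Suc_right del: funpow.simps)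
  then show ?case
    using poly_glb_rodrigues_boundary[of j M] Suc.prems by (simp add: poly_int_by_parts)
qed (use poly_int_smult[of 0 0] in simp)

text \<open>As long as the order is below M, the endpoints are roots too, so Rolle turns j interior
  roots together with 0 and 1 into j + 1 interior roots.\<close>

lemma glb_rodrigues_roots:
  assumes "j \<le> M"
  shows "\<exists>A \<subseteq> {0<..<1}. finite A \<and> card A = j \<and> (\<forall>x\<in>A. poly ((pderiv ^^ j) (glb_rodrigues M)) x = 0)"
  using assms
proof (induction j)
  case (Suc j)
  then obtain A where A: "A \<subseteq> {0<..<1}" "finite A" "card A = j"
    "\<forall>x\<in>A. poly ((pderiv ^^ j) (glb_rodrigues M)) x = 0" by auto
  define A' where "A' = insert 0 (insert 1 A)"
  have fin: "finite A'" and ne: "A' \<noteq> {}" using A by (auto simp: A'_def)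
  have "0 \<notin> insert 1 A" "1 \<notin> A" using A(1) by auto
  then have card: "card A' - 1 = Suc j" using A by (simp add: A'_def)
  have "Min A' \<ge> 0" "Max A' \<le> 1"
    using A(1) fin ne by (auto simp: A'_def)
  moreover obtain B where "B \<subseteq> {Min A'<..<Max A'}" "finite B" "card B = card A' - 1"
    "\<forall>x\<in>B. poly (pderiv ((pderiv ^^ j) (glb_rodrigues M))) x = 0"
    using poly_roots_pderiv[OF fin ne, of "(pderiv ^^ j) (glb_rodrigues M)"] A
      poly_glb_rodrigues_boundary[of j M] Suc.prems by (auto simp: A'_def)
  ultimately show ?case using card by (intro exI[of _ B]) fastforce
qed auto

text \<open>Rolle between the M interior roots of the Legendre polynomial yields M - 1 roots of its
  derivative \<open>D\<close>. As \<open>D\<close> has degree M - 1, there are no others, and all of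
  them lie strictly inside (0, 1).\<close>

lemma glb_points_props:
  assumes "M \<ge> 1"
  shows "finite (glb_points M)" "card (glb_points M) = M + 1" "glb_points M \<subseteq> {0..1}"
proof -
  define D where "D = (pderiv ^^ Suc M) (glb_rodrigues M)"
  obtain c where c: "c \<noteq> 0" "shifted_legendre M = Polynomial.smult c ((pderiv ^^ M) (glb_rodrigues M))"
    using shifted_legendre_eq by blast
  then have pts: "glb_points M = {0, 1} \<union> {x. poly D x = 0}"
    by (simp add: glb_points_def pderiv_smult D_def)
  have D0: "D \<noteq> 0" unfolding D_def using higher_pderiv_eq_0_iff[OF degree_glb_rodrigues(2), of "Suc M" M]
      degree_glb_rodrigues(1)[of M] assms by simp
  have degD: "Polynomial.degree D = M - 1"
    by (simp only: D_def degree_higher_pderiv degree_glb_rodrigues)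
  obtain A where A: "A \<subseteq> {0<..<1}" "finite A" "card A = M"
    "\<forall>x\<in>A. poly ((pderiv ^^ M) (glb_rodrigues M)) x = 0"
    using glb_rodrigues_roots[of M M] by auto
  then have ne: "A \<noteq> {}" using assms by auto
  obtain B where B: "B \<subseteq> {Min A<..<Max A}" "finite B" "card B = M - 1" "\<forall>x\<in>B. poly D x = 0"
    using poly_roots_pderiv[OF A(2) ne, of "(pderiv ^^ M) (glb_rodrigues M)"] A by (auto simp: D_def)
  have "Min A \<in> {0<..<1}" "Max A \<in> {0<..<1}" using Min_in[OF A(2) ne] Max_in[OF A(2) ne] A(1) by blast+
  then have B01: "B \<subseteq> {0<..<1}" using B(1) by fastforce
  have "finite {x. poly D x = 0}" using D0 by (rule poly_roots_finite)
  moreover have "card {x. poly D x = 0} \<le> card B" using card_poly_roots_bound[OF D0] degD B by simp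
  moreover have "B \<subseteq> {x. poly D x = 0}" using B by auto
  ultimately have "{x. poly D x = 0} = B" by (metis card_seteq)
  then have eq: "glb_points M = insert 0 (insert 1 B)" using pts by auto
  moreover have "0 \<notin> insert 1 B" "1 \<notin> B" using B01 by auto
  ultimately show "finite (glb_points M)" "card (glb_points M) = M + 1" "glb_points M \<subseteq> {0..1}"
    using B B01 assms by auto
qed


section \<open>Enumeration of the nodes and Lagrange interpolation\<close>

lemma glb_node_bij:
  assumes "M \<ge> 1"
  shows "bij_betw (glb_node M) {..M} (glb_points M)"
    and "glb_node M 0 = 0" and "glb_node M M = 1"
proof -
  let ?l = "sorted_list_of_set (glb_points M)"
  note P = glb_points_props[OF assms]
  have len: "length ?l = Suc M" and set: "set ?l = glb_points M"
    using P by simp_all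
  show bij: "bij_betw (glb_node M) {..M} (glb_points M)"
    using bij_betw_nth[of ?l "{..M}" "glb_points M"] len set
    unfolding glb_node_def[abs_def] by (simp add: lessThan_Suc_atMost[symmetric])
  have mono: "glb_node M i \<le> glb_node M j" if "i \<le> j" "j \<le> M" for i j
    unfolding glb_node_def using that len by (intro sorted_nth_mono) auto
  have "0 \<in> glb_points M" "1 \<in> glb_points M" by (auto simp: glb_points_def)
  then obtain i j where "i \<le> M" "glb_node M i = 0" "j \<le> M" "glb_node M j = 1"
    using bij by (metis atMost_iff bij_betw_imp_surj_on imageE)
  moreover have "glb_node M 0 \<in> {0..1}" "glb_node M M \<in> {0..1}"
    using bij P(3) by (meson atMost_iff bij_betwE order_refl subsetD zero_le)+
  ultimately show "glb_node M 0 = 0" "glb_node M M = 1"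
    using mono[of 0 i] mono[of j M] by auto
qed

text \<open>Indexed by node values instead of positions, because the same facts are needed both for
  all Gauss-Lobatto points and for the M points other than 0.\<close>

definition lagrange_poly :: "real set \<Rightarrow> real \<Rightarrow> real poly" where
  "lagrange_poly N x = (\<Prod>y\<in>N - {x}. Polynomial.smult (1 / (x - y)) [:- y, 1:])"

lemma poly_lagrange_poly:
  assumes "finite N" "x \<in> N" "z \<in> N"
  shows "poly (lagrange_poly N x) z = (if z = x then 1 else 0)"
  using assms
  by (auto simp: lagrange_poly_def poly_prod diff_divide_distrib[symmetric] intro!: prod.neutral)

lemma degree_lagrange_poly:
  assumes "finite N" "x \<in> N"
  shows "Polynomial.degree (lagrange_poly N x) < card N"
proof -
  have "Polynomial.degree (lagrange_poly N x) \<le> (\<Sum>y\<in>N - {x}. 1::nat)"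
    unfolding lagrange_poly_def
    by (rule order_trans[OF degree_prod_sum_le]) (use assms in \<open>auto intro!: sum_mono\<close>)
  also have "\<dots> = card (N - {x})" by simp
  also have "\<dots> < card N" using assms by (rule card_Diff1_less)
  finally show ?thesis .
qed

lemma lagrange_interpolation:
  assumes "finite N" "Polynomial.degree p < card N"
  shows "p = (\<Sum>x\<in>N. Polynomial.smult (poly p x) (lagrange_poly N x))" (is "_ = ?q")
proof (rule ccontr)
  assume "p \<noteq> ?q"
  then have ne: "p - ?q \<noteq> 0" by simp
  have "card N > 0" using assms(2) by linarith
  then have "Polynomial.degree ?q < card N"
    using assms degree_lagrange_poly[OF assms(1)]
    by (intro degree_sum_less) (auto intro: le_less_trans[OF degree_smult_le])
  then have "Polynomial.degree (p - ?q) < card N" using assms by (simp add: degree_diff_less)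
  moreover have "N \<subseteq> {x. poly (p - ?q) x = 0}"
    using assms by (auto simp: poly_sum poly_lagrange_poly if_distrib sum.delta cong: if_cong)
  then have "card N \<le> card {x. poly (p - ?q) x = 0}"
    by (intro card_mono poly_roots_finite ne)
  ultimately show False using card_poly_roots_bound[OF ne] by simp
qed

text \<open>Norms on a finite-dimensional space of polynomials are equivalent. The constant is the
  sum of the absolute values of all coefficients of the Lagrange polynomials, so it depends on the
  nodes alone.\<close>

lemma lagrange_coeff_bound:
  fixes N :: "real set"
  assumes "finite N"
  shows "\<exists>C\<ge>0. \<forall>p e. Polynomial.degree p < card N \<longrightarrow> (\<forall>x\<in>N. \<bar>poly p x\<bar> \<le> e) \<longrightarrow> 0 \<le> e \<longrightarrow>
    (\<forall>i. \<bar>poly.coeff p i\<bar> \<le> C * e)"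
proof (intro exI[of _ "\<Sum>i<card N. \<Sum>x\<in>N. \<bar>poly.coeff (lagrange_poly N x) i\<bar>"] conjI allI impI)
  fix p :: "real poly" and e :: real and i
  let ?C = "\<lambda>i. \<Sum>x\<in>N. \<bar>poly.coeff (lagrange_poly N x) i\<bar>"
  assume p: "Polynomial.degree p < card N" "\<forall>x\<in>N. \<bar>poly p x\<bar> \<le> e" "0 \<le> e"
  show "\<bar>poly.coeff p i\<bar> \<le> (\<Sum>i<card N. ?C i) * e"
  proof (cases "i < card N")
    case True
    have "poly.coeff p i = (\<Sum>x\<in>N. poly p x * poly.coeff (lagrange_poly N x) i)"
      by (subst lagrange_interpolation[OF assms p(1)]) (simp add: coeff_sum)
    then have "\<bar>poly.coeff p i\<bar> \<le> (\<Sum>x\<in>N. \<bar>poly p x\<bar> * \<bar>poly.coeff (lagrange_poly N x) i\<bar>)"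
      by (simp only: abs_mult[symmetric] sum_abs)
    also have "\<dots> \<le> (\<Sum>x\<in>N. e * \<bar>poly.coeff (lagrange_poly N x) i\<bar>)"
      using p by (intro sum_mono mult_right_mono) auto
    also have "\<dots> = ?C i * e" by (simp add: sum_distrib_left mult.commute)
    also have "\<dots> \<le> (\<Sum>i<card N. ?C i) * e"
      using True p by (intro mult_right_mono member_le_sum) (auto intro: sum_nonneg)
    finally show ?thesis .
  next
    case False
    then show ?thesis using p by (simp add: coeff_eq_0 sum_nonneg)
  qed
qed (auto intro!: sum_nonneg)

lemma glb_basis_eq:
  assumes "M \<ge> 1" "m \<le> M"
  shows "glb_basis M m = lagrange_poly (glb_points M) (glb_node M m)"
proof -
  have inj: "inj_on (glb_node M) {..M}" and im: "glb_node M ` {..M} = glb_points M"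
    using glb_node_bij(1)[OF assms(1)] by (auto simp: bij_betw_def)
  have "glb_points M - {glb_node M m} = glb_node M ` ({..M} - {m})"
    using inj assms(2) by (subst inj_on_image_set_diff[OF inj]) (auto simp: im)
  then show ?thesis
    unfolding glb_basis_def lagrange_poly_def
    by (simp add: prod.reindex inj_on_subset[OF inj])
qed

lemma poly_glb_basis_node:
  assumes "M \<ge> 1" "m \<le> M" "q \<le> M"
  shows "poly (glb_basis M m) (glb_node M q) = (if q = m then 1 else 0)"
proof -
  have "glb_node M q \<in> glb_points M" "glb_node M m \<in> glb_points M"
    "glb_node M q = glb_node M m \<longleftrightarrow> q = m"
    using assms glb_node_bij(1)[OF assms(1)] by (auto simp: bij_betw_def inj_on_def)
  then show ?thesis
    using assms glb_points_props(1)[OF assms(1)] by (simp add: glb_basis_eq poly_lagrange_poly)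
qed

lemma degree_glb_basis:
  assumes "M \<ge> 1" "m \<le> M"
  shows "Polynomial.degree (glb_basis M m) \<le> M"
proof -
  have "glb_node M m \<in> glb_points M"
    using assms glb_node_bij(1)[OF assms(1)] by (auto simp: bij_betw_def)
  then show ?thesis
    using degree_lagrange_poly[of "glb_points M" "glb_node M m"] assms glb_points_props[OF assms(1)]
    by (simp add: glb_basis_eq)
qed

lemma glb_interpolation:
  assumes "M \<ge> 1" "Polynomial.degree p \<le> M"
  shows "p = (\<Sum>m\<le>M. Polynomial.smult (poly p (glb_node M m)) (glb_basis M m))"
proof -
  have "p = (\<Sum>x\<in>glb_points M. Polynomial.smult (poly p x) (lagrange_poly (glb_points M) x))"
    using assms glb_points_props[OF assms(1)] by (intro lagrange_interpolation) auto
  also have "\<dots> = (\<Sum>m\<le>M. Polynomial.smult (poly p (glb_node M m)) (glb_basis M m))"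
    by (subst sum.reindex_bij_betw[OF glb_node_bij(1)[OF assms(1)], symmetric])
      (auto simp: glb_basis_eq[OF assms(1)] intro!: sum.cong)
  finally show ?thesis .
qed

text \<open>Divide \<open>p\<close> by the node polynomial \<open>N\<close>. The remainder has
  degree at most M and is interpolated exactly. The multiple of \<open>N\<close> vanishes at the
  nodes, and its integral vanishes by one integration by parts and orthogonality.\<close>

lemma poly_int_eq_glb_quadrature:
  assumes M: "M \<ge> 1" and deg: "Polynomial.degree p \<le> 2 * M - 1"
  shows "poly_int p = (\<Sum>m\<le>M. glb_weight M m * poly p (glb_node M m))"
proof -
  define D where "D = (pderiv ^^ M) (glb_rodrigues M)"
  define N where "N = [:0, -1, 1:] * pderiv D"
  have degD: "Polynomial.degree D = M" 
    by (simp add: D_def degree_higher_pderiv degree_glb_rodrigues)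
  have D'0: "pderiv D \<noteq> 0" using degD M by (simp add: pderiv_eq_0_iff)
  have degN: "Polynomial.degree N = M + 1"
    unfolding N_def using D'0 degD M by (subst degree_mult_eq) (auto simp: degree_pderiv)
  have N0: "poly N x = 0" if "x \<in> glb_points M" for x
  proof -
    obtain c where "c \<noteq> 0" "shifted_legendre M = Polynomial.smult c D"
      using shifted_legendre_eq D_def by blast
    then show ?thesis using that by (auto simp: glb_points_def N_def pderiv_smult)
  qed
  define q where "q = p div N"
  define s where "s = p mod N"
  have p: "p = N * q + s" by (simp add: q_def s_def)
  have "N \<noteq> 0" using degN by auto
  then have degs: "Polynomial.degree s \<le> M"
    using degree_mod_less[of N p] degN by (auto simp: s_def)
  \<comment> \<open>Here the bound 2 M - 1 is used: \<open>N\<close> has degree M + 1, which leaves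
    M - 2 for \<open>q\<close>. The case \<open>q = 0\<close> is separate because it is the only one
    for M = 1.\<close>
  have degq: "q = 0 \<or> Polynomial.degree q + 2 \<le> M"
  proof (cases "q = 0")
    case False
    have "N * q = p - s" using p by simp
    then have "Polynomial.degree (N * q) \<le> 2 * M - 1"
      using degs deg M by (auto intro: degree_diff_le)
    then show ?thesis using False \<open>N \<noteq> 0\<close> degN by (subst (asm) degree_mult_eq) auto
  qed simp
  have "poly_int (N * q) = 0"
  proof -
    \<comment> \<open>The product \<xi> (\<xi> - 1) q has degree at most M, so its derivative is
      orthogonal to the Legendre polynomial \<open>D\<close>; the factor \<xi> (\<xi> - 1) kills the
      boundary terms.\<close>
    have "(pderiv ^^ M) (pderiv ([:0, -1, 1:] * q)) = 0"
    proof (cases "q = 0")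
      case False
      then have "Polynomial.degree ([:0, -1, 1:] * q) < Suc M"
        using degq by (subst degree_mult_eq) auto
      then have "(pderiv ^^ Suc M) ([:0, -1, 1:] * q) = 0"
        using no_zero_divisors[of "[:0, -1, 1:]" q] False by (subst higher_pderiv_eq_0_iff) auto
      then show ?thesis by (simp only: funpow_Suc_right o_def)
    qed simp
    then have "poly_int (D * pderiv ([:0, -1, 1:] * q)) = 0"
      unfolding D_def by (intro poly_int_glb_rodrigues) auto
    moreover have "N * q = pderiv D * ([:0, -1, 1:] * q)" by (simp add: N_def algebra_simps)
    ultimately show ?thesis by (simp only: poly_int_by_parts) simp
  qed
  then have "poly_int p = poly_int s" by (simp add: p poly_int_add)
  also have "\<dots> = (\<Sum>m\<le>M. poly s (glb_node M m) * poly_int (glb_basis M m))"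
    by (subst glb_interpolation[OF M degs]) (simp add: poly_int_sum poly_int_smult)
  also have "\<dots> = (\<Sum>m\<le>M. glb_weight M m * poly p (glb_node M m))"
    using N0 glb_node_bij(1)[OF M]
    by (intro sum.cong) (auto simp: p glb_weight_def poly_int_def bij_betw_def mult.commute)
  finally show ?thesis .
qed

text \<open>
  If \<open>w\<^sub>l = 0\<close>, a polynomial of degree at most \<open>2 M - 1\<close> which vanishes at the other nodes and does not
  change sign would have integral zero.
\<close>

lemma glb_weight_nonzero:
  assumes M: "M \<ge> 1" and l: "l \<le> M"
  shows "glb_weight M l \<noteq> 0"
proof
  assume w0: "glb_weight M l = 0"
  define x where "x = glb_node M"
  note B = glb_node_bij[OF M, folded x_def]
  define I where "I = {1..<M} - {l}"
  define E where "E = {0, M} - {l}"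
  define e where "e m = (if m = (0::nat) then [:0, 1:] else [:1, -1 :: real:])" for m
  \<comment> \<open>Interior nodes need double roots to avoid a sign change; at the endpoints the
    simple factors \<xi> and 1 - \<xi>, nonnegative on [0, 1], are enough.\<close>
  define p where "p = (\<Prod>m\<in>E. e m) * (\<Prod>m\<in>I. [:- x m, 1:])\<^sup>2"
  have fin: "finite I" "finite E" by (auto simp: I_def E_def)
  have "p \<noteq> 0" using fin by (auto simp: p_def e_def)
  moreover have "poly p z \<ge> 0" if "0 \<le> z" "z \<le> 1" for z
    using that by (auto simp: p_def poly_prod e_def intro!: mult_nonneg_nonneg prod_nonneg)
  ultimately have "poly_int p > 0" by (rule poly_int_pos)
  moreover have "poly_int p = 0"
  proof -
    have "Polynomial.degree p \<le> card E + 2 * card I"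
    proof -
      have "Polynomial.degree (\<Prod>m\<in>E. e m) \<le> (\<Sum>m\<in>E. Polynomial.degree (e m))"
        using degree_prod_sum_le[OF fin(2), of e] by simp
      also have "\<dots> \<le> (\<Sum>m\<in>E. 1)" by (intro sum_mono) (auto simp: e_def)
      finally have "Polynomial.degree (\<Prod>m\<in>E. e m) \<le> card E" by simp
      moreover have "Polynomial.degree (\<Prod>m\<in>I. [:- x m, 1:]) \<le> (\<Sum>m\<in>I. 1)"
        by (rule order_trans[OF degree_prod_sum_le]) (use fin in \<open>auto intro!: sum_mono\<close>)
      then have "Polynomial.degree ((\<Prod>m\<in>I. [:- x m, 1:])\<^sup>2) \<le> 2 * card I"
        using degree_power_le[of "\<Prod>m\<in>I. [:- x m, 1:]" 2] by simp
      ultimately show ?thesis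
        unfolding p_def by (intro order_trans[OF degree_mult_le]) simp
    qed
    \<comment> \<open>An interior \<open>l\<close> gives at most 2 + 2 (M - 2) = 2 M - 2, an
      endpoint at most 1 + 2 (M - 1) = 2 M - 1, which just stays within the exactness
      degree.\<close>
    also have "\<dots> \<le> 2 * M - 1"
    proof (cases "l \<in> {1..<M}")
      case True
      then have "card I = M - 2" "card E \<le> 2" using M
        by (auto simp: I_def E_def card_Diff_singleton card_insert_if)
      then show ?thesis using True by auto
    next
      case False
      then have "I = {1..<M}" "E \<subseteq> {if l = 0 then M else 0}" using l by (auto simp: I_def E_def)
      then have "card I = M - 1" "card E \<le> 1" using card_mono[of "{if l = 0 then M else 0}" E] by auto
      then show ?thesis using M by auto
    qed
    finally have "poly_int p = (\<Sum>m\<le>M. glb_weight M m * poly p (x m))"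
      unfolding x_def by (rule poly_int_eq_glb_quadrature[OF M])
    also have "\<dots> = 0"
    proof (intro sum.neutral ballI)
      fix m assume "m \<in> {..M}"
      then consider "m = l" | "m \<in> I" | "m \<in> E" by (force simp: I_def E_def)
      then show "glb_weight M m * poly p (x m) = 0"
      proof cases
        case 2
        then have "(\<Prod>m'\<in>I. poly [:- x m', 1:] (x m)) = 0" using fin by (intro prod_zero) auto
        then show ?thesis by (simp add: p_def poly_prod)
      next
        case 3
        then have "poly (e m) (x m) = 0" using B M by (auto simp: e_def E_def)
        then have "(\<Prod>m'\<in>E. poly (e m') (x m)) = 0" using fin 3 by (intro prod_zero) auto
        then show ?thesis by (simp add: p_def poly_prod)
      qed (simp add: w0)
    qed
    finally show ?thesis .
  qed
  ultimately show False by simp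
qed

section \<open>The stage equations as collocation conditions\<close>

text \<open>The product of a basis polynomial and a derivative has degree at most 2 M - 1, so the
  quadrature in \<open>ader_B\<close> is exact and integration by parts is legitimate. It cancels
  the boundary term at 1 and leaves the one at 0; the Kronecker property then removes the
  sum.\<close>

lemma ader_B_entry:
  assumes M: "M \<ge> 1" and "l \<le> M" "s \<le> M"
  shows "ader_B M $$ (l, s) =
    (if l = 0 \<and> s = 0 then 1 else 0) + glb_weight M l * poly (pderiv (glb_basis M s)) (glb_node M l)"
proof -
  note N = glb_node_bij[OF M]
  let ?f = "glb_basis M l" and ?g = "glb_basis M s"
  have deg: "Polynomial.degree ?f \<le> M" "Polynomial.degree ?g \<le> M"
    using degree_glb_basis[OF M] assms by auto
  then have d: "Polynomial.degree (pderiv ?f * ?g) \<le> 2 * M - 1"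
    "Polynomial.degree (pderiv ?g * ?f) \<le> 2 * M - 1"
    using M by (auto intro!: order_trans[OF degree_mult_le] simp: degree_pderiv)
  have "ader_B M $$ (l, s) = poly ?f 1 * poly ?g 1 - poly_int (pderiv ?f * ?g)"
    using assms d(1) by (simp add: ader_B_def poly_int_eq_glb_quadrature mult.assoc)
  also have "\<dots> = poly ?f 0 * poly ?g 0 + poly_int (pderiv ?g * ?f)"
    using poly_int_by_parts[of ?f ?g] by (simp add: mult.commute[of ?f])
  also have "poly_int (pderiv ?g * ?f) =
      (\<Sum>m\<le>M. if m = l then glb_weight M l * poly (pderiv ?g) (glb_node M l) else 0)"
    unfolding poly_int_eq_glb_quadrature[OF M d(2)]
    by (intro sum.cong) (auto simp: poly_glb_basis_node[OF M] assms)
  also have "poly ?f 0 * poly ?g 0 = (if l = 0 \<and> s = 0 then 1 else 0)"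
    using poly_glb_basis_node[OF M, of l 0] poly_glb_basis_node[OF M, of s 0] assms N by auto
  finally show ?thesis using assms by (simp add: sum.delta)
qed

text \<open>Diagonal by the Kronecker property, although the product of two basis polynomials may
  have degree 2 M, one more than the quadrature integrates exactly.\<close>

lemma ader_Lambda_entry:
  assumes M: "M \<ge> 1" and "l \<le> M" "s \<le> M"
  shows "ader_Lambda M $$ (l, s) = (if l = s then glb_weight M l else 0)"
proof -
  have "ader_Lambda M $$ (l, s) = (\<Sum>q\<le>M. glb_weight M q * poly (glb_basis M l) (glb_node M q)
      * poly (glb_basis M s) (glb_node M q))"
    using assms by (simp add: ader_Lambda_def)
  also have "\<dots> = (\<Sum>q\<le>M. if q = l then (if l = s then glb_weight M l else 0) else 0)"
    by (intro sum.cong) (auto simp: poly_glb_basis_node[OF M] assms)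
  finally have "ader_Lambda M $$ (l, s) = \<dots>" .
  then show ?thesis using assms by (simp add: sum.delta)
qed

definition glb_interp :: "nat \<Rightarrow> (nat \<Rightarrow> real) \<Rightarrow> real poly" where
  "glb_interp M y = (\<Sum>s\<le>M. Polynomial.smult (y s) (glb_basis M s))"

lemma glb_interp_node:
  assumes "M \<ge> 1" "q \<le> M"
  shows "poly (glb_interp M y) (glb_node M q) = y q"
  using assms by (auto simp: glb_interp_def poly_sum poly_glb_basis_node if_distrib sum.delta cong: if_cong)

lemma degree_glb_interp:
  assumes "M \<ge> 1"
  shows "Polynomial.degree (glb_interp M y) \<le> M"
  unfolding glb_interp_def using assms degree_glb_basis[OF assms]
  by (intro degree_sum_le) (auto intro: order_trans[OF degree_smult_le])

text \<open>Linearity in \<open>y\<close> turns multiplication by B into differentiation of the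
  interpolant, weighted at each node, plus the initial value in row 0.\<close>

lemma ader_B_mult_eq:
  assumes M: "M \<ge> 1" and "l \<le> M"
  shows "(\<Sum>s\<le>M. ader_B M $$ (l, s) * y s) =
    (if l = 0 then y 0 else 0) + glb_weight M l * poly (pderiv (glb_interp M y)) (glb_node M l)"
proof -
  have "pderiv (glb_interp M y) = (\<Sum>s\<le>M. Polynomial.smult (y s) (pderiv (glb_basis M s)))"
    unfolding glb_interp_def
    using higher_pderiv_sum[of 1 "\<lambda>s. Polynomial.smult (y s) (glb_basis M s)" "{..M}"]
    by (simp add: pderiv_smult)
  then have "glb_weight M l * poly (pderiv (glb_interp M y)) (glb_node M l) =
    (\<Sum>s\<le>M. glb_weight M l * poly (pderiv (glb_basis M s)) (glb_node M l) * y s)"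
    by (simp add: poly_sum sum_distrib_left mult_ac)
  moreover have "(\<Sum>s\<le>M. (if l = 0 \<and> s = 0 then 1 else 0) * y s) = (if l = 0 then y 0 else 0)"
    by (simp add: if_distrib[of "\<lambda>a. a * _"] sum.delta cong: if_cong)
  ultimately show ?thesis
    using assms by (simp add: ader_B_entry distrib_right sum.distrib)
qed

text \<open>Since the weights are nonzero, rows 1 to M make the derivative of the interpolant vanish
  at M nodes, more than its degree allows. The interpolant is thus constant, and row 0 makes it
  zero.\<close>

lemma ader_B_injective:
  assumes M: "M \<ge> 1" and zero: "\<And>l. l \<le> M \<Longrightarrow> (\<Sum>s\<le>M. ader_B M $$ (l, s) * y s) = 0" and "s \<le> M"
  shows "y s = 0"
proof -
  let ?p = "glb_interp M y"
  have inj: "inj_on (glb_node M) {..M}"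
    using glb_node_bij(1)[OF M] by (simp add: bij_betw_def)
  have root: "poly (pderiv ?p) (glb_node M l) = 0" if "l \<in> {1..M}" for l
    using that zero[of l] ader_B_mult_eq[OF M, of l y] glb_weight_nonzero[OF M, of l] by auto
  have "pderiv ?p = 0"
  proof (rule ccontr)
    assume ne: "pderiv ?p \<noteq> 0"
    have "card (glb_node M ` {1..M}) \<le> card {x. poly (pderiv ?p) x = 0}"
      using root by (intro card_mono poly_roots_finite ne) auto
    moreover have "card (glb_node M ` {1..M}) = M"
      by (subst card_image[OF inj_on_subset[OF inj]]) auto
    ultimately show False
      using card_poly_roots_bound[OF ne] degree_glb_interp[OF M, of y] M by (simp add: degree_pderiv)
  qed
  moreover from this have "y 0 = 0" using zero[of 0] ader_B_mult_eq[OF M, of 0 y] by simp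
  ultimately have "?p = 0"
    using pderiv_iszero[of ?p] glb_interp_node[OF M, of 0 y] by auto
  then show ?thesis using glb_interp_node[OF M \<open>s \<le> M\<close>, of y] by simp
qed

text \<open>Shows that \<open>the (mat_inverse (ader_B M))\<close> is a genuine inverse. Later
  arguments use the product identity and never compute the entries of A.\<close>

lemma ader_A_carrier:
  assumes M: "M \<ge> 1"
  shows "ader_A M \<in> carrier_mat (M + 1) (M + 1)" "ader_B M * ader_A M = ader_Lambda M"
proof -
  let ?n = "M + 1"
  have B: "ader_B M \<in> carrier_mat ?n ?n" and L: "ader_Lambda M \<in> carrier_mat ?n ?n"
    by (auto simp: ader_B_def ader_Lambda_def)
  have "det (ader_B M) \<noteq> 0"
  proof
    assume "det (ader_B M) = 0"
    then obtain v where v: "v \<in> carrier_vec ?n" "v \<noteq> 0\<^sub>v ?n" "ader_B M *\<^sub>v v = 0\<^sub>v ?n"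
      using det_0_iff_vec_prod_zero_field[OF B] by auto
    have "(\<Sum>s\<le>M. ader_B M $$ (l, s) * (vec_index v s)) = 0" if "l \<le> M" for l
    proof -
      have "vec_index (ader_B M *\<^sub>v v) l = (\<Sum>s = 0..<?n. ader_B M $$ (l, s) * vec_index v s)"
        using that B v(1) by (simp add: scalar_prod_def)
      then show ?thesis using v(3) that by (simp add: atLeast0LessThan lessThan_Suc_atMost)
    qed
    from ader_B_injective[OF M this] have "v = 0\<^sub>v ?n" using v(1) by (intro eq_vecI) auto
    then show False using v by simp
  qed
  then have "ader_B M \<in> Units (ring_mat TYPE(real) ?n (undefined :: real))"
    by (rule det_non_zero_imp_unit[OF B])
  then obtain C where C: "mat_inverse (ader_B M) = Some C"
    using mat_inverse(1)[OF B, of "undefined :: real"] by (cases "mat_inverse (ader_B M)") auto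
  then have C': "ader_B M * C = 1\<^sub>m ?n" "C \<in> carrier_mat ?n ?n" using mat_inverse(2)[OF B] by auto
  then show "ader_A M \<in> carrier_mat ?n ?n" using L by (simp add: ader_A_def C)
  show "ader_B M * ader_A M = ader_Lambda M"
    using L C' by (simp add: ader_A_def C assoc_mult_mat[OF B C'(2) L, symmetric])
qed

text \<open>Multiply the stage equations by B: the constant vector is mapped to the first unit
  vector, since its interpolant is 1, and B A is the diagonal matrix of weights. The scalar form
  serves each component of a system.\<close>

lemma ader_stages_collocation:
  assumes M: "M \<ge> 1" and "l \<le> M"
    and y: "\<And>s. s \<le> M \<Longrightarrow> y s = x + h * (\<Sum>r\<le>M. ader_A M $$ (s, r) * g r)"
  shows "(if l = 0 then y 0 - x else 0) +
    glb_weight M l * (poly (pderiv (glb_interp M y)) (glb_node M l) - h * g l) = 0"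
proof -
  note A = ader_A_carrier[OF M]
  have B: "ader_B M \<in> carrier_mat (M + 1) (M + 1)" by (simp add: ader_B_def)
  have one: "(\<Sum>s\<le>M. ader_B M $$ (l, s)) = (if l = 0 then 1 else 0)"
  proof -
    have "glb_interp M (\<lambda>_. 1) = 1" unfolding glb_interp_def
      using glb_interpolation[OF M, of 1] by simp
    then show ?thesis using ader_B_mult_eq[OF M \<open>l \<le> M\<close>, of "\<lambda>_. 1"] by simp
  qed
  have BA: "(\<Sum>s\<le>M. ader_B M $$ (l, s) * ader_A M $$ (s, r)) = (if l = r then glb_weight M l else 0)"
    if "r \<le> M" for r
  proof -
    have "(ader_B M * ader_A M) $$ (l, r) = (\<Sum>s = 0..<M + 1. ader_B M $$ (l, s) * ader_A M $$ (s, r))"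
      using that A(1) B \<open>l \<le> M\<close> by (simp add: scalar_prod_def)
    then show ?thesis
      using that \<open>l \<le> M\<close> M by (simp add: A ader_Lambda_entry atLeast0LessThan lessThan_Suc_atMost)
  qed
  have "(if l = 0 then y 0 else 0) + glb_weight M l * poly (pderiv (glb_interp M y)) (glb_node M l) =
      (\<Sum>s\<le>M. ader_B M $$ (l, s) * (x + h * (\<Sum>r\<le>M. ader_A M $$ (s, r) * g r)))"
    unfolding ader_B_mult_eq[OF M \<open>l \<le> M\<close>, symmetric] using y by simp
  also have "\<dots> = (\<Sum>s\<le>M. ader_B M $$ (l, s)) * x +
      h * (\<Sum>s\<le>M. \<Sum>r\<le>M. ader_B M $$ (l, s) * ader_A M $$ (s, r) * g r)"
    by (simp add: distrib_left sum.distrib sum_distrib_left sum_distrib_right mult_ac)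
  also have "(\<Sum>s\<le>M. \<Sum>r\<le>M. ader_B M $$ (l, s) * ader_A M $$ (s, r) * g r) =
      (\<Sum>r\<le>M. (\<Sum>s\<le>M. ader_B M $$ (l, s) * ader_A M $$ (s, r)) * g r)"
    by (subst sum.swap) (simp add: sum_distrib_right)
  also have "\<dots> = (\<Sum>r\<le>M. if l = r then glb_weight M l * g l else 0)"
    by (intro sum.cong) (auto simp: BA)
  also have "\<dots> = glb_weight M l * g l" using \<open>l \<le> M\<close> by (simp add: sum.delta')
  finally show ?thesis by (simp add: one algebra_simps split: if_splits)
qed

text \<open>Summing the collocation relations over all nodes gives the quadrature of the derivative
  of the interpolant, which is exact, and the initial value at node 0 cancels.\<close>

lemma ader_step_eq_interp:
  assumes M: "M \<ge> 1"
    and y: "\<And>s. s \<le> M \<Longrightarrow> y s = x + h * (\<Sum>r\<le>M. ader_A M $$ (s, r) * g r)"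
  shows "x + h * (\<Sum>r\<le>M. glb_weight M r * g r) = poly (glb_interp M y) 1"
proof -
  let ?p = "glb_interp M y"
  have deg: "Polynomial.degree (pderiv ?p) \<le> 2 * M - 1"
    using degree_glb_interp[OF M, of y] by (simp add: degree_pderiv)
  have "h * (\<Sum>r\<le>M. glb_weight M r * g r) = (\<Sum>r\<le>M. glb_weight M r * (h * g r))"
    by (simp add: sum_distrib_left mult_ac)
  also have "\<dots> = (\<Sum>r\<le>M. (if r = 0 then y 0 - x else 0) + glb_weight M r * poly (pderiv ?p) (glb_node M r))"
    using ader_stages_collocation[OF M _ y] by (intro sum.cong) (auto simp: algebra_simps split: if_splits)
  also have "\<dots> = y 0 - x + poly_int (pderiv ?p)"
    by (simp add: sum.distrib sum.delta poly_int_eq_glb_quadrature[OF M deg])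
  also have "\<dots> = poly ?p 1 - x"
    using glb_interp_node[OF M, of 0 y] glb_node_bij(2)[OF M] by (simp add: poly_int_pderiv)
  finally show ?thesis by simp
qed

section \<open>Families of functions that are almost polynomials in the physical time\<close>

text \<open>
  Throughout, the first argument of a family is the step size \<open>h\<close> and the second one the local time
  \<open>\<xi> \<in> [0, 1]\<close>; the physical time is \<open>h \<xi>\<close>.
\<close>

definition unif_O :: "nat \<Rightarrow> (real \<Rightarrow> real \<Rightarrow> real) \<Rightarrow> bool" where
  "unif_O k f \<longleftrightarrow> (\<exists>C. \<forall>\<^sub>F h in at 0. \<forall>\<xi>\<in>{0..1}. \<bar>f h \<xi>\<bar> \<le> C * \<bar>h\<bar> ^ k)"

lemma eventually_abs_le_1: "\<forall>\<^sub>F h in at (0::real). \<bar>h\<bar> \<le> 1"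
  unfolding eventually_at by (intro exI[of _ 1]) auto

lemma unif_O_I:
  assumes "\<forall>\<^sub>F h in at 0. \<forall>\<xi>\<in>{0..1}. \<bar>f h \<xi>\<bar> \<le> C * \<bar>h\<bar> ^ k"
  shows "unif_O k f"
  using assms unfolding unif_O_def by blast

lemma unif_O_E:
  assumes "unif_O k f"
  obtains C where "C \<ge> 0" "\<forall>\<^sub>F h in at 0. \<forall>\<xi>\<in>{0..1}. \<bar>f h \<xi>\<bar> \<le> C * \<bar>h\<bar> ^ k"
proof -
  obtain C where C: "\<forall>\<^sub>F h in at 0. \<forall>\<xi>\<in>{0..1}. \<bar>f h \<xi>\<bar> \<le> C * \<bar>h\<bar> ^ k"
    using assms unfolding unif_O_def by blast
  have "C * \<bar>h\<bar> ^ k \<le> \<bar>C\<bar> * \<bar>h\<bar> ^ k" for h :: real by (intro mult_right_mono) auto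
  then have "\<forall>\<^sub>F h in at 0. \<forall>\<xi>\<in>{0..1}. \<bar>f h \<xi>\<bar> \<le> \<bar>C\<bar> * \<bar>h\<bar> ^ k"
    using C by (auto elim!: eventually_mono intro: order_trans)
  then show thesis using that[of "\<bar>C\<bar>"] by simp
qed

lemma unif_O_cong:
  assumes "\<forall>\<^sub>F h in at 0. \<forall>\<xi>\<in>{0..1}. f h \<xi> = g h \<xi>"
  shows "unif_O k f \<longleftrightarrow> unif_O k g"
proof -
  have "unif_O k f" if "unif_O k g" "\<forall>\<^sub>F h in at 0. \<forall>\<xi>\<in>{0..1}. f h \<xi> = g h \<xi>" for f g
  proof -
    obtain C where "\<forall>\<^sub>F h in at 0. \<forall>\<xi>\<in>{0..1}. \<bar>g h \<xi>\<bar> \<le> C * \<bar>h\<bar> ^ k"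
      using \<open>unif_O k g\<close> unfolding unif_O_def by blast
    with that(2) have "\<forall>\<^sub>F h in at 0. \<forall>\<xi>\<in>{0..1}. \<bar>f h \<xi>\<bar> \<le> C * \<bar>h\<bar> ^ k"
      by eventually_elim simp
    then show ?thesis by (rule unif_O_I)
  qed
  from this[of f g] this[of g f] show ?thesis using assms by (auto simp: eq_commute)
qed

lemma unif_O_add:
  assumes "unif_O k f" "unif_O k g"
  shows "unif_O k (\<lambda>h \<xi>. f h \<xi> + g h \<xi>)"
proof -
  obtain C where "\<forall>\<^sub>F h in at 0. \<forall>\<xi>\<in>{0..1}. \<bar>f h \<xi>\<bar> \<le> C * \<bar>h\<bar> ^ k" using assms(1) by (rule unif_O_E)
  moreover obtain D where "\<forall>\<^sub>F h in at 0. \<forall>\<xi>\<in>{0..1}. \<bar>g h \<xi>\<bar> \<le> D * \<bar>h\<bar> ^ k"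
    using assms(2) by (rule unif_O_E)
  ultimately have "\<forall>\<^sub>F h in at 0. \<forall>\<xi>\<in>{0..1}. \<bar>f h \<xi> + g h \<xi>\<bar> \<le> (C + D) * \<bar>h\<bar> ^ k"
    by eventually_elim (force simp: distrib_right)
  then show ?thesis by (rule unif_O_I)
qed

lemma unif_O_mult:
  assumes "unif_O k f" "unif_O l g"
  shows "unif_O (k + l) (\<lambda>h \<xi>. f h \<xi> * g h \<xi>)"
proof -
  obtain C where "C \<ge> 0" and C: "\<forall>\<^sub>F h in at 0. \<forall>\<xi>\<in>{0..1}. \<bar>f h \<xi>\<bar> \<le> C * \<bar>h\<bar> ^ k"
    using assms(1) by (rule unif_O_E)
  obtain D where D: "\<forall>\<^sub>F h in at 0. \<forall>\<xi>\<in>{0..1}. \<bar>g h \<xi>\<bar> \<le> D * \<bar>h\<bar> ^ l"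
    using assms(2) by (rule unif_O_E)
  from C D have "\<forall>\<^sub>F h in at 0. \<forall>\<xi>\<in>{0..1}. \<bar>f h \<xi> * g h \<xi>\<bar> \<le> (C * D) * \<bar>h\<bar> ^ (k + l)"
  proof eventually_elim
    case (elim h)
    show ?case
    proof
      fix \<xi> :: real assume "\<xi> \<in> {0..1}"
      then have "\<bar>f h \<xi> * g h \<xi>\<bar> \<le> (C * \<bar>h\<bar> ^ k) * (D * \<bar>h\<bar> ^ l)"
        unfolding abs_mult using elim \<open>C \<ge> 0\<close> by (intro mult_mono) auto
      then show "\<bar>f h \<xi> * g h \<xi>\<bar> \<le> (C * D) * \<bar>h\<bar> ^ (k + l)" by (simp add: power_add mult_ac)
    qed
  qed
  then show ?thesis by (rule unif_O_I)
qed

lemma unif_O_mono: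
  assumes "unif_O l f" "k \<le> l"
  shows "unif_O k f"
proof -
  obtain C where C: "C \<ge> 0" "\<forall>\<^sub>F h in at 0. \<forall>\<xi>\<in>{0..1}. \<bar>f h \<xi>\<bar> \<le> C * \<bar>h\<bar> ^ l"
    using assms(1) by (rule unif_O_E)
  have "\<forall>\<^sub>F h in at 0. \<forall>\<xi>\<in>{0..1}. \<bar>f h \<xi>\<bar> \<le> C * \<bar>h\<bar> ^ k"
    using C(2) eventually_abs_le_1
  proof eventually_elim
    case (elim h)
    then have "C * \<bar>h\<bar> ^ l \<le> C * \<bar>h\<bar> ^ k" using C(1) assms(2) by (intro mult_left_mono power_decreasing) auto
    then show ?case using elim by (meson order_trans)
  qed
  then show ?thesis by (rule unif_O_I)
qed

lemma unif_O_const: "unif_O 0 (\<lambda>h \<xi>. c)"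
  by (rule unif_O_I[of _ "\<bar>c\<bar>"]) simp

lemma unif_O_zero: "unif_O k (\<lambda>h \<xi>. 0)"
  by (rule unif_O_I[of _ 0]) simp

lemma unif_O_h: "unif_O 1 (\<lambda>h \<xi>. h)"
  by (rule unif_O_I[of _ 1]) simp

lemma unif_O_h_mult: "unif_O k f \<Longrightarrow> unif_O (Suc k) (\<lambda>h \<xi>. h * f h \<xi>)"
  using unif_O_mult[OF unif_O_h] by simp

lemma unif_O_cmult: "unif_O k f \<Longrightarrow> unif_O k (\<lambda>h \<xi>. c * f h \<xi>)"
  using unif_O_mult[OF unif_O_const] by simp

lemma unif_O_minus: "unif_O k f \<Longrightarrow> unif_O k (\<lambda>h \<xi>. - f h \<xi>)"
  using unif_O_cmult[of k f "-1"] by simp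

lemma unif_O_diff: "unif_O k f \<Longrightarrow> unif_O k g \<Longrightarrow> unif_O k (\<lambda>h \<xi>. f h \<xi> - g h \<xi>)"
  using unif_O_add[OF _ unif_O_minus] by simp

lemma unif_O_sum:
  assumes "\<And>i. i \<in> I \<Longrightarrow> unif_O k (f i)"
  shows "unif_O k (\<lambda>h \<xi>. \<Sum>i\<in>I. f i h \<xi>)"
  using assms
  by (induction I rule: infinite_finite_induct) (auto intro: unif_O_zero unif_O_add)

text \<open>Quantities depending on \<open>h\<close> alone are treated as families constant in
  \<xi>, so that the same calculus applies to them.\<close>

lemma unif_O_at:
  assumes "unif_O k f" "a \<in> {0..1}"
  shows "unif_O k (\<lambda>h \<xi>. f h a)"
proof -
  obtain C where "\<forall>\<^sub>F h in at 0. \<forall>\<xi>\<in>{0..1}. \<bar>f h \<xi>\<bar> \<le> C * \<bar>h\<bar> ^ k"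
    using assms(1) by (rule unif_O_E)
  then have "\<forall>\<^sub>F h in at 0. \<forall>\<xi>\<in>{0..1::real}. \<bar>f h a\<bar> \<le> C * \<bar>h\<bar> ^ k"
    by eventually_elim (use assms(2) in auto)
  then show ?thesis by (rule unif_O_I)
qed

text \<open>Mean value inequality on an interval of length 1, so the order is kept; a gain has to
  come from a factor \<open>h\<close> in the derivative.\<close>

lemma unif_O_antideriv:
  assumes der: "\<forall>\<^sub>F h in at 0. \<forall>\<xi>\<in>{0..1}. (f h has_real_derivative f' h \<xi>) (at \<xi> within {0..1})"
    and "unif_O k f'" and a: "a \<in> {0..1}"
  shows "unif_O k (\<lambda>h \<xi>. f h \<xi> - f h a)"
proof -
  obtain C where C: "C \<ge> 0" "\<forall>\<^sub>F h in at 0. \<forall>\<xi>\<in>{0..1}. \<bar>f' h \<xi>\<bar> \<le> C * \<bar>h\<bar> ^ k"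
    using assms(2) by (rule unif_O_E)
  have "\<forall>\<^sub>F h in at 0. \<forall>\<xi>\<in>{0..1}. \<bar>f h \<xi> - f h a\<bar> \<le> C * \<bar>h\<bar> ^ k"
    using C(2) der
  proof eventually_elim
    case (elim h)
    show ?case
    proof
      fix \<xi> :: real assume xi: "\<xi> \<in> {0..1}"
      have "norm (f h \<xi> - f h a) \<le> C * \<bar>h\<bar> ^ k * norm (\<xi> - a)"
        by (rule field_differentiable_bound[where S = "{0..1}"]) (use elim xi a in auto)
      also have "\<dots> \<le> C * \<bar>h\<bar> ^ k * 1" using C(1) xi a by (intro mult_left_mono) auto
      finally show "\<bar>f h \<xi> - f h a\<bar> \<le> C * \<bar>h\<bar> ^ k" by simp
    qed
  qed
  then show ?thesis by (rule unif_O_I)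
qed

text \<open>Boundedness only, without continuity in \<open>h\<close>, since the stages may be
  selected differently for each \<open>h\<close>.\<close>

definition bounded_polys :: "(real \<Rightarrow> real poly) \<Rightarrow> bool" where
  "bounded_polys p \<longleftrightarrow>
    (\<exists>n C. \<forall>\<^sub>F h in at 0. Polynomial.degree (p h) \<le> n \<and> (\<forall>i. \<bar>poly.coeff (p h) i\<bar> \<le> C))"

lemma bounded_polys_add:
  assumes "bounded_polys p" "bounded_polys q"
  shows "bounded_polys (\<lambda>h. p h + q h)"
proof -
  obtain n C where "\<forall>\<^sub>F h in at 0. Polynomial.degree (p h) \<le> n \<and> (\<forall>i. \<bar>poly.coeff (p h) i\<bar> \<le> C)"
    using assms(1) unfolding bounded_polys_def by blast
  moreover obtain m D where "\<forall>\<^sub>F h in at 0. Polynomial.degree (q h) \<le> m \<and> (\<forall>i. \<bar>poly.coeff (q h) i\<bar> \<le> D)"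
    using assms(2) unfolding bounded_polys_def by blast
  ultimately have "\<forall>\<^sub>F h in at 0. Polynomial.degree (p h + q h) \<le> max n m \<and>
      (\<forall>i. \<bar>poly.coeff (p h + q h) i\<bar> \<le> C + D)"
  proof eventually_elim
    case (elim h)
    then have "\<bar>poly.coeff (p h + q h) i\<bar> \<le> C + D" for i
      by (simp add: abs_triangle_ineq[THEN order_trans] add_mono)
    then show ?case using elim by (auto intro: degree_add_le)
  qed
  then show ?thesis unfolding bounded_polys_def by blast
qed

lemma bounded_polys_mult:
  assumes "bounded_polys p" "bounded_polys q"
  shows "bounded_polys (\<lambda>h. p h * q h)"
proof -
  obtain n C where "\<forall>\<^sub>F h in at 0. Polynomial.degree (p h) \<le> n \<and> (\<forall>i. \<bar>poly.coeff (p h) i\<bar> \<le> C)"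
    using assms(1) unfolding bounded_polys_def by blast
  moreover obtain m D where "\<forall>\<^sub>F h in at 0. Polynomial.degree (q h) \<le> m \<and> (\<forall>i. \<bar>poly.coeff (q h) i\<bar> \<le> D)"
    using assms(2) unfolding bounded_polys_def by blast
  ultimately have "\<forall>\<^sub>F h in at 0. Polynomial.degree (p h * q h) \<le> n + m \<and>
      (\<forall>i. \<bar>poly.coeff (p h * q h) i\<bar> \<le> (n + m + 1) * (C * D))"
  proof eventually_elim
    case (elim h)
    have deg: "Polynomial.degree (p h * q h) \<le> n + m"
      using elim by (meson add_mono degree_mult_le order_trans)
    have C0: "C \<ge> 0" "D \<ge> 0" using elim by (meson abs_ge_zero order_trans)+
    have "\<bar>poly.coeff (p h * q h) i\<bar> \<le> (n + m + 1) * (C * D)" for i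
    proof (cases "i \<le> n + m")
      case True
      have "\<bar>poly.coeff (p h * q h) i\<bar> \<le> (\<Sum>j\<le>i. \<bar>poly.coeff (p h) j * poly.coeff (q h) (i - j)\<bar>)"
        unfolding coeff_mult by (rule sum_abs)
      also have "\<dots> \<le> (\<Sum>j\<le>i. C * D)"
        unfolding abs_mult using elim C0 by (intro sum_mono mult_mono) auto
      also have "\<dots> \<le> (n + m + 1) * (C * D)"
        using True C0 by (simp add: mult_right_mono)
      finally show ?thesis .
    next
      case False
      then show ?thesis using deg C0 by (simp add: coeff_eq_0)
    qed
    then show ?case using deg by auto
  qed
  then show ?thesis unfolding bounded_polys_def by blast
qed

lemma bounded_polys_const:
  assumes "\<forall>\<^sub>F h in at 0. \<bar>c h\<bar> \<le> C"
  shows "bounded_polys (\<lambda>h. [:c h:])"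
  unfolding bounded_polys_def
proof (intro exI)
  show "\<forall>\<^sub>F h in at 0. Polynomial.degree [:c h:] \<le> 0 \<and> (\<forall>i. \<bar>poly.coeff [:c h:] i\<bar> \<le> C)"
    using assms by eventually_elim (auto simp: coeff_pCons split: nat.splits)
qed

lemma bounded_polys_fixed: "bounded_polys (\<lambda>h. p)"
  unfolding bounded_polys_def
proof (intro exI always_eventually allI conjI)
  fix i show "\<bar>poly.coeff p i\<bar> \<le> (\<Sum>i\<le>Polynomial.degree p. \<bar>poly.coeff p i\<bar>)"
    by (cases "i \<le> Polynomial.degree p")
      (auto simp: coeff_eq_0 intro: member_le_sum sum_nonneg)
qed (rule order_refl)

lemma bounded_polys_minus: "bounded_polys p \<Longrightarrow> bounded_polys (\<lambda>h. - p h)"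
  unfolding bounded_polys_def by simp

lemma bounded_polys_pderiv:
  assumes "bounded_polys p"
  shows "bounded_polys (\<lambda>h. pderiv (p h))"
proof -
  obtain n C where "\<forall>\<^sub>F h in at 0. Polynomial.degree (p h) \<le> n \<and> (\<forall>i. \<bar>poly.coeff (p h) i\<bar> \<le> C)"
    using assms(1) unfolding bounded_polys_def by blast
  then have "\<forall>\<^sub>F h in at 0. Polynomial.degree (pderiv (p h)) \<le> n \<and>
      (\<forall>i. \<bar>poly.coeff (pderiv (p h)) i\<bar> \<le> real (n + 1) * C)"
  proof eventually_elim
    case (elim h)
    have C0: "C \<ge> 0" using elim by (meson abs_ge_zero order_trans)
    have "\<bar>poly.coeff (pderiv (p h)) i\<bar> \<le> real (n + 1) * C" for i
    proof (cases "i \<le> n")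
      case True
      then show ?thesis using elim C0
        by (simp add: coeff_pderiv abs_mult mult_mono del: of_nat_Suc)
    next
      case False
      then show ?thesis using elim C0 by (simp add: coeff_pderiv coeff_eq_0)
    qed
    moreover have "Polynomial.degree (pderiv (p h)) \<le> n"
      using elim by (auto simp: degree_pderiv)
    ultimately show ?case by blast
  qed
  then show ?thesis unfolding bounded_polys_def by blast
qed

lemma bounded_polys_cutoff:
  assumes "bounded_polys p"
  shows "bounded_polys (\<lambda>h. poly_cutoff k (p h))"
proof -
  obtain n C where "\<forall>\<^sub>F h in at 0. Polynomial.degree (p h) \<le> n \<and> (\<forall>i. \<bar>poly.coeff (p h) i\<bar> \<le> C)"
    using assms(1) unfolding bounded_polys_def by blast
  then have "\<forall>\<^sub>F h in at 0. Polynomial.degree (poly_cutoff k (p h)) \<le> n \<and>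
      (\<forall>i. \<bar>poly.coeff (poly_cutoff k (p h)) i\<bar> \<le> C)"
  proof eventually_elim
    case (elim h)
    have C0: "C \<ge> 0" using elim by (meson abs_ge_zero order_trans)
    have "Polynomial.degree (poly_cutoff k (p h)) \<le> n"
      using elim by (intro degree_le) (auto simp: coeff_poly_cutoff coeff_eq_0)
    then show ?case using elim C0 by (simp add: coeff_poly_cutoff)
  qed
  then show ?thesis unfolding bounded_polys_def by blast
qed

definition poly_antideriv :: "real poly \<Rightarrow> real poly" where
  "poly_antideriv p = pCons 0 (\<Sum>i\<le>Polynomial.degree p. monom (poly.coeff p i / real (Suc i)) i)"

lemma coeff_poly_antideriv:
  "poly.coeff (poly_antideriv p) i = (case i of 0 \<Rightarrow> 0 | Suc j \<Rightarrow> poly.coeff p j / real (Suc j))"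
  by (auto simp: poly_antideriv_def coeff_pCons coeff_sum sum.delta' coeff_eq_0 split: nat.splits)

lemma pderiv_poly_antideriv [simp]: "pderiv (poly_antideriv p) = p"
  by (intro poly_eqI) (simp add: coeff_pderiv coeff_poly_antideriv)

lemma bounded_polys_antideriv:
  assumes "bounded_polys p"
  shows "bounded_polys (\<lambda>h. poly_antideriv (p h))"
proof -
  obtain n C where "\<forall>\<^sub>F h in at 0. Polynomial.degree (p h) \<le> n \<and> (\<forall>i. \<bar>poly.coeff (p h) i\<bar> \<le> C)"
    using assms(1) unfolding bounded_polys_def by blast
  then have "\<forall>\<^sub>F h in at 0. Polynomial.degree (poly_antideriv (p h)) \<le> n + 1 \<and>
      (\<forall>i. \<bar>poly.coeff (poly_antideriv (p h)) i\<bar> \<le> C)"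
  proof eventually_elim
    case (elim h)
    have C0: "C \<ge> 0" using elim by (meson abs_ge_zero order_trans)
    have "Polynomial.degree (poly_antideriv (p h)) \<le> n + 1"
      using elim by (intro degree_le) (auto simp: coeff_poly_antideriv coeff_eq_0 split: nat.splits)
    moreover have "\<bar>poly.coeff (p h) j / real (Suc j)\<bar> \<le> C" for j
    proof -
      have "\<bar>poly.coeff (p h) j / real (Suc j)\<bar> \<le> \<bar>poly.coeff (p h) j\<bar> / 1"
        unfolding abs_divide by (intro divide_left_mono) auto
      then show ?thesis using elim by (auto intro: order_trans)
    qed
    ultimately show ?case using C0 by (simp add: coeff_poly_antideriv split: nat.splits)
  qed
  then show ?thesis unfolding bounded_polys_def by blast
qed

lemma unif_O_poly:
  assumes "bounded_polys p" "\<And>h i. i < k \<Longrightarrow> poly.coeff (p h) i = 0"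
  shows "unif_O k (\<lambda>h \<xi>. poly (p h) (h * \<xi>))"
proof -
  obtain n C where "\<forall>\<^sub>F h in at 0. Polynomial.degree (p h) \<le> n \<and> (\<forall>i. \<bar>poly.coeff (p h) i\<bar> \<le> C)"
    using assms(1) unfolding bounded_polys_def by blast
  then have "\<forall>\<^sub>F h in at 0. \<forall>\<xi>\<in>{0..1}. \<bar>poly (p h) (h * \<xi>)\<bar> \<le> ((n + 1) * C) * \<bar>h\<bar> ^ k"
    using eventually_abs_le_1
  proof eventually_elim
    case (elim h)
    have C0: "C \<ge> 0" using elim by (meson abs_ge_zero order_trans)
    show ?case
    proof
      fix \<xi> :: real assume xi: "\<xi> \<in> {0..1}"
      have le: "\<bar>h * \<xi>\<bar> \<le> \<bar>h\<bar>" using xi by (simp add: abs_mult mult_left_le)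
      have "\<bar>poly (p h) (h * \<xi>)\<bar> \<le> (\<Sum>i\<le>Polynomial.degree (p h). \<bar>poly.coeff (p h) i * (h * \<xi>) ^ i\<bar>)"
        unfolding poly_altdef by (rule sum_abs)
      also have "\<dots> \<le> (\<Sum>i\<le>Polynomial.degree (p h). C * \<bar>h\<bar> ^ k)"
      proof (intro sum_mono)
        fix i
        show "\<bar>poly.coeff (p h) i * (h * \<xi>) ^ i\<bar> \<le> C * \<bar>h\<bar> ^ k"
        proof (cases "i < k")
          case False
          have "\<bar>h * \<xi>\<bar> ^ i \<le> \<bar>h\<bar> ^ i" using le by (intro power_mono) auto
          also have "\<dots> \<le> \<bar>h\<bar> ^ k" using False elim by (intro power_decreasing) auto
          finally show ?thesis
            unfolding abs_mult power_abs[symmetric] using elim C0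
            by (intro mult_mono) (auto simp: power_abs abs_mult)
        qed (use C0 assms(2) in auto)
      qed
      also have "\<dots> \<le> ((n + 1) * C) * \<bar>h\<bar> ^ k"
        using elim C0 by (simp add: mult.assoc mult_right_mono)
      finally show "\<bar>poly (p h) (h * \<xi>)\<bar> \<le> ((n + 1) * C) * \<bar>h\<bar> ^ k" .
    qed
  qed
  then show ?thesis by (rule unif_O_I)
qed

text \<open>
  This replaces bounds \<open>O(h\<^sup>j)\<close> for the \<open>j\<close>-th \<open>\<xi>\<close>-derivatives, \<open>j < k\<close>: no derivative of a
  composition has to be computed, since the class is closed under sums and products.  The polynomials may
  depend on \<open>h\<close> arbitrarily, as long as degrees and coefficients stay bounded.
\<close>

definition graded :: "nat \<Rightarrow> (real \<Rightarrow> real \<Rightarrow> real) \<Rightarrow> bool" where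
  "graded k f \<longleftrightarrow> (\<exists>p. bounded_polys p \<and> unif_O k (\<lambda>h \<xi>. f h \<xi> - poly (p h) (h * \<xi>)))"

lemma graded_poly: "bounded_polys p \<Longrightarrow> graded k (\<lambda>h \<xi>. poly (p h) (h * \<xi>))"
  unfolding graded_def using unif_O_zero by (intro exI[of _ p]) simp

lemma graded_cong_unif_O:
  assumes "graded k f" "unif_O k (\<lambda>h \<xi>. g h \<xi> - f h \<xi>)"
  shows "graded k g"
proof -
  obtain p where "bounded_polys p" and p: "unif_O k (\<lambda>h \<xi>. f h \<xi> - poly (p h) (h * \<xi>))"
    using assms(1) unfolding graded_def by blast
  moreover have "unif_O k (\<lambda>h \<xi>. g h \<xi> - poly (p h) (h * \<xi>))"
    using unif_O_add[OF assms(2) p] by simp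
  ultimately show ?thesis unfolding graded_def by blast
qed

lemma graded_const: "graded k (\<lambda>h \<xi>. c)"
  using graded_poly[OF bounded_polys_fixed[of "[:c:]"]] by simp

lemma graded_time: "graded k (\<lambda>h \<xi>. h * \<xi>)"
  using graded_poly[OF bounded_polys_fixed[of "[:0, 1:]"]] by simp

lemma graded_unif_O: "graded k f \<Longrightarrow> unif_O 0 f"
  unfolding graded_def
proof (elim exE conjE)
  fix p assume p: "bounded_polys p" "unif_O k (\<lambda>h \<xi>. f h \<xi> - poly (p h) (h * \<xi>))"
  show "unif_O 0 f"
    using unif_O_add[OF unif_O_mono[OF p(2)] unif_O_poly[OF p(1)], of 0] by simp
qed

lemma unif_O_graded: "unif_O k f \<Longrightarrow> graded k f"
  using graded_cong_unif_O[OF graded_const[of k 0], of f] by simp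

lemma graded_add:
  assumes "graded k f" "graded k g"
  shows "graded k (\<lambda>h \<xi>. f h \<xi> + g h \<xi>)"
proof -
  obtain p q where "bounded_polys p" "unif_O k (\<lambda>h \<xi>. f h \<xi> - poly (p h) (h * \<xi>))"
    "bounded_polys q" "unif_O k (\<lambda>h \<xi>. g h \<xi> - poly (q h) (h * \<xi>))"
    using assms unfolding graded_def by blast
  then show ?thesis
    unfolding graded_def using unif_O_add bounded_polys_add
    by (intro exI[of _ "\<lambda>h. p h + q h"]) (force simp: algebra_simps)
qed

lemma graded_mult:
  assumes "graded k f" "graded k g"
  shows "graded k (\<lambda>h \<xi>. f h \<xi> * g h \<xi>)"
proof -
  obtain p q where pq: "bounded_polys p" "unif_O k (\<lambda>h \<xi>. f h \<xi> - poly (p h) (h * \<xi>))"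
    "bounded_polys q" "unif_O k (\<lambda>h \<xi>. g h \<xi> - poly (q h) (h * \<xi>))"
    using assms unfolding graded_def by blast
  \<comment> \<open>Split f g - p q as (f - p) g + p (g - q); the factors \<open>g\<close> and
    \<open>p\<close> are bounded.\<close>
  have "unif_O k (\<lambda>h \<xi>. (f h \<xi> - poly (p h) (h * \<xi>)) * g h \<xi> +
      poly (p h) (h * \<xi>) * (g h \<xi> - poly (q h) (h * \<xi>)))"
    using unif_O_mult[OF pq(2) graded_unif_O[OF assms(2)]]
      unif_O_mult[OF unif_O_poly[OF pq(1), of 0] pq(4)] by (intro unif_O_add) simp_all
  then have "unif_O k (\<lambda>h \<xi>. f h \<xi> * g h \<xi> - poly (p h * q h) (h * \<xi>))"
    by (simp add: algebra_simps)
  then show ?thesis unfolding graded_def using bounded_polys_mult[OF pq(1,3)] by blast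
qed

lemma graded_minus: "graded k f \<Longrightarrow> graded k (\<lambda>h \<xi>. - f h \<xi>)"
  using graded_mult[OF graded_const[of k "-1"]] by simp

lemma graded_diff: "graded k f \<Longrightarrow> graded k g \<Longrightarrow> graded k (\<lambda>h \<xi>. f h \<xi> - g h \<xi>)"
  using graded_add[OF _ graded_minus] by simp

lemma graded_sum:
  assumes "\<And>i. i \<in> I \<Longrightarrow> graded k (f i)"
  shows "graded k (\<lambda>h \<xi>. \<Sum>i\<in>I. f i h \<xi>)"
  using assms
  by (induction I rule: infinite_finite_induct) (auto intro: graded_const graded_add)

text \<open>Monomials of degree at least k in \<open>h * \<xi>\<close> are absorbed by the
  remainder. The degree bound is what makes interpolation and quadrature exact on the polynomial
  part.\<close>

lemma graded_cutoff:
  assumes "graded k f"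
  obtains p where "bounded_polys p" "\<And>h i. i \<ge> k \<Longrightarrow> poly.coeff (p h) i = 0"
    "unif_O k (\<lambda>h \<xi>. f h \<xi> - poly (p h) (h * \<xi>))"
proof -
  obtain p where p: "bounded_polys p" "unif_O k (\<lambda>h \<xi>. f h \<xi> - poly (p h) (h * \<xi>))"
    using assms unfolding graded_def by blast
  define q where "q h = poly_cutoff k (p h)" for h
  have q: "bounded_polys q" unfolding q_def by (rule bounded_polys_cutoff[OF p(1)])
  have "unif_O k (\<lambda>h \<xi>. poly (p h + - q h) (h * \<xi>))"
    using bounded_polys_add[OF p(1) bounded_polys_minus[OF q]]
    by (intro unif_O_poly) (auto simp: q_def coeff_poly_cutoff)
  from unif_O_add[OF p(2) this] have "unif_O k (\<lambda>h \<xi>. f h \<xi> - poly (q h) (h * \<xi>))"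
    by (simp add: algebra_simps)
  then show thesis using q by (intro that[of q]) (auto simp: q_def coeff_poly_cutoff)
qed

lemma has_derivative_poly_time:
  "((\<lambda>\<xi>. poly p (h * \<xi>)) has_real_derivative h * poly (pderiv p) (h * \<xi>)) (at \<xi> within S)"
  using DERIV_chain2[OF poly_DERIV[of p "h * \<xi>"] DERIV_cmult_Id[of h \<xi> S]]
  by (simp add: mult.commute)

text \<open>In physical time the polynomial part is integrated exactly, and the factor
  \<open>h\<close> improves the remainder by one order. This drives the bootstrap for the exact
  solution as well as the one for the stages. The bound at 0 keeps the constant of integration
  bounded.\<close>

lemma graded_antideriv:
  assumes der: "\<forall>\<^sub>F h in at 0. \<forall>\<xi>\<in>{0..1}. (f h has_real_derivative h * g h \<xi>) (at \<xi> within {0..1})"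
    and g: "graded k g" and f0: "\<forall>\<^sub>F h in at 0. \<bar>f h 0\<bar> \<le> C"
  shows "graded (Suc k) f"
proof -
  obtain p where p: "bounded_polys p" "unif_O k (\<lambda>h \<xi>. g h \<xi> - poly (p h) (h * \<xi>))"
    using g unfolding graded_def by blast
  define q where "q h = [:f h 0:] + poly_antideriv (p h)" for h
  have q: "bounded_polys q" unfolding q_def
    by (intro bounded_polys_add bounded_polys_const[OF f0] bounded_polys_antideriv p)
  have q0: "poly (q h) 0 = f h 0" for h by (simp add: q_def poly_antideriv_def)
  have "unif_O (Suc k) (\<lambda>h \<xi>. (f h \<xi> - poly (q h) (h * \<xi>)) - (f h 0 - poly (q h) (h * 0)))"
  proof (rule unif_O_antideriv[where f = "\<lambda>h \<xi>. f h \<xi> - poly (q h) (h * \<xi>)"])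
    show "unif_O (Suc k) (\<lambda>h \<xi>. h * (g h \<xi> - poly (p h) (h * \<xi>)))" by (rule unif_O_h_mult[OF p(2)])
    show "\<forall>\<^sub>F h in at 0. \<forall>\<xi>\<in>{0..1}. ((\<lambda>\<xi>. f h \<xi> - poly (q h) (h * \<xi>)) has_real_derivative
        h * (g h \<xi> - poly (p h) (h * \<xi>))) (at \<xi> within {0..1})"
      using der
    proof eventually_elim
      case (elim h)
      have "pderiv (q h) = p h" by (simp add: q_def pderiv_add)
      then have "((\<lambda>\<xi>. poly (q h) (h * \<xi>)) has_real_derivative h * poly (p h) (h * \<xi>)) (at \<xi> within {0..1})" for \<xi>
        using has_derivative_poly_time[of "q h"] by simp
      then show ?case using elim by (auto simp: right_diff_distrib intro!: DERIV_diff)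
    qed
  qed simp
  then have "unif_O (Suc k) (\<lambda>h \<xi>. f h \<xi> - poly (q h) (h * \<xi>))" by (simp add: q0)
  then show ?thesis unfolding graded_def using q by blast
qed

section \<open>Taylor expansion by polynomial functions\<close>

text \<open>Prepares integration along rays: after integrating over \<theta> the result is again a
  polynomial function of \<open>v\<close>, and the uniform degree bound allows a sum whose range
  does not depend on \<open>v\<close>.\<close>

lemma real_polynomial_function_ray:
  assumes "real_polynomial_function P"
  shows "\<exists>q n. (\<forall>\<theta> v. P (\<theta> *\<^sub>R v) = poly (q v) \<theta>) \<and> (\<forall>v. Polynomial.degree (q v) \<le> n) \<and>
    (\<forall>i. real_polynomial_function (\<lambda>v. poly.coeff (q v) i))"
  using assms
proof (induction P rule: real_polynomial_function.induct)
  case (linear f)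
  interpret bounded_linear f by fact
  have "real_polynomial_function (\<lambda>v. poly.coeff [:0, f v:] i)" for i
  proof (cases "i = 1")
    case True
    then show ?thesis using real_polynomial_function.intros(1)[OF \<open>bounded_linear f\<close>] by simp
  next
    case False
    then have "poly.coeff [:0, f v:] i = 0" for v by (simp add: coeff_pCons split: nat.splits)
    then show ?thesis by auto
  qed
  then show ?case by (intro exI[of _ "\<lambda>v. [:0, f v:]"] exI[of _ 1]) (auto simp: scaleR)
next
  case (const c)
  show ?case by (intro exI[of _ "\<lambda>v. [:c:]"] exI[of _ 0]) auto
next
  case (add f g)
  then obtain p m q n where
    f: "\<And>\<theta> v. f (\<theta> *\<^sub>R v) = poly (p v) \<theta>" "\<And>v. Polynomial.degree (p v) \<le> m"
      "\<And>i. real_polynomial_function (\<lambda>v. poly.coeff (p v) i)" and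
    g: "\<And>\<theta> v. g (\<theta> *\<^sub>R v) = poly (q v) \<theta>" "\<And>v. Polynomial.degree (q v) \<le> n"
      "\<And>i. real_polynomial_function (\<lambda>v. poly.coeff (q v) i)"
    by metis
  have "Polynomial.degree (p v + q v) \<le> max m n" for v
    using f(2)[of v] g(2)[of v] by (intro degree_add_le) auto
  then show ?case using f g by (intro exI[of _ "\<lambda>v. p v + q v"] exI[of _ "max m n"]) auto
next
  case (mult f g)
  then obtain p m q n where
    f: "\<And>\<theta> v. f (\<theta> *\<^sub>R v) = poly (p v) \<theta>" "\<And>v. Polynomial.degree (p v) \<le> m"
      "\<And>i. real_polynomial_function (\<lambda>v. poly.coeff (p v) i)" and
    g: "\<And>\<theta> v. g (\<theta> *\<^sub>R v) = poly (q v) \<theta>" "\<And>v. Polynomial.degree (q v) \<le> n"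
      "\<And>i. real_polynomial_function (\<lambda>v. poly.coeff (q v) i)"
    by metis
  have "Polynomial.degree (p v * q v) \<le> m + n" for v
    using f(2)[of v] g(2)[of v] degree_mult_le[of "p v" "q v"] by linarith
  moreover have "real_polynomial_function (\<lambda>v. poly.coeff (p v * q v) i)" for i
    unfolding coeff_mult using f(3) g(3)
    by (intro real_polynomial_function_sum real_polynomial_function.intros(4)) auto
  ultimately show ?case using f g by (intro exI[of _ "\<lambda>v. p v * q v"] exI[of _ "m + n"]) auto
qed

text \<open>Only directional derivatives are at hand in \<open>C_k\<close>, so the Taylor polynomial
  is built by induction: expand each partial derivative and integrate along the ray from
  \<open>p0\<close> to \<open>p0 + v\<close>. No higher multilinear derivatives occur.\<close>

lemma C_k_taylor:
  fixes F :: "'a::euclidean_space \<Rightarrow> real"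
  assumes "C_k k F"
  shows "\<exists>P C \<delta>. real_polynomial_function P \<and> \<delta> > 0 \<and>
    (\<forall>v. norm v \<le> \<delta> \<longrightarrow> \<bar>F (p0 + v) - P v\<bar> \<le> C * norm v ^ k)"
  using assms
proof (induction k arbitrary: F)
  case 0
  then have "isCont F p0" by (simp add: continuous_on_eq_continuous_at)
  then obtain \<delta> where \<delta>: "\<delta> > 0" "\<And>x. dist x p0 < \<delta> \<Longrightarrow> dist (F x) (F p0) < 1"
    unfolding continuous_at_eps_delta by (metis zero_less_one_class.zero_less_one)
  \<comment> \<open>Order 0 asks only for boundedness near \<open>p0\<close>, so the zero polynomial
    will do.\<close>
  have "\<bar>F (p0 + v) - 0\<bar> \<le> (\<bar>F p0\<bar> + 1) * norm v ^ 0" if "norm v \<le> \<delta> / 2" for v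
    using \<delta>(2)[of "p0 + v"] that \<open>\<delta> > 0\<close> by (simp add: dist_norm)
  then show ?case
    using \<open>\<delta> > 0\<close> by (intro exI[of _ "\<lambda>_. 0"] exI[of _ "\<bar>F p0\<bar> + 1"] exI[of _ "\<delta> / 2"]) auto
next
  case (Suc k)
  then obtain F' where F': "\<And>x. (F has_derivative F' x) (at x)" "\<And>v. C_k k (\<lambda>x. F' x v)"
    by auto
  have "\<forall>b. \<exists>P C \<delta>. real_polynomial_function P \<and> \<delta> > 0 \<and>
      (\<forall>v. norm v \<le> \<delta> \<longrightarrow> \<bar>F' (p0 + v) b - P v\<bar> \<le> C * norm v ^ k)"
    using Suc.IH[OF F'(2)] by blast
  then obtain P C \<delta> where P: "\<And>b. real_polynomial_function (P b)" "\<And>b. \<delta> b > (0::real)"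
      "\<And>b v. norm v \<le> \<delta> b \<Longrightarrow> \<bar>F' (p0 + v) b - P b v\<bar> \<le> C b * norm v ^ k"
    by metis
  obtain q n where q: "\<And>b \<theta> v. P b (\<theta> *\<^sub>R v) = poly (q b v) \<theta>"
      "\<And>b v. Polynomial.degree (q b v) \<le> n b"
      "\<And>b i. real_polynomial_function (\<lambda>v. poly.coeff (q b v) i)"
    using real_polynomial_function_ray[OF P(1)] by metis
  \<comment> \<open>The integral over \<theta> from 0 to 1 of the expanded directional derivative in
    direction \<open>v\<close>.\<close>
  define R where "R v = F p0 + (\<Sum>b\<in>Basis. (v \<bullet> b) * poly (poly_antideriv (q b v)) 1)" for v
  define \<delta>' where "\<delta>' = Min (\<delta> ` Basis)"
  have \<delta>': "\<delta>' > 0" "\<And>b. b \<in> Basis \<Longrightarrow> \<delta>' \<le> \<delta> b" using P(2) by (auto simp: \<delta>'_def)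
  define D where "D = (\<Sum>b\<in>(Basis :: 'a set). \<bar>C b\<bar>)"
  have polyR: "real_polynomial_function R"
  proof -
    have "poly (poly_antideriv (q b v)) 1 = (\<Sum>i\<le>n b. poly.coeff (q b v) i / real (Suc i))" for b v
    proof -
      have "poly (poly_antideriv (q b v)) 1 =
          (\<Sum>i\<le>Polynomial.degree (q b v). poly.coeff (q b v) i / real (Suc i))"
        by (simp add: poly_antideriv_def poly_sum poly_monom)
      also have "\<dots> = (\<Sum>i\<le>n b. poly.coeff (q b v) i / real (Suc i))"
        using q(2)[of b v] by (intro sum.mono_neutral_left) (auto simp: coeff_eq_0)
      finally show ?thesis .
    qed
    then have "real_polynomial_function (\<lambda>v. poly (poly_antideriv (q b v)) 1)" for b
      using q(3) by (simp only:) (intro real_polynomial_function_sum real_polynomial_function_divide, auto)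
    then have "real_polynomial_function (\<lambda>v. (v \<bullet> b) * poly (poly_antideriv (q b v)) 1)" for b
      by (rule real_polynomial_function.intros(4)[OF real_polynomial_function.intros(1)[OF bounded_linear_inner_left]])
    then show ?thesis unfolding R_def
      by (intro real_polynomial_function.intros(3) real_polynomial_function.intros(2)
          real_polynomial_function_sum finite_Basis)
  qed
  have "\<bar>F (p0 + v) - R v\<bar> \<le> D * norm v ^ Suc k" if v: "norm v \<le> \<delta>'" for v
  proof -
    \<comment> \<open>The Taylor error along the ray; its derivative pairs \<open>v\<close> with the
      errors of the partial derivatives, and the factor \<open>v\<close> supplies the additional
      power of the norm.\<close>
    define f where "f \<theta> = F (p0 + \<theta> *\<^sub>R v) - (\<Sum>b\<in>Basis. (v \<bullet> b) * poly (poly_antideriv (q b v)) \<theta>)" for \<theta>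
    define f' where "f' \<theta> = F' (p0 + \<theta> *\<^sub>R v) v - (\<Sum>b\<in>Basis. (v \<bullet> b) * poly (q b v) \<theta>)" for \<theta>
    have "((\<lambda>\<theta>. F (p0 + \<theta> *\<^sub>R v)) has_derivative (\<lambda>t. F' (p0 + \<theta> *\<^sub>R v) (t *\<^sub>R v))) (at \<theta> within {0..1})" for \<theta>
      by (rule has_derivative_compose[where g = F, OF _ F'(1)]) (auto intro!: derivative_eq_intros)
    moreover have "(\<lambda>t. F' (p0 + \<theta> *\<^sub>R v) (t *\<^sub>R v)) = (*) (F' (p0 + \<theta> *\<^sub>R v) v)" for \<theta>
      using linear_cmul[OF has_derivative_linear[OF F'(1)]] by (simp add: fun_eq_iff)
    ultimately have dF: "((\<lambda>\<theta>. F (p0 + \<theta> *\<^sub>R v)) has_real_derivative F' (p0 + \<theta> *\<^sub>R v) v) (at \<theta> within {0..1})" for \<theta>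
      by (simp add: has_field_derivative_def)
    have dA: "(poly (poly_antideriv p) has_real_derivative poly p \<theta>) (at \<theta> within {0..1})" for p \<theta>
      using poly_DERIV[of "poly_antideriv p" \<theta>] by (auto intro: DERIV_subset)
    have df: "(f has_real_derivative f' \<theta>) (at \<theta> within {0..1})" for \<theta>
      unfolding f_def f'_def by (intro DERIV_diff dF DERIV_sum DERIV_cmult dA)
    have bound: "norm (f' \<theta>) \<le> D * norm v ^ Suc k" if "\<theta> \<in> {0..1}" for \<theta>
    proof -
      let ?x = "p0 + \<theta> *\<^sub>R v"
      have lin: "linear (F' ?x)" using F'(1) has_derivative_linear by blast
      have "F' ?x v = (\<Sum>b\<in>Basis. (v \<bullet> b) * F' ?x b)"
        by (subst euclidean_representation[of v, symmetric])
          (simp only: linear_sum[OF lin] linear_cmul[OF lin] real_scaleR_def)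
      then have "f' \<theta> = (\<Sum>b\<in>Basis. (v \<bullet> b) * (F' ?x b - P b (\<theta> *\<^sub>R v)))"
        by (simp add: f'_def q(1) right_diff_distrib sum_subtractf)
      also have "norm \<dots> \<le> (\<Sum>b\<in>Basis. \<bar>v \<bullet> b\<bar> * \<bar>F' ?x b - P b (\<theta> *\<^sub>R v)\<bar>)"
        by (simp only: real_norm_def abs_mult[symmetric] sum_abs)
      also have "\<dots> \<le> (\<Sum>b\<in>Basis. norm v * (\<bar>C b\<bar> * norm v ^ k))"
      proof (intro sum_mono mult_mono)
        fix b :: 'a assume b: "b \<in> Basis"
        show "\<bar>v \<bullet> b\<bar> \<le> norm v" using b by (rule Basis_le_norm)
        have le: "norm (\<theta> *\<^sub>R v) \<le> norm v" using that by (simp add: mult_left_le_one_le)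
        then have "\<bar>F' ?x b - P b (\<theta> *\<^sub>R v)\<bar> \<le> C b * norm (\<theta> *\<^sub>R v) ^ k"
          using v \<delta>'(2)[OF b] by (intro P(3)) linarith
        also have "\<dots> \<le> \<bar>C b\<bar> * norm v ^ k"
          using le by (intro mult_mono power_mono) auto
        finally show "\<bar>F' ?x b - P b (\<theta> *\<^sub>R v)\<bar> \<le> \<bar>C b\<bar> * norm v ^ k" .
      qed auto
      also have "\<dots> = D * norm v ^ Suc k"
        by (simp add: D_def sum_distrib_left sum_distrib_right mult_ac)
      finally show ?thesis .
    qed
    have "norm (f 1 - f 0) \<le> D * norm v ^ Suc k * norm (1 - 0 :: real)"
      by (rule field_differentiable_bound[where S = "{0..1}" and f' = f']) (use df bound in auto)
    moreover have "f 1 - f 0 = F (p0 + v) - R v"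
      by (simp add: f_def R_def poly_antideriv_def)
    ultimately show ?thesis by simp
  qed
  then show ?case using polyR \<delta>'(1) by blast
qed

lemma C_k_inner:
  fixes f :: "'a::euclidean_space \<Rightarrow> 'b::euclidean_space"
  shows "C_k k f \<Longrightarrow> C_k k (\<lambda>x. f x \<bullet> b)"
proof (induction k arbitrary: f)
  case 0
  then show ?case by (auto intro: continuous_intros)
next
  case (Suc k)
  then obtain f' where "\<And>x. (f has_derivative f' x) (at x)" "\<And>v. C_k k (\<lambda>x. f' x v)" by auto
  then show ?case using Suc.IH
    by (auto intro!: exI[of _ "\<lambda>x v. f' x v \<bullet> b"] derivative_eq_intros)
qed

section \<open>Almost polynomial families with values in a Euclidean space\<close>

definition graded_vec :: "nat \<Rightarrow> (real \<Rightarrow> real \<Rightarrow> 'a::euclidean_space) \<Rightarrow> bool" where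
  "graded_vec k w \<longleftrightarrow> (\<forall>b\<in>Basis. graded k (\<lambda>h \<xi>. w h \<xi> \<bullet> b))"

lemma graded_bounded_linear:
  fixes f :: "'a::euclidean_space \<Rightarrow> real"
  assumes "bounded_linear f" "graded_vec k w"
  shows "graded k (\<lambda>h \<xi>. f (w h \<xi>))"
proof -
  have lin: "linear f" using assms(1) by (rule bounded_linear.linear)
  have eq: "f v = (\<Sum>b\<in>Basis. (v \<bullet> b) * f b)" for v
    by (subst euclidean_representation[of v, symmetric])
      (simp only: linear_sum[OF lin] linear_cmul[OF lin] real_scaleR_def)
  have "graded k (\<lambda>h \<xi>. \<Sum>b\<in>Basis. (w h \<xi> \<bullet> b) * f b)"
    using assms(2) by (intro graded_sum graded_mult graded_const) (simp add: graded_vec_def)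
  then show ?thesis by (simp only: eq[symmetric])
qed

lemma graded_polynomial:
  fixes P :: "'a::euclidean_space \<Rightarrow> real"
  assumes "real_polynomial_function P" "graded_vec k w"
  shows "graded k (\<lambda>h \<xi>. P (w h \<xi>))"
  using assms(1)
proof (induction P rule: real_polynomial_function.induct)
  case (linear f)
  then show ?case using assms(2) by (rule graded_bounded_linear)
qed (auto intro: graded_const graded_add graded_mult)

text \<open>
  Yields the matrix \<open>Q\<close> of the linearized error equation without remainder term.
\<close>

lemma real_polynomial_function_diff_factor:
  fixes P :: "'a::euclidean_space \<Rightarrow> real"
  assumes "real_polynomial_function P"
  shows "\<exists>Q. (\<forall>v w. P v - P w = (\<Sum>b\<in>Basis. Q b v w * ((v - w) \<bullet> b))) \<and>
    (\<forall>b k v w. graded_vec k v \<longrightarrow> graded_vec k w \<longrightarrow> graded k (\<lambda>h \<xi>. Q b (v h \<xi>) (w h \<xi>)))"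
  using assms
proof (induction P rule: real_polynomial_function.induct)
  case (linear f)
  have lin: "linear f" using linear by (rule bounded_linear.linear)
  have "f u = (\<Sum>b\<in>Basis. f b * (u \<bullet> b))" for u
    by (subst euclidean_representation[of u, symmetric])
      (simp only: linear_sum[OF lin] linear_cmul[OF lin] real_scaleR_def mult.commute)
  then have "f v - f w = (\<Sum>b\<in>Basis. f b * ((v - w) \<bullet> b))" for v w
    unfolding linear_diff[OF lin, symmetric] .
  then show ?case by (intro exI[of _ "\<lambda>b v w. f b"] conjI allI impI graded_const)
next
  case (const c)
  show ?case by (intro exI[of _ "\<lambda>b v w. 0"]) (auto intro: graded_const)
next
  case (add f g)
  obtain Q where
    Q: "\<And>v w. f v - f w = (\<Sum>b\<in>Basis. Q b v w * ((v - w) \<bullet> b))"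
      "\<And>b k v w. graded_vec k v \<Longrightarrow> graded_vec k w \<Longrightarrow> graded k (\<lambda>h \<xi>. Q b (v h \<xi>) (w h \<xi>))"
    using add.IH(1) by blast
  obtain R where
    R: "\<And>v w. g v - g w = (\<Sum>b\<in>Basis. R b v w * ((v - w) \<bullet> b))"
      "\<And>b k v w. graded_vec k v \<Longrightarrow> graded_vec k w \<Longrightarrow> graded k (\<lambda>h \<xi>. R b (v h \<xi>) (w h \<xi>))"
    using add.IH(2) by blast
  have "f v + g v - (f w + g w) = (\<Sum>b\<in>Basis. (Q b v w + R b v w) * ((v - w) \<bullet> b))" for v w
    using Q(1)[of v w] R(1)[of v w] by (simp add: distrib_right sum.distrib)
  then show ?case using Q(2) R(2)
    by (intro exI[of _ "\<lambda>b v w. Q b v w + R b v w"] conjI allI impI graded_add)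
next
  case (mult f g)
  obtain Q where
    Q: "\<And>v w. f v - f w = (\<Sum>b\<in>Basis. Q b v w * ((v - w) \<bullet> b))"
      "\<And>b k v w. graded_vec k v \<Longrightarrow> graded_vec k w \<Longrightarrow> graded k (\<lambda>h \<xi>. Q b (v h \<xi>) (w h \<xi>))"
    using mult.IH(1) by blast
  obtain R where
    R: "\<And>v w. g v - g w = (\<Sum>b\<in>Basis. R b v w * ((v - w) \<bullet> b))"
      "\<And>b k v w. graded_vec k v \<Longrightarrow> graded_vec k w \<Longrightarrow> graded k (\<lambda>h \<xi>. R b (v h \<xi>) (w h \<xi>))"
    using mult.IH(2) by blast
  have "f v * g v - f w * g w = (\<Sum>b\<in>Basis. (Q b v w * g v + f w * R b v w) * ((v - w) \<bullet> b))" for v w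
  proof -
    have "f v * g v - f w * g w = (f v - f w) * g v + f w * (g v - g w)" by (simp add: algebra_simps)
    also have "\<dots> = (\<Sum>b\<in>Basis. (Q b v w * g v + f w * R b v w) * ((v - w) \<bullet> b))"
      unfolding Q(1) R(1)
      by (simp add: sum_distrib_left sum_distrib_right sum.distrib[symmetric] algebra_simps)
    finally show ?thesis .
  qed
  then show ?case
    using Q(2) R(2) graded_polynomial[OF mult.hyps(1)] graded_polynomial[OF mult.hyps(2)]
    by (intro exI[of _ "\<lambda>b v w. Q b v w * g v + f w * R b v w"] conjI allI impI graded_add graded_mult)
qed

lemma graded_vec_Pair:
  fixes w :: "real \<Rightarrow> real \<Rightarrow> 'a::euclidean_space"
  assumes "graded_vec k w"
  shows "graded_vec k (\<lambda>h \<xi>. (h * \<xi>, w h \<xi>))"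
  using assms by (auto simp: graded_vec_def Basis_prod_def graded_time graded_const)

lemma unif_O_inner:
  fixes w :: "real \<Rightarrow> real \<Rightarrow> 'a::euclidean_space"
  assumes "unif_O k (\<lambda>h \<xi>. norm (w h \<xi>))" "b \<in> Basis"
  shows "unif_O k (\<lambda>h \<xi>. w h \<xi> \<bullet> b)"
proof -
  obtain C where "\<forall>\<^sub>F h in at 0. \<forall>\<xi>\<in>{0..1}. \<bar>norm (w h \<xi>)\<bar> \<le> C * \<bar>h\<bar> ^ k"
    using assms(1) by (rule unif_O_E)
  then have "\<forall>\<^sub>F h in at 0. \<forall>\<xi>\<in>{0..1}. \<bar>w h \<xi> \<bullet> b\<bar> \<le> C * \<bar>h\<bar> ^ k"
    by eventually_elim (use Basis_le_norm[OF assms(2)] in \<open>auto intro: order_trans\<close>)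
  then show ?thesis by (rule unif_O_I)
qed

lemma unif_O_norm:
  fixes w :: "real \<Rightarrow> real \<Rightarrow> 'a::euclidean_space"
  assumes "\<And>b. b \<in> Basis \<Longrightarrow> unif_O k (\<lambda>h \<xi>. w h \<xi> \<bullet> b)"
  shows "unif_O k (\<lambda>h \<xi>. norm (w h \<xi>))"
proof -
  have "unif_O k (\<lambda>h \<xi>. \<Sum>b\<in>Basis. \<bar>w h \<xi> \<bullet> b\<bar>)"
    using assms by (intro unif_O_sum) (auto simp: unif_O_def)
  then obtain C where "\<forall>\<^sub>F h in at 0. \<forall>\<xi>\<in>{0..1}. \<bar>\<Sum>b\<in>Basis. \<bar>w h \<xi> \<bullet> b\<bar>\<bar> \<le> C * \<bar>h\<bar> ^ k"
    by (rule unif_O_E)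
  then have "\<forall>\<^sub>F h in at 0. \<forall>\<xi>\<in>{0..1}. \<bar>norm (w h \<xi>)\<bar> \<le> C * \<bar>h\<bar> ^ k"
  proof eventually_elim
    case (elim h)
    show ?case
    proof
      fix \<xi> :: real assume "\<xi> \<in> {0..1}"
      then show "\<bar>norm (w h \<xi>)\<bar> \<le> C * \<bar>h\<bar> ^ k"
        using elim norm_le_l1[of "w h \<xi>"] by (auto intro: order_trans[OF _ order_trans[OF abs_ge_self]])
    qed
  qed
  then show ?thesis by (rule unif_O_I)
qed

text \<open>The increment has norm at most (1 + D) |h|, so a remainder of order k in space becomes
  one of order k in \<open>h\<close>. Apart from being O(h), \<open>w\<close> is arbitrary.\<close>

lemma unif_O_taylor:
  fixes F P :: "real \<times> 'a::euclidean_space \<Rightarrow> real"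
  assumes "\<delta> > 0" and P: "\<And>v. norm v \<le> \<delta> \<Longrightarrow> \<bar>F (p0 + v) - P v\<bar> \<le> C * norm v ^ k"
    and w: "unif_O 1 (\<lambda>h \<xi>. norm (w h \<xi>))"
  shows "unif_O k (\<lambda>h \<xi>. F (p0 + (h * \<xi>, w h \<xi>)) - P (h * \<xi>, w h \<xi>))"
proof -
  obtain D where D: "D \<ge> 0" "\<forall>\<^sub>F h in at 0. \<forall>\<xi>\<in>{0..1}. \<bar>norm (w h \<xi>)\<bar> \<le> D * \<bar>h\<bar> ^ 1"
    using w by (rule unif_O_E)
  have small: "\<forall>\<^sub>F h in at 0. \<bar>h\<bar> < \<delta> / (1 + D)"
    using \<open>\<delta> > 0\<close> D(1) by (auto simp: eventually_at intro!: exI[of _ "\<delta> / (1 + D)"])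
  have "\<forall>\<^sub>F h in at 0. \<forall>\<xi>\<in>{0..1}. \<bar>F (p0 + (h * \<xi>, w h \<xi>)) - P (h * \<xi>, w h \<xi>)\<bar> \<le>
      \<bar>C\<bar> * (1 + D) ^ k * \<bar>h\<bar> ^ k"
    using D(2) small
  proof eventually_elim
    case (elim h)
    show ?case
    proof
      fix \<xi> :: real assume xi: "\<xi> \<in> {0..1}"
      have "norm (h * \<xi>, w h \<xi>) \<le> norm (h * \<xi>) + norm (w h \<xi>)" by (rule norm_Pair_le)
      also have "\<dots> \<le> \<bar>h\<bar> + D * \<bar>h\<bar>"
        using elim xi by (intro add_mono) (auto simp: abs_mult mult_left_le)
      finally have n: "norm (h * \<xi>, w h \<xi>) \<le> (1 + D) * \<bar>h\<bar>" by (simp add: algebra_simps)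
      also have "\<dots> \<le> \<delta>" using elim(2) D(1) by (simp add: field_simps)
      finally have "\<bar>F (p0 + (h * \<xi>, w h \<xi>)) - P (h * \<xi>, w h \<xi>)\<bar> \<le> C * norm (h * \<xi>, w h \<xi>) ^ k"
        by (rule P)
      also have "\<dots> \<le> \<bar>C\<bar> * ((1 + D) * \<bar>h\<bar>) ^ k"
        using n by (intro mult_mono power_mono) auto
      finally show "\<bar>F (p0 + (h * \<xi>, w h \<xi>)) - P (h * \<xi>, w h \<xi>)\<bar> \<le> \<bar>C\<bar> * (1 + D) ^ k * \<bar>h\<bar> ^ k"
        by (simp add: power_mult_distrib mult_ac)
    qed
  qed
  then show ?thesis by (rule unif_O_I)
qed

section \<open>Superconvergence\<close>

text \<open>The bounds at the finitely many nodes may have different constants and neighbourhoods;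
  these are merged before values are turned into coefficients.\<close>

lemma coeff_unif_O:
  fixes N :: "real set"
  assumes N: "finite N" and deg: "\<forall>\<^sub>F h in at 0. Polynomial.degree (d h) < card N"
    and bound: "\<And>x. x \<in> N \<Longrightarrow> \<exists>C. \<forall>\<^sub>F h in at 0. \<bar>poly (d h) x\<bar> \<le> C * \<bar>h\<bar> ^ k"
  obtains C where "C \<ge> 0" "\<forall>\<^sub>F h in at 0. \<forall>i. \<bar>poly.coeff (d h) i\<bar> \<le> C * \<bar>h\<bar> ^ k"
proof -
  obtain C where C: "C \<ge> 0" "\<And>p e i. Polynomial.degree p < card N \<Longrightarrow> (\<forall>x\<in>N. \<bar>poly p x\<bar> \<le> e) \<Longrightarrow> 0 \<le> e \<Longrightarrow>
      \<bar>poly.coeff p i\<bar> \<le> C * e"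
    using lagrange_coeff_bound[OF N] by blast
  obtain c where c: "\<And>x. x \<in> N \<Longrightarrow> \<forall>\<^sub>F h in at 0. \<bar>poly (d h) x\<bar> \<le> c x * \<bar>h\<bar> ^ k"
    using bound by metis
  define D where "D = (\<Sum>x\<in>N. \<bar>c x\<bar>)"
  have "D \<ge> 0" by (simp add: D_def sum_nonneg)
  have "\<forall>\<^sub>F h in at 0. \<forall>x\<in>N. \<bar>poly (d h) x\<bar> \<le> c x * \<bar>h\<bar> ^ k"
    using c by (intro eventually_ball_finite N) auto
  then have "\<forall>\<^sub>F h in at 0. \<forall>i. \<bar>poly.coeff (d h) i\<bar> \<le> (C * D) * \<bar>h\<bar> ^ k"
    using deg
  proof eventually_elim
    case (elim h)
    have "\<bar>poly (d h) x\<bar> \<le> D * \<bar>h\<bar> ^ k" if "x \<in> N" for x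
    proof -
      have "c x \<le> D" unfolding D_def using N that member_le_sum[of x N "\<lambda>x. \<bar>c x\<bar>"] by fastforce
      then have "c x * \<bar>h\<bar> ^ k \<le> D * \<bar>h\<bar> ^ k" by (intro mult_right_mono) auto
      then show ?thesis using elim that by fastforce
    qed
    then show ?case using C(2)[of "d h" "D * \<bar>h\<bar> ^ k"] elim \<open>D \<ge> 0\<close> by (simp add: mult.assoc)
  qed
  then show thesis using C(1) \<open>D \<ge> 0\<close> by (intro that[of "C * D"]) auto
qed

lemma unif_O_coeff:
  assumes deg: "\<forall>\<^sub>F h in at 0. Polynomial.degree (d h) \<le> n" and C: "C \<ge> 0"
    and bound: "\<forall>\<^sub>F h in at 0. \<forall>i. \<bar>poly.coeff (d h) i\<bar> \<le> C * \<bar>h\<bar> ^ k"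
  shows "unif_O k (\<lambda>h. poly (d h))"
proof -
  have "\<forall>\<^sub>F h in at 0. \<forall>\<xi>\<in>{0..1}. \<bar>poly (d h) \<xi>\<bar> \<le> ((n + 1) * C) * \<bar>h\<bar> ^ k"
    using deg bound
  proof eventually_elim
    case (elim h)
    show ?case
    proof
      fix \<xi> :: real assume xi: "\<xi> \<in> {0..1}"
      have "\<bar>poly (d h) \<xi>\<bar> \<le> (\<Sum>i\<le>Polynomial.degree (d h). \<bar>poly.coeff (d h) i * \<xi> ^ i\<bar>)"
        unfolding poly_altdef by (rule sum_abs)
      also have "\<dots> \<le> (\<Sum>i\<le>Polynomial.degree (d h). (C * \<bar>h\<bar> ^ k) * 1)"
        unfolding abs_mult using elim xi C
        by (intro sum_mono mult_mono) (auto simp: power_le_one power_abs)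
      also have "\<dots> \<le> ((n + 1) * C) * \<bar>h\<bar> ^ k"
        using elim C by (simp add: mult.assoc mult_right_mono)
      finally show "\<bar>poly (d h) \<xi>\<bar> \<le> ((n + 1) * C) * \<bar>h\<bar> ^ k" .
    qed
  qed
  then show ?thesis by (rule unif_O_I)
qed

lemma unif_O_bound_at:
  assumes "unif_O k f" "x \<in> {0..1}"
  shows "\<exists>C. \<forall>\<^sub>F h in at 0. \<bar>f h x\<bar> \<le> C * \<bar>h\<bar> ^ k"
proof -
  obtain C where "\<forall>\<^sub>F h in at 0. \<forall>\<xi>\<in>{0..1}. \<bar>f h \<xi>\<bar> \<le> C * \<bar>h\<bar> ^ k" using assms(1) by (rule unif_O_E)
  then have "\<forall>\<^sub>F h in at 0. \<bar>f h x\<bar> \<le> C * \<bar>h\<bar> ^ k" by eventually_elim (use assms(2) in auto)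
  then show ?thesis by blast
qed

lemma eventually_at_nonzero: "\<forall>\<^sub>F h in at (0::real). h \<noteq> 0"
  by (simp add: eventually_neq_at_within)

lemma glb_node_range:
  assumes "M \<ge> 1" "m \<le> M" shows "glb_node M m \<in> {0..1}"
  using glb_node_bij(1)[OF assms(1)] glb_points_props(3)[OF assms(1)] assms(2)
  by (meson atMost_iff bij_betwE subsetD)

lemma card_glb_node_image:
  assumes "M \<ge> 1" "A \<subseteq> {..M}" shows "card (glb_node M ` A) = card A"
  using glb_node_bij(1)[OF assms(1)] assms(2) by (meson bij_betw_def card_image inj_on_subset)

text \<open>
  Bootstrapping: \<open>w'\<close> is \<open>h\<close> times the interpolant of \<open>g\<close> at the \<open>M\<close> nodes other than \<open>0\<close>, and interpolation
  reproduces polynomials of degree less than \<open>j \<le> M\<close>.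
\<close>

lemma collocation_graded_Suc:
  assumes M: "M \<ge> 1" and j: "j \<le> M"
    and deg: "\<And>h. Polynomial.degree (w h) \<le> M"
    and node: "\<forall>\<^sub>F h in at 0. \<forall>l\<in>{1..M}. poly (pderiv (w h)) (glb_node M l) = h * g h (glb_node M l)"
    and g: "graded j g" and bdd: "unif_O 0 (\<lambda>h. poly (w h))"
  shows "graded (Suc j) (\<lambda>h. poly (w h))"
proof -
  obtain q where q: "bounded_polys q" "\<And>h i. i \<ge> j \<Longrightarrow> poly.coeff (q h) i = 0"
    "unif_O j (\<lambda>h \<xi>. g h \<xi> - poly (q h) (h * \<xi>))"
    using graded_cutoff[OF g] by blast
  \<comment> \<open>As j is at most M, \<open>d h\<close> has degree at most M - 1, so its values at
    the M nodes other than 0, which are O(h^(j + 1)), control all its coefficients.\<close>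
  define d where "d h = pderiv (w h) - Polynomial.smult h (pcompose (q h) [:0, h:])" for h
  have degd: "Polynomial.degree (d h) \<le> M - 1" for h
  proof -
    have "Polynomial.degree (pcompose (q h) [:0, h:]) \<le> M - 1"
      using q(2)[of _ h] j M by (intro degree_le) (auto simp: coeff_pcompose_linear)
    then show ?thesis unfolding d_def using deg[of h]
      by (intro degree_diff_le order_trans[OF degree_smult_le]) (auto simp: degree_pderiv)
  qed
  obtain C where C: "C \<ge> 0" "\<forall>\<^sub>F h in at 0. \<forall>i. \<bar>poly.coeff (d h) i\<bar> \<le> C * \<bar>h\<bar> ^ Suc j"
  proof (rule coeff_unif_O[where N = "glb_node M ` {1..M}" and d = d and k = "Suc j"])
    have "card (glb_node M ` {1..M}) = M" by (subst card_glb_node_image[OF M]) auto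
    then have "Polynomial.degree (d h) < card (glb_node M ` {1..M})" for h
      using degd[of h] M by simp
    then show "\<forall>\<^sub>F h in at 0. Polynomial.degree (d h) < card (glb_node M ` {1..M})" by simp
    fix x assume "x \<in> glb_node M ` {1..M}"
    then obtain l where l: "l \<in> {1..M}" "x = glb_node M l" by blast
    then have "x \<in> {0..1}" using glb_node_range[OF M] by auto
    then obtain C where "\<forall>\<^sub>F h in at 0. \<bar>g h x - poly (q h) (h * x)\<bar> \<le> C * \<bar>h\<bar> ^ j"
      using unif_O_bound_at[OF q(3)] by blast
    then have "\<forall>\<^sub>F h in at 0. \<bar>poly (d h) x\<bar> \<le> C * \<bar>h\<bar> ^ Suc j"
      using node
    proof eventually_elim
      case (elim h)
      have "poly (d h) x = h * (g h x - poly (q h) (h * x))"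
        using elim(2) l by (auto simp: d_def poly_pcompose algebra_simps)
      then show ?case using mult_left_mono[OF elim(1), of "\<bar>h\<bar>"] by (simp add: abs_mult mult_ac)
    qed
    then show "\<exists>C. \<forall>\<^sub>F h in at 0. \<bar>poly (d h) x\<bar> \<le> C * \<bar>h\<bar> ^ Suc j" by blast
  qed auto
  \<comment> \<open>The derivative of \<open>w h\<close> in physical time; the division by
    \<open>h\<close> costs the extra order of \<open>d\<close>.\<close>
  define f where "f h \<xi> = poly (q h) (h * \<xi>) + poly (Polynomial.smult (1 / h) (d h)) \<xi>" for h \<xi>
  have "unif_O j (\<lambda>h. poly (Polynomial.smult (1 / h) (d h)))"
  proof (rule unif_O_coeff[OF _ C(1)])
    show "\<forall>\<^sub>F h in at 0. Polynomial.degree (Polynomial.smult (1 / h) (d h)) \<le> M"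
      by (intro always_eventually allI order_trans[OF degree_smult_le] order_trans[OF degd]) simp
    show "\<forall>\<^sub>F h in at 0. \<forall>i. \<bar>poly.coeff (Polynomial.smult (1 / h) (d h)) i\<bar> \<le> C * \<bar>h\<bar> ^ j"
      using C(2) eventually_at_nonzero
      by eventually_elim (simp add: abs_mult abs_divide divide_simps mult_ac)
  qed
  then have "graded j f"
    unfolding f_def by (intro graded_add graded_poly q(1)) (rule unif_O_graded)
  moreover have "\<forall>\<^sub>F h in at 0. \<forall>\<xi>\<in>{0..1}. (poly (w h) has_real_derivative h * f h \<xi>) (at \<xi> within {0..1})"
    using eventually_at_nonzero
  proof eventually_elim
    case (elim h)
    have "h * f h \<xi> = poly (pderiv (w h)) \<xi>" for \<xi>
      using elim by (simp add: f_def d_def poly_pcompose algebra_simps)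
    then show ?case using has_field_derivative_at_within[OF poly_DERIV[of "w h"]] by simp
  qed
  moreover obtain D where "\<forall>\<^sub>F h in at 0. \<bar>poly (w h) 0\<bar> \<le> D"
    using unif_O_bound_at[OF bdd, of 0] by auto
  ultimately show ?thesis by (intro graded_antideriv[where g = f])
qed

text \<open>
  For a polynomial of degree at most \<open>M\<close>, accuracy \<open>O(h\<^sup>M\<^sup>+\<^sup>1)\<close> makes the approximation by polynomials in
  \<open>h \<xi>\<close> exact, because dividing the \<open>i\<close>-th coefficient of the error by \<open>h\<^sup>i\<close> still leaves \<open>O(h)\<close>.
\<close>

lemma graded_exact:
  assumes M: "M \<ge> 1" and deg: "\<And>h. Polynomial.degree (w h) \<le> M"
    and w: "graded (Suc M) (\<lambda>h. poly (w h))"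
  shows "\<exists>q. bounded_polys q \<and> (\<forall>h. h \<noteq> 0 \<longrightarrow> w h = pcompose (q h) [:0, h:])"
proof -
  obtain q where q: "bounded_polys q" "\<And>h i. i \<ge> Suc M \<Longrightarrow> poly.coeff (q h) i = 0"
    "unif_O (Suc M) (\<lambda>h \<xi>. poly (w h) \<xi> - poly (q h) (h * \<xi>))"
    using graded_cutoff[OF w] by blast
  define d where "d h = w h - pcompose (q h) [:0, h:]" for h
  have degd: "Polynomial.degree (d h) \<le> M" for h
  proof -
    have "Polynomial.degree (pcompose (q h) [:0, h:]) \<le> M"
      using q(2)[of _ h] by (intro degree_le) (auto simp: coeff_pcompose_linear)
    then show ?thesis unfolding d_def using deg[of h] by (intro degree_diff_le)
  qed
  obtain C where C: "C \<ge> 0" "\<forall>\<^sub>F h in at 0. \<forall>i. \<bar>poly.coeff (d h) i\<bar> \<le> C * \<bar>h\<bar> ^ Suc M"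
  proof (rule coeff_unif_O[where N = "glb_points M" and d = d and k = "Suc M"])
    note P = glb_points_props[OF M]
    show "finite (glb_points M)" by (rule P)
    have "Polynomial.degree (d h) < card (glb_points M)" for h using degd[of h] P by simp
    then show "\<forall>\<^sub>F h in at 0. Polynomial.degree (d h) < card (glb_points M)" by simp
    fix x assume "x \<in> glb_points M"
    then have "x \<in> {0..1}" using P by auto
    moreover have "poly (d h) x = poly (w h) x - poly (q h) (h * x)" for h
      by (simp add: d_def poly_pcompose mult.commute)
    ultimately show "\<exists>C. \<forall>\<^sub>F h in at 0. \<bar>poly (d h) x\<bar> \<le> C * \<bar>h\<bar> ^ Suc M"
      using unif_O_bound_at[OF q(3)] by simp
  qed auto
  \<comment> \<open>The same polynomial in physical time: the i-th coefficient is divided by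
    h^i.\<close>
  define r where "r h = pcompose (w h) [:0, 1 / h:]" for h
  have "w h = pcompose (r h) [:0, h:]" if "h \<noteq> 0" for h
    using that by (simp add: r_def pcompose_assoc[symmetric] pcompose_pCons pcompose_idR)
  moreover have "bounded_polys r"
  proof -
    obtain n D where "\<forall>\<^sub>F h in at 0. Polynomial.degree (q h) \<le> n \<and> (\<forall>i. \<bar>poly.coeff (q h) i\<bar> \<le> D)"
      using q(1) unfolding bounded_polys_def by blast
    then have "\<forall>\<^sub>F h in at 0. Polynomial.degree (r h) \<le> M \<and> (\<forall>i. \<bar>poly.coeff (r h) i\<bar> \<le> C + D)"
      using C(2) eventually_at_nonzero eventually_abs_le_1
    proof eventually_elim
      case (elim h)
      have degr: "Polynomial.degree (r h) \<le> M"
        using deg[of h] by (intro degree_le) (auto simp: r_def coeff_pcompose_linear coeff_eq_0)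
      have D0: "D \<ge> 0" using elim by (meson abs_ge_zero order_trans)
      have "\<bar>poly.coeff (r h) i\<bar> \<le> C + D" for i
      proof (cases "i \<le> M")
        case True
        have "poly.coeff (r h) i = poly.coeff (d h) i / h ^ i + poly.coeff (q h) i"
          using elim(3) by (simp add: r_def d_def coeff_pcompose_linear field_simps)
        moreover have "\<bar>poly.coeff (d h) i / h ^ i\<bar> \<le> C"
        proof -
          have "\<bar>poly.coeff (d h) i\<bar> \<le> C * \<bar>h\<bar> ^ Suc M" using elim by blast
          also have "\<dots> \<le> C * \<bar>h\<bar> ^ i"
            using C(1) True elim by (intro mult_left_mono power_decreasing) auto
          finally show ?thesis using elim(3) by (simp add: abs_divide power_abs divide_simps)
        qed
        moreover have "\<bar>poly.coeff (q h) i\<bar> \<le> D" using elim by blast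
        ultimately show ?thesis by linarith
      next
        case False
        then show ?thesis using degr C(1) D0 by (simp add: coeff_eq_0)
      qed
      then show ?case using degr by blast
    qed
    then show ?thesis unfolding bounded_polys_def by blast
  qed
  ultimately show ?thesis by blast
qed

text \<open>
  Picard iteration for the adjoint equation; every step gains one power of \<open>h\<close> in the defect.
\<close>

lemma adjoint_approximation:
  fixes q :: "'i \<Rightarrow> 'i \<Rightarrow> real \<Rightarrow> real \<Rightarrow> real"
  assumes q: "\<And>c b. c \<in> I \<Longrightarrow> b \<in> I \<Longrightarrow> graded N (q c b)" and "n \<le> N"
  shows "\<exists>p. \<forall>b\<in>I. bounded_polys (p b) \<and> (\<forall>h. poly (p b h) h = (if b = \<eta> then 1 else 0)) \<and>
    unif_O n (\<lambda>h \<xi>. poly (pderiv (p b h)) (h * \<xi>) + (\<Sum>c\<in>I. q c b h \<xi> * poly (p c h) (h * \<xi>)))"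
  using assms(2)
proof (induction n)
  case 0
  have "unif_O 0 (\<lambda>h \<xi>. \<Sum>c\<in>I. q c b h \<xi> * (if c = \<eta> then 1 else 0))" if "b \<in> I" for b
    using that by (intro graded_unif_O[of N] graded_sum graded_mult graded_const q)
  then show ?case
    by (intro exI[of _ "\<lambda>b h. [:if b = \<eta> then 1 else 0:]"] ballI conjI bounded_polys_fixed)
      (simp_all add: pderiv_pCons)
next
  case (Suc n)
  from Suc.IH[OF Suc_leD[OF Suc.prems]] obtain p where p: "\<And>b. b \<in> I \<Longrightarrow> bounded_polys (p b)"
    "\<And>b h. b \<in> I \<Longrightarrow> poly (p b h) h = (if b = \<eta> then 1 else 0)"
    "\<And>b. b \<in> I \<Longrightarrow> unif_O n (\<lambda>h \<xi>. poly (pderiv (p b h)) (h * \<xi>) + (\<Sum>c\<in>I. q c b h \<xi> * poly (p c h) (h * \<xi>)))"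
    by blast
  have "\<exists>a. bounded_polys a \<and> unif_O N (\<lambda>h \<xi>. (\<Sum>c\<in>I. q c b h \<xi> * poly (p c h) (h * \<xi>)) - poly (a h) (h * \<xi>))"
    if "b \<in> I" for b
    unfolding graded_def[symmetric]
    using that by (intro graded_sum graded_mult graded_poly p q)
  then have "\<exists>a. \<forall>b\<in>I. bounded_polys (a b) \<and>
      unif_O N (\<lambda>h \<xi>. (\<Sum>c\<in>I. q c b h \<xi> * poly (p c h) (h * \<xi>)) - poly (a b h) (h * \<xi>))"
    by (intro bchoice) auto
  then obtain a where a: "\<And>b. b \<in> I \<Longrightarrow> bounded_polys (a b)"
    "\<And>b. b \<in> I \<Longrightarrow> unif_O N (\<lambda>h \<xi>. (\<Sum>c\<in>I. q c b h \<xi> * poly (p c h) (h * \<xi>)) - poly (a b h) (h * \<xi>))"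
    by blast
  \<comment> \<open>The Picard iterate, integrated backwards from physical time \<open>h\<close>,
    that is \<xi> = 1, where the end value is met exactly. Using the polynomial \<open>a\<close> for
    the right-hand side keeps the iterates polynomial.\<close>
  define r where "r b h = [:(if b = \<eta> then 1 else 0) + poly (poly_antideriv (a b h)) h:] - poly_antideriv (a b h)" for b h
  have bdd: "bounded_polys (r b)" if b: "b \<in> I" for b
  proof -
    note A = bounded_polys_antideriv[OF a(1)[OF b]]
    obtain C where "\<forall>\<^sub>F h in at 0. \<bar>poly (poly_antideriv (a b h)) h\<bar> \<le> C"
      using unif_O_bound_at[OF unif_O_poly[OF A, of 0], of 1] by auto
    then have "\<forall>\<^sub>F h in at 0. \<bar>(if b = \<eta> then 1 else 0) + poly (poly_antideriv (a b h)) h\<bar> \<le> 1 + C"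
      by eventually_elim auto
    then show ?thesis
      unfolding r_def diff_conv_add_uminus
      by (intro bounded_polys_add bounded_polys_minus A bounded_polys_const)
  qed
  have rh: "poly (r b h) h = (if b = \<eta> then 1 else 0)" for b h by (simp add: r_def)
  have r': "pderiv (r b h) = - a b h" for b h by (simp add: r_def pderiv_diff pderiv_pCons)
  \<comment> \<open>The iterates agree at \<xi> = 1, and their derivatives in physical time differ
    by the old defect, up to the error of \<open>a\<close>; integration in \<xi> adds the factor
    \<open>h\<close>.\<close>
  have diff: "unif_O (Suc n) (\<lambda>h \<xi>. poly (r b h) (h * \<xi>) - poly (p b h) (h * \<xi>))" if b: "b \<in> I" for b
  proof -
    have "unif_O n (\<lambda>h \<xi>. ((\<Sum>c\<in>I. q c b h \<xi> * poly (p c h) (h * \<xi>)) - poly (a b h) (h * \<xi>)) -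
        (poly (pderiv (p b h)) (h * \<xi>) + (\<Sum>c\<in>I. q c b h \<xi> * poly (p c h) (h * \<xi>))))"
      using Suc.prems by (intro unif_O_diff p(3)[OF b] unif_O_mono[OF a(2)[OF b]]) auto
    then have "unif_O n (\<lambda>h \<xi>. poly (pderiv (r b h)) (h * \<xi>) - poly (pderiv (p b h)) (h * \<xi>))"
      by (simp add: r' algebra_simps)
    note unif_O_h_mult[OF this]
    from unif_O_antideriv[OF _ this, of "\<lambda>h \<xi>. poly (r b h) (h * \<xi>) - poly (p b h) (h * \<xi>)" 1]
    show ?thesis
      by (simp add: rh p(2)[OF b] right_diff_distrib DERIV_diff has_derivative_poly_time)
  qed
  have "unif_O (Suc n) (\<lambda>h \<xi>. poly (pderiv (r b h)) (h * \<xi>) + (\<Sum>c\<in>I. q c b h \<xi> * poly (r c h) (h * \<xi>)))"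
    if b: "b \<in> I" for b
  proof -
    have "unif_O (Suc n) (\<lambda>h \<xi>. q c b h \<xi> * (poly (r c h) (h * \<xi>) - poly (p c h) (h * \<xi>)))"
      if "c \<in> I" for c
      using unif_O_mult[OF graded_unif_O[OF q[OF that b]] diff[OF that]] by simp
    then have "unif_O (Suc n) (\<lambda>h \<xi>. ((\<Sum>c\<in>I. q c b h \<xi> * poly (p c h) (h * \<xi>)) - poly (a b h) (h * \<xi>)) +
        (\<Sum>c\<in>I. q c b h \<xi> * (poly (r c h) (h * \<xi>) - poly (p c h) (h * \<xi>))))"
      using Suc.prems by (intro unif_O_add unif_O_mono[OF a(2)[OF b]] unif_O_sum)
    then show ?thesis by (simp add: r' right_diff_distrib sum_subtractf)
  qed
  then show ?case using bdd rh by (intro exI[of _ r]) auto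
qed


text \<open>The duality argument for displacements from the initial value: \<open>w\<close> are the
  stage polynomials and \<open>z\<close> the exact solution, \<open>gw\<close> and \<open>gz\<close>
  the right-hand sides along them, and \<open>q\<close> plays the part of the matrix. Linearization,
  adjoint equation and polynomial approximation may each fail by O(h^(2 M)), since each of these
  errors is finally multiplied by \<open>h\<close>.\<close>

lemma superconvergence:
  fixes w \<omega> :: "'i \<Rightarrow> real \<Rightarrow> real poly" and z gw gz :: "'i \<Rightarrow> real \<Rightarrow> real \<Rightarrow> real"
  assumes M: "M \<ge> 1" and I: "finite I" "\<eta> \<in> I"
    and \<omega>: "\<And>c. c \<in> I \<Longrightarrow> bounded_polys (\<omega> c)"
      "\<And>c h. c \<in> I \<Longrightarrow> h \<noteq> 0 \<Longrightarrow> w c h = pcompose (\<omega> c h) [:0, h:]"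
    and z: "\<And>c. c \<in> I \<Longrightarrow> graded (2 * M) (z c)" "\<And>c h. c \<in> I \<Longrightarrow> z c h 0 = 0"
      "\<And>c. c \<in> I \<Longrightarrow> \<forall>\<^sub>F h in at 0. \<forall>\<xi>\<in>{0..1}. (z c h has_real_derivative h * gz c h \<xi>) (at \<xi> within {0..1})"
    and gw: "\<And>c. c \<in> I \<Longrightarrow> graded (2 * M) (gw c)"
    and q: "\<And>c b. c \<in> I \<Longrightarrow> b \<in> I \<Longrightarrow> graded (2 * M) (q c b)"
    and lin: "\<And>c. c \<in> I \<Longrightarrow>
      unif_O (2 * M) (\<lambda>h \<xi>. gw c h \<xi> - gz c h \<xi> - (\<Sum>b\<in>I. q c b h \<xi> * (poly (w b h) \<xi> - z b h \<xi>)))"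
    and node: "\<And>c. c \<in> I \<Longrightarrow>
      \<forall>\<^sub>F h in at 0. \<forall>l\<in>{1..M}. poly (pderiv (w c h)) (glb_node M l) = h * gw c h (glb_node M l)"
    and node0: "\<And>c. c \<in> I \<Longrightarrow>
      \<forall>\<^sub>F h in at 0. poly (w c h) 0 + glb_weight M 0 * (poly (pderiv (w c h)) 0 - h * gw c h 0) = 0"
  shows "unif_O (2 * M + 1) (\<lambda>h \<xi>. poly (w \<eta> h) 1 - z \<eta> h 1)"
proof -
  obtain p where p: "\<And>b. b \<in> I \<Longrightarrow> bounded_polys (p b)"
    "\<And>b h. b \<in> I \<Longrightarrow> poly (p b h) h = (if b = \<eta> then 1 else 0)"
    "\<And>b. b \<in> I \<Longrightarrow> unif_O (2 * M) (\<lambda>h \<xi>. poly (pderiv (p b h)) (h * \<xi>) + (\<Sum>c\<in>I. q c b h \<xi> * poly (p c h) (h * \<xi>)))"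
    using adjoint_approximation[where I = I and q = q and N = "2 * M" and \<eta> = \<eta>, OF q order_refl] by blast
  define \<phi> where "\<phi> c h \<xi> = poly (p c h) (h * \<xi>)" for c h \<xi>
  define \<psi> where "\<psi> c h \<xi> = poly (pderiv (p c h)) (h * \<xi>)" for c h \<xi>
  define \<Omega> where "\<Omega> c h \<xi> = poly (pderiv (\<omega> c h)) (h * \<xi>)" for c h \<xi>
  define e where "e c h \<xi> = poly (w c h) \<xi> - z c h \<xi>" for c h \<xi>
  \<comment> \<open>\<open>\<Omega>\<close> is the derivative of the stage polynomial in physical
    time, so \<open>f\<close> is the pairing of the adjoint with the residual, divided by
    \<open>h\<close>.\<close>
  define f where "f h \<xi> = (\<Sum>c\<in>I. \<phi> c h \<xi> * (\<Omega> c h \<xi> - gw c h \<xi>))" for h \<xi>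
  define H where "H h \<xi> = (\<Sum>c\<in>I. \<phi> c h \<xi> * e c h \<xi>)" for h \<xi>
  define H' where "H' h \<xi> = (\<Sum>c\<in>I. \<psi> c h \<xi> * e c h \<xi> + \<phi> c h \<xi> * (\<Omega> c h \<xi> - gz c h \<xi>))" for h \<xi>
  have w\<omega>: "poly (w c h) \<xi> = poly (\<omega> c h) (h * \<xi>)" "poly (pderiv (w c h)) \<xi> = h * \<Omega> c h \<xi>"
    if "c \<in> I" "h \<noteq> 0" for c h \<xi>
    using \<omega>(2)[OF that] by (simp_all add: poly_pcompose pderiv_pcompose pderiv_pCons \<Omega>_def mult.commute)
  have \<phi>: "graded (2 * M) (\<phi> c)" and \<Omega>: "graded (2 * M) (\<Omega> c)" if "c \<in> I" for c
    unfolding \<phi>_def \<Omega>_def using that by (auto intro!: graded_poly bounded_polys_pderiv p \<omega>)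
  have e0: "unif_O 0 (e c)" if "c \<in> I" for c
  proof -
    have "unif_O 0 (\<lambda>h \<xi>. poly (\<omega> c h) (h * \<xi>) - z c h \<xi>)"
      using that by (intro graded_unif_O[of "2 * M"] graded_diff graded_poly \<omega> z)
    moreover have eq: "\<forall>\<^sub>F h in at 0. \<forall>\<xi>\<in>{0..1}. e c h \<xi> = poly (\<omega> c h) (h * \<xi>) - z c h \<xi>"
      using eventually_at_nonzero by eventually_elim (simp add: e_def w\<omega> that)
    ultimately show ?thesis using unif_O_cong[OF eq, of 0] by simp
  qed
  have f: "graded (2 * M) f"
    unfolding f_def by (intro graded_sum graded_mult graded_diff \<phi> \<Omega> gw)
  then obtain \<pi> where \<pi>: "bounded_polys \<pi>" "\<And>h i. i \<ge> 2 * M \<Longrightarrow> poly.coeff (\<pi> h) i = 0"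
    "unif_O (2 * M) (\<lambda>h \<xi>. f h \<xi> - poly (\<pi> h) (h * \<xi>))"
    using graded_cutoff by blast
  have "unif_O (2 * M) (\<lambda>h \<xi>. H' h \<xi> - f h \<xi>)"
  proof -
    \<comment> \<open>Adding and subtracting the double sum with \<open>q\<close> leaves the adjoint
      defect times the bounded error plus the bounded adjoint times the linearization
      defect.\<close>
    have "H' h \<xi> - f h \<xi> = (\<Sum>b\<in>I. e b h \<xi> * (\<psi> b h \<xi> + (\<Sum>c\<in>I. q c b h \<xi> * \<phi> c h \<xi>))) +
        (\<Sum>c\<in>I. \<phi> c h \<xi> * (gw c h \<xi> - gz c h \<xi> - (\<Sum>b\<in>I. q c b h \<xi> * e b h \<xi>)))" for h \<xi>
    proof -
      have "(\<Sum>b\<in>I. e b h \<xi> * (\<Sum>c\<in>I. q c b h \<xi> * \<phi> c h \<xi>)) =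
          (\<Sum>c\<in>I. \<phi> c h \<xi> * (\<Sum>b\<in>I. q c b h \<xi> * e b h \<xi>))"
        unfolding sum_distrib_left by (subst sum.swap) (simp add: mult_ac)
      then show ?thesis
        by (simp add: H'_def f_def distrib_left right_diff_distrib sum.distrib sum_subtractf mult.commute)
    qed
    moreover have "unif_O (2 * M) (\<lambda>h \<xi>. e b h \<xi> * (\<psi> b h \<xi> + (\<Sum>c\<in>I. q c b h \<xi> * \<phi> c h \<xi>)))" if "b \<in> I" for b
      using unif_O_mult[OF e0[OF that] p(3)[OF that]] by (simp add: \<phi>_def \<psi>_def)
    moreover have "unif_O (2 * M) (\<lambda>h \<xi>. \<phi> c h \<xi> * (gw c h \<xi> - gz c h \<xi> - (\<Sum>b\<in>I. q c b h \<xi> * e b h \<xi>)))"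
      if "c \<in> I" for c
      using unif_O_mult[OF graded_unif_O[OF \<phi>[OF that]] lin[OF that]] by (simp add: e_def)
    ultimately show ?thesis by (simp only:) (intro unif_O_add unif_O_sum)
  qed
  from unif_O_add[OF this \<pi>(3)] have H'\<pi>: "unif_O (2 * M) (\<lambda>h \<xi>. H' h \<xi> - poly (\<pi> h) (h * \<xi>))" by simp
  define A where "A h = poly_antideriv (\<pi> h)" for h
  have "unif_O (2 * M + 1) (\<lambda>h \<xi>. (H h \<xi> - poly (A h) (h * \<xi>)) - (H h 0 - poly (A h) (h * 0)))"
  proof (rule unif_O_antideriv[where f = "\<lambda>h \<xi>. H h \<xi> - poly (A h) (h * \<xi>)"])
    show "unif_O (2 * M + 1) (\<lambda>h \<xi>. h * (H' h \<xi> - poly (\<pi> h) (h * \<xi>)))"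
      using unif_O_h_mult[OF H'\<pi>] by simp
    have "\<forall>\<^sub>F h in at 0. \<forall>c\<in>I. \<forall>\<xi>\<in>{0..1}. (z c h has_real_derivative h * gz c h \<xi>) (at \<xi> within {0..1})"
      using z(3) by (intro eventually_ball_finite I) auto
    then show "\<forall>\<^sub>F h in at 0. \<forall>\<xi>\<in>{0..1}. ((\<lambda>\<xi>. H h \<xi> - poly (A h) (h * \<xi>)) has_real_derivative
        h * (H' h \<xi> - poly (\<pi> h) (h * \<xi>))) (at \<xi> within {0..1})"
      using eventually_at_nonzero
    proof eventually_elim
      case (elim h)
      show ?case
      proof
        fix \<xi> :: real assume xi: "\<xi> \<in> {0..1}"
        have dw: "(poly (w c h) has_real_derivative h * \<Omega> c h \<xi>) (at \<xi> within {0..1})" if "c \<in> I" for c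
          using poly_DERIV[of "w c h" \<xi>] w\<omega>(2)[OF that elim(2)] by (auto intro: DERIV_subset)
        have "((\<lambda>\<xi>. \<phi> c h \<xi> * e c h \<xi>) has_real_derivative
            h * (\<psi> c h \<xi> * e c h \<xi> + \<phi> c h \<xi> * (\<Omega> c h \<xi> - gz c h \<xi>))) (at \<xi> within {0..1})"
          if "c \<in> I" for c
        proof -
          have "((\<lambda>\<xi>. \<phi> c h \<xi> * e c h \<xi>) has_real_derivative
            (h * \<psi> c h \<xi>) * e c h \<xi> + (h * \<Omega> c h \<xi> - h * gz c h \<xi>) * \<phi> c h \<xi>) (at \<xi> within {0..1})"
            unfolding \<phi>_def \<psi>_def e_def using elim(1) xi that
            by (intro DERIV_mult DERIV_diff has_derivative_poly_time dw) auto
          then show ?thesis by (simp add: algebra_simps)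
        qed
        then have "(H h has_real_derivative h * H' h \<xi>) (at \<xi> within {0..1})"
          unfolding H_def H'_def sum_distrib_left by (intro DERIV_sum)
        then show "((\<lambda>\<xi>. H h \<xi> - poly (A h) (h * \<xi>)) has_real_derivative
            h * (H' h \<xi> - poly (\<pi> h) (h * \<xi>))) (at \<xi> within {0..1})"
          unfolding right_diff_distrib
          by (intro DERIV_diff) (use has_derivative_poly_time[of "A h" h \<xi>] in \<open>simp_all add: A_def\<close>)
      qed
    qed
  qed simp
  from unif_O_at[OF this, of 1]
  have H1: "unif_O (2 * M + 1) (\<lambda>h \<xi>. (H h 1 - poly (A h) h) - (H h 0 - poly (A h) 0))" by simp
  \<comment> \<open>The cutoff made the degree of \<open>\<pi> h\<close> less than 2 M, so the
    quadrature gives its integral exactly.\<close>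
  have A: "poly (A h) h - poly (A h) 0 = h * (\<Sum>m\<le>M. glb_weight M m * poly (\<pi> h) (h * glb_node M m))" for h
  proof -
    have eq: "pderiv (pcompose (A h) [:0, h:]) = Polynomial.smult h (pcompose (\<pi> h) [:0, h:])"
      by (simp add: pderiv_pcompose A_def pderiv_pCons)
    have "Polynomial.degree (pcompose (\<pi> h) [:0, h:]) \<le> 2 * M - 1"
      using \<pi>(2)[of _ h] M by (intro degree_le) (auto simp: coeff_pcompose_linear)
    then have "poly_int (pcompose (\<pi> h) [:0, h:]) =
        (\<Sum>m\<le>M. glb_weight M m * poly (\<pi> h) (h * glb_node M m))"
      by (simp add: poly_int_eq_glb_quadrature[OF M] poly_pcompose mult.commute)
    then show ?thesis
      using poly_int_pderiv[of "pcompose (A h) [:0, h:]"] by (simp add: eq poly_int_smult poly_pcompose)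
  qed
  have quad: "unif_O (2 * M + 1)
      (\<lambda>h \<xi>. h * (\<Sum>m\<le>M. glb_weight M m * (f h (glb_node M m) - poly (\<pi> h) (h * glb_node M m))))"
  proof -
    have "unif_O (2 * M) (\<lambda>h \<xi>. \<Sum>m\<le>M. glb_weight M m *
        (f h (glb_node M m) - poly (\<pi> h) (h * glb_node M m)))"
      by (intro unif_O_sum unif_O_cmult unif_O_at[OF \<pi>(3)] glb_node_range[OF M]) simp
    from unif_O_h_mult[OF this] show ?thesis by simp
  qed
  have "\<forall>\<^sub>F h in at 0. \<forall>c\<in>I. (\<forall>l\<in>{1..M}. poly (pderiv (w c h)) (glb_node M l) = h * gw c h (glb_node M l)) \<and>
      poly (w c h) 0 + glb_weight M 0 * (poly (pderiv (w c h)) 0 - h * gw c h 0) = 0"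
    using eventually_conj[OF node node0] by (intro eventually_ball_finite[OF I(1)] ballI) blast
  \<comment> \<open>The residual vanishes at all nodes but 0; there \<open>node0\<close> relates it
    to the initial value of the stage polynomial, which is the initial error because
    \<open>z\<close> starts at 0.\<close>
  then have "\<forall>\<^sub>F h in at 0. h * (\<Sum>m\<le>M. glb_weight M m * f h (glb_node M m)) = - H h 0"
    using eventually_at_nonzero
  proof eventually_elim
    case (elim h)
    have "f h (glb_node M m) = 0" if "m \<in> {1..M}" for m
    proof -
      have "\<Omega> c h (glb_node M m) = gw c h (glb_node M m)" if "c \<in> I" for c
        using elim that \<open>m \<in> {1..M}\<close> w\<omega>(2)[OF that elim(2), of "glb_node M m"] by auto
      then show ?thesis by (simp add: f_def)
    qed
    then have "(\<Sum>m\<le>M. glb_weight M m * f h (glb_node M m)) = (\<Sum>m\<in>{0}. glb_weight M m * f h (glb_node M m))"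
      by (intro sum.mono_neutral_right) auto
    then have "h * (\<Sum>m\<le>M. glb_weight M m * f h (glb_node M m)) =
        (\<Sum>c\<in>I. \<phi> c h 0 * (glb_weight M 0 * (h * \<Omega> c h 0 - h * gw c h 0)))"
      by (simp add: f_def glb_node_bij(2)[OF M] sum_distrib_left algebra_simps)
    also have "\<dots> = (\<Sum>c\<in>I. \<phi> c h 0 * (- poly (w c h) 0))"
    proof (rule sum.cong[OF refl])
      fix c assume c: "c \<in> I"
      then have "poly (w c h) 0 + glb_weight M 0 * (h * \<Omega> c h 0 - h * gw c h 0) = 0"
        using elim(1) w\<omega>(2)[OF c elim(2), of 0] by auto
      then show "\<phi> c h 0 * (glb_weight M 0 * (h * \<Omega> c h 0 - h * gw c h 0)) = \<phi> c h 0 * (- poly (w c h) 0)"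
        by (metis add_eq_0_iff)
    qed
    also have "\<dots> = - H h 0" by (simp add: H_def e_def z(2) sum_negf)
    finally show ?case .
  qed
  then have "\<forall>\<^sub>F h in at 0. \<forall>\<xi>\<in>{0..1::real}. poly (w \<eta> h) 1 - z \<eta> h 1 =
      ((H h 1 - poly (A h) h) - (H h 0 - poly (A h) 0)) -
      h * (\<Sum>m\<le>M. glb_weight M m * (f h (glb_node M m) - poly (\<pi> h) (h * glb_node M m)))"
  proof eventually_elim
    case (elim h)
    \<comment> \<open>The adjoint is exactly the unit vector at \<xi> = 1, so \<open>H h 1\<close>
      is one component of the error. The initial term \<open>H h 0\<close> cancels against the
      quadrature sum of \<open>f\<close>, and only remainders are left.\<close>
    have "H h 1 = (\<Sum>c\<in>I. if c = \<eta> then e c h 1 else 0)"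
      unfolding H_def by (intro sum.cong) (auto simp: \<phi>_def p(2))
    then have "H h 1 = poly (w \<eta> h) 1 - z \<eta> h 1" using I by (simp add: e_def sum.delta)
    then show ?case
      using elim A[of h] by (simp add: right_diff_distrib sum_subtractf)
  qed
  from unif_O_cong[OF this] show ?thesis using unif_O_diff[OF H1 quad] by blast
qed

section \<open>Stages and exact solution\<close>

text \<open>For small \<open>h\<close> the stage map contracts by 1/2 in the maximum norm over the S
  stages; its iterates, started at the constant \<open>x\<close>, converge to a solution.\<close>

lemma rk_step_exists:
  fixes G :: "real \<Rightarrow> 'a::euclidean_space \<Rightarrow> 'a"
  assumes lip: "\<And>t. L-lipschitz_on UNIV (G t)"
  shows "\<forall>\<^sub>F h in at 0. \<exists>x'. rk_step S A b c G t h x x'"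
proof -
  define K where "K = (\<Sum>s<S. \<Sum>r<S. \<bar>A $$ (s, r)\<bar>)"
  have KL: "K * L \<ge> 0" using lipschitz_on_nonneg[OF lip] by (simp add: K_def sum_nonneg)
  \<comment> \<open>The threshold enforces |h| K L at most 1/2; the summand 1 covers K L =
    0.\<close>
  then have "\<forall>\<^sub>F h in at 0. \<bar>h\<bar> < 1 / (2 * (K * L + 1))"
    by (auto simp: eventually_at intro!: exI[of _ "1 / (2 * (K * L + 1))"])
  then show ?thesis
  proof eventually_elim
    case (elim h)
    then have "\<bar>h\<bar> * (K * L + 1) \<le> 1 / 2" using KL by (simp add: field_simps)
    then have small: "\<bar>h\<bar> * K * L \<le> 1 / 2" by (simp add: algebra_simps)
    define T where "T y s = x + h *\<^sub>R (\<Sum>r<S. (A $$ (s, r)) *\<^sub>R G (t + c r * h) (y r))"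
      for y :: "nat \<Rightarrow> 'a" and s
    have contraction: "norm (T y s - T y' s) \<le> m / 2"
      if "s < S" and m: "\<And>r. r < S \<Longrightarrow> norm (y r - y' r) \<le> m" for y y' s m
    proof -
      have m0: "m \<ge> 0" using m[OF \<open>s < S\<close>] norm_ge_zero order_trans by blast
      let ?d = "\<lambda>r. G (t + c r * h) (y r) - G (t + c r * h) (y' r)"
      have d: "norm (?d r) \<le> L * m" if "r < S" for r
        using lipschitz_onD[OF lip UNIV_I UNIV_I, of "t + c r * h" "y r" "y' r"]
          mult_left_mono[OF m[OF that] lipschitz_on_nonneg[OF lip]]
        by (simp add: dist_norm)
      have "norm (T y s - T y' s) = \<bar>h\<bar> * norm (\<Sum>r<S. (A $$ (s, r)) *\<^sub>R ?d r)"
        by (simp add: T_def scaleR_diff_right sum_subtractf flip: norm_scaleR)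
      also have "\<dots> \<le> \<bar>h\<bar> * (\<Sum>r<S. \<bar>A $$ (s, r)\<bar> * (L * m))"
        using d by (intro mult_left_mono sum_norm_le) (auto intro: mult_left_mono)
      also have "\<dots> = \<bar>h\<bar> * ((\<Sum>r<S. \<bar>A $$ (s, r)\<bar>) * (L * m))"
        by (simp add: sum_distrib_right)
      also have "\<dots> \<le> \<bar>h\<bar> * (K * (L * m))"
        unfolding K_def using \<open>s < S\<close> lipschitz_on_nonneg[OF lip] m0
        by (intro mult_left_mono mult_right_mono member_le_sum) (auto intro: sum_nonneg)
      also have "\<dots> \<le> m / 2"
        using mult_right_mono[OF small m0] by (simp add: mult.assoc)
      finally show ?thesis .
    qed
    define Y where "Y n = (T ^^ n) (\<lambda>_. x)" for n
    define m where "m = (\<Sum>s<S. norm (Y 1 s - Y 0 s))"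
    have step: "norm (Y (Suc n) s - Y n s) \<le> m * (1 / 2) ^ n" if "s < S" for n s
      using that
    proof (induction n arbitrary: s)
      case 0
      then show ?case unfolding m_def
        using member_le_sum[of s "{..<S}" "\<lambda>s. norm (Y 1 s - Y 0 s)"] by simp
    next
      case (Suc n)
      have "norm (T (Y (Suc n)) s - T (Y n) s) \<le> m * (1 / 2) ^ n / 2"
        by (rule contraction[OF Suc.prems Suc.IH])
      then show ?case by (simp add: Y_def)
    qed
    have "\<exists>l. (\<lambda>n. Y n s) \<longlonglongrightarrow> l" if "s < S" for s
    proof -
      have "summable (\<lambda>n. m * (1 / 2) ^ n)" by (intro summable_mult summable_geometric) simp
      then have "summable (\<lambda>n. Y (Suc n) s - Y n s)"
        by (rule summable_comparison_test'[where N = 0]) (rule step[OF that])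
      then obtain l where "(\<lambda>n. \<Sum>i<n. Y (Suc i) s - Y i s) \<longlonglongrightarrow> l"
        using summable_LIMSEQ by blast
      then have "(\<lambda>n. (Y n s - Y 0 s) + Y 0 s) \<longlonglongrightarrow> l + Y 0 s"
        by (intro tendsto_add tendsto_const) (simp add: sum_lessThan_telescope[of "\<lambda>i. Y i s"])
      then show ?thesis by auto
    qed
    then obtain y where y: "\<And>s. s < S \<Longrightarrow> (\<lambda>n. Y n s) \<longlonglongrightarrow> y s" by metis
    have "\<forall>s<S. y s = x + h *\<^sub>R (\<Sum>r<S. (A $$ (s, r)) *\<^sub>R G (t + c r * h) (y r))"
    proof (intro allI impI)
      fix s assume s: "s < S"
      have "(\<lambda>n. G (t + c r * h) (Y n r)) \<longlonglongrightarrow> G (t + c r * h) (y r)" if "r < S" for r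
        using lipschitz_on_continuous_on[OF lip, of "t + c r * h"] y[OF that]
        by (auto intro: continuous_on_tendsto_compose)
      then have "(\<lambda>n. T (Y n) s) \<longlonglongrightarrow> T y s"
        unfolding T_def by (intro tendsto_intros) simp
      moreover have "(\<lambda>n. T (Y n) s) \<longlonglongrightarrow> y s"
        using LIMSEQ_Suc[OF y[OF s]] by (simp add: Y_def)
      ultimately show "y s = x + h *\<^sub>R (\<Sum>r<S. (A $$ (s, r)) *\<^sub>R G (t + c r * h) (y r))"
        using LIMSEQ_unique unfolding T_def by blast
    qed
    then show ?case unfolding rk_step_def by blast
  qed
qed

text \<open>Holds for every solution of the stage equations, as required by the arbitrary choice of
  \<open>\<Phi>\<close>. The largest deviation m from \<open>x\<close> satisfies an inequality of
  the form m \<le> |h| K g + m/2, from which m is absorbed.\<close>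

lemma rk_stage_bound:
  fixes G :: "real \<Rightarrow> 'a::euclidean_space \<Rightarrow> 'a"
  assumes lip: "\<And>t. L-lipschitz_on UNIV (G t)"
    and cont: "continuous_on UNIV (\<lambda>(t, x). G t x)"
  shows "\<exists>C. \<forall>\<^sub>F h in at 0. \<forall>y. (\<forall>s<S. y s = x + h *\<^sub>R (\<Sum>r<S. (A $$ (s, r)) *\<^sub>R G (t + c r * h) (y r))) \<longrightarrow>
    (\<forall>s<S. norm (y s - x) \<le> C * \<bar>h\<bar>)"
proof -
  define K where "K = (\<Sum>s<S. \<Sum>r<S. \<bar>A $$ (s, r)\<bar>)"
  have K0: "K \<ge> 0" by (simp add: K_def sum_nonneg)
  have L0: "L \<ge> 0" using lipschitz_on_nonneg[OF lip] .
  have KL: "K * L \<ge> 0" using K0 L0 by simp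
  then have small: "\<forall>\<^sub>F h in at 0. \<bar>h\<bar> < 1 / (2 * (K * L + 1))"
    by (auto simp: eventually_at intro!: exI[of _ "1 / (2 * (K * L + 1))"])
  \<comment> \<open>By continuity in time, a bound for \<open>G\<close> at \<open>x\<close> and all
    stage times once \<open>h\<close> is small.\<close>
  define g where "g = norm (G t x) + 1"
  have "\<forall>\<^sub>F h in at 0. norm (G (t + c r * h) x) < g" for r
  proof -
    have "continuous_on UNIV (\<lambda>h. (\<lambda>(t, x). G t x) (t + c r * h, x))"
      by (rule continuous_on_compose2[OF cont]) (auto intro!: continuous_intros)
    then have "isCont (\<lambda>h. G (t + c r * h) x) 0"
      by (simp add: continuous_on_eq_continuous_at)
    then have "((\<lambda>h. norm (G (t + c r * h) x)) \<longlongrightarrow> norm (G (t + c r * 0) x)) (at 0)"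
      unfolding isCont_def by (rule tendsto_norm)
    then show ?thesis by (rule order_tendstoD) (simp add: g_def)
  qed
  then have "\<forall>\<^sub>F h in at 0. \<forall>r\<in>{..<S}. norm (G (t + c r * h) x) < g"
    by (intro eventually_ball_finite) auto
  then have "\<forall>\<^sub>F h in at 0. \<forall>y. (\<forall>s<S. y s = x + h *\<^sub>R (\<Sum>r<S. (A $$ (s, r)) *\<^sub>R G (t + c r * h) (y r))) \<longrightarrow>
    (\<forall>s<S. norm (y s - x) \<le> (2 * K * g) * \<bar>h\<bar>)"
    using small
  proof eventually_elim
    case (elim h)
    then have "\<bar>h\<bar> * (K * L + 1) \<le> 1 / 2" using KL by (simp add: field_simps)
    then have KLh: "\<bar>h\<bar> * K * L \<le> 1 / 2" by (simp add: algebra_simps)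
    show ?case
    proof (intro allI impI)
      fix y s
      assume y: "\<forall>s<S. y s = x + h *\<^sub>R (\<Sum>r<S. (A $$ (s, r)) *\<^sub>R G (t + c r * h) (y r))" and s: "s < S"
      define m where "m = Max ((\<lambda>s. norm (y s - x)) ` {..<S})"
      have m: "norm (y r - x) \<le> m" if "r < S" for r
        unfolding m_def using that by (intro Max_ge) auto
      have m0: "m \<ge> 0" using m[OF s] norm_ge_zero order_trans by blast
      have "m \<in> (\<lambda>s. norm (y s - x)) ` {..<S}"
        unfolding m_def using s by (intro Max_in) auto
      then obtain s' where s': "s' < S" "m = norm (y s' - x)" by blast
      have G: "norm (G (t + c r * h) (y r)) \<le> g + L * m" if "r < S" for r
      proof -
        have "norm (G (t + c r * h) (y r) - G (t + c r * h) x) \<le> L * norm (y r - x)"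
          using lipschitz_onD[OF lip UNIV_I UNIV_I, of "t + c r * h" "y r" x] by (simp add: dist_norm)
        also have "\<dots> \<le> L * m" using m[OF that] L0 by (intro mult_left_mono)
        finally show ?thesis
          using elim(1) that norm_triangle_sub[of "G (t + c r * h) (y r)" "G (t + c r * h) x"] by force
      qed
      have "m = \<bar>h\<bar> * norm (\<Sum>r<S. (A $$ (s', r)) *\<^sub>R G (t + c r * h) (y r))"
        unfolding s'(2) using y s' by simp
      also have "\<dots> \<le> \<bar>h\<bar> * (\<Sum>r<S. \<bar>A $$ (s', r)\<bar> * (g + L * m))"
        using G by (intro mult_left_mono sum_norm_le) (auto intro: mult_left_mono)
      also have "\<dots> = \<bar>h\<bar> * ((\<Sum>r<S. \<bar>A $$ (s', r)\<bar>) * (g + L * m))" by (simp add: sum_distrib_right)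
      also have "\<dots> \<le> \<bar>h\<bar> * (K * (g + L * m))"
        unfolding K_def using s' L0 m0
        by (intro mult_left_mono mult_right_mono member_le_sum) (auto intro: sum_nonneg simp: g_def)
      also have "\<dots> = \<bar>h\<bar> * K * g + (\<bar>h\<bar> * K * L) * m" by (simp add: algebra_simps)
      also have "\<dots> \<le> \<bar>h\<bar> * K * g + 1 / 2 * m" using KLh m0 by (intro add_left_mono mult_right_mono)
      finally show "norm (y s - x) \<le> (2 * K * g) * \<bar>h\<bar>" using m[OF s] by (simp add: mult_ac)
    qed
  qed
  then show ?thesis by blast
qed

section \<open>Right-hand side and exact solution as almost polynomial families\<close>

lemma graded_taylor:
  fixes F P :: "real \<times> 'a::euclidean_space \<Rightarrow> real"
  assumes "real_polynomial_function P"
    and "unif_O k (\<lambda>h \<xi>. F (p0 + (h * \<xi>, w h \<xi>)) - P (h * \<xi>, w h \<xi>))"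
    and "graded_vec j w" "j \<le> k"
  shows "graded j (\<lambda>h \<xi>. F (p0 + (h * \<xi>, w h \<xi>)))"
proof (rule graded_cong_unif_O)
  show "graded j (\<lambda>h \<xi>. P (h * \<xi>, w h \<xi>))"
    by (rule graded_polynomial[OF assms(1) graded_vec_Pair[OF assms(3)]])
qed (rule unif_O_mono[OF assms(2,4)])

text \<open>Bootstrapping through the differential equation: order j for \<open>z\<close> passes to
  the right-hand side by its Taylor polynomial, and integration yields order j + 1, until the
  smoothness k is exhausted. No higher derivative of the solution is formed.\<close>

lemma exact_solution_graded:
  fixes F P :: "'a \<Rightarrow> real \<times> 'a::euclidean_space \<Rightarrow> real"
  assumes P: "\<And>c. c \<in> Basis \<Longrightarrow> real_polynomial_function (P c)"
    and F: "\<And>c w. c \<in> Basis \<Longrightarrow> unif_O 1 (\<lambda>h \<xi>. norm (w h \<xi>)) \<Longrightarrow>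
      unif_O k (\<lambda>h \<xi>. F c (p0 + (h * \<xi>, w h \<xi>)) - P c (h * \<xi>, w h \<xi>))"
    and small: "unif_O 1 (\<lambda>h \<xi>. norm (z h \<xi>))" and z0: "\<And>h. z h 0 = 0"
    and der: "\<And>c. c \<in> Basis \<Longrightarrow> \<forall>\<^sub>F h in at 0. \<forall>\<xi>\<in>{0..1}.
      ((\<lambda>\<xi>. z h \<xi> \<bullet> c) has_real_derivative h * F c (p0 + (h * \<xi>, z h \<xi>))) (at \<xi> within {0..1})"
  shows "graded_vec k z"
proof -
  have "graded_vec j z" if "j \<le> k" for j
    using that
  proof (induction j)
    case 0
    have "unif_O 0 (\<lambda>h \<xi>. z h \<xi> \<bullet> c)" if "c \<in> Basis" for c
      using unif_O_mono[OF unif_O_inner[OF small that]] by simp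
    then show ?case by (auto simp: graded_vec_def intro: unif_O_graded)
  next
    case (Suc j)
    then have "graded j (\<lambda>h \<xi>. F c (p0 + (h * \<xi>, z h \<xi>)))" if "c \<in> Basis" for c
      using that by (intro graded_taylor[OF P F[OF _ small]]) auto
    then show ?case
      unfolding graded_vec_def using der z0 by (intro ballI graded_antideriv[where C = 0]) auto
  qed
  then show ?thesis by simp
qed

lemma exact_solution_small:
  fixes u :: "real \<Rightarrow> 'a::euclidean_space"
  assumes "(u has_vector_derivative v) (at t)"
  shows "unif_O 1 (\<lambda>h \<xi>. norm (u (t + h * \<xi>) - u t))"
proof -
  have "\<forall>e>0. \<exists>d>0. \<forall>y. norm (y - t) < d \<longrightarrow> norm (u y - u t - (y - t) *\<^sub>R v) \<le> e * norm (y - t)"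
    using assms unfolding has_vector_derivative_def has_derivative_at_alt by auto
  then obtain d where d: "d > 0" "\<And>y. norm (y - t) < d \<Longrightarrow> norm (u y - u t - (y - t) *\<^sub>R v) \<le> 1 * norm (y - t)"
    by (metis zero_less_one_class.zero_less_one)
  have "\<forall>\<^sub>F h in at 0. \<bar>h\<bar> < d" using d(1) by (auto simp: eventually_at intro!: exI[of _ d])
  then have "\<forall>\<^sub>F h in at 0. \<forall>\<xi>\<in>{0..1}. \<bar>norm (u (t + h * \<xi>) - u t)\<bar> \<le> (1 + norm v) * \<bar>h\<bar> ^ 1"
  proof eventually_elim
    case (elim h)
    show ?case
    proof
      fix \<xi> :: real assume xi: "\<xi> \<in> {0..1}"
      then have le: "\<bar>h * \<xi>\<bar> \<le> \<bar>h\<bar>" by (simp add: abs_mult mult_left_le)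
      have "norm (u (t + h * \<xi>) - u t - (h * \<xi>) *\<^sub>R v) \<le> \<bar>h * \<xi>\<bar>"
        using d(2)[of "t + h * \<xi>"] le elim by simp
      then have "norm (u (t + h * \<xi>) - u t) \<le> \<bar>h * \<xi>\<bar> + \<bar>h * \<xi>\<bar> * norm v"
        using norm_triangle_sub[of "u (t + h * \<xi>) - u t" "(h * \<xi>) *\<^sub>R v"] by simp
      also have "\<dots> \<le> \<bar>h\<bar> + \<bar>h\<bar> * norm v" using le by (intro add_mono mult_right_mono) auto
      finally show "\<bar>norm (u (t + h * \<xi>) - u t)\<bar> \<le> (1 + norm v) * \<bar>h\<bar> ^ 1" by (simp add: algebra_simps)
    qed
  qed
  then show ?thesis by (rule unif_O_I)
qed

lemma exact_solution_derivative:
  fixes u :: "real \<Rightarrow> 'a::euclidean_space"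
  assumes "\<forall>\<^sub>F t in nhds t0. (u has_vector_derivative G t (u t)) (at t)"
  shows "\<forall>\<^sub>F h in at 0. \<forall>\<xi>\<in>{0..1}. ((\<lambda>\<xi>. (u (t0 + h * \<xi>) - a) \<bullet> c) has_real_derivative
    h * (G (t0 + h * \<xi>) (u (t0 + h * \<xi>)) \<bullet> c)) (at \<xi> within {0..1})"
proof -
  obtain d where d: "d > 0" "\<And>t. dist t t0 < d \<Longrightarrow> (u has_vector_derivative G t (u t)) (at t)"
    using assms unfolding eventually_nhds_metric by blast
  have "\<forall>\<^sub>F h in at 0. \<bar>h\<bar> < d" using d(1) by (auto simp: eventually_at intro!: exI[of _ d])
  then show ?thesis
  proof eventually_elim
    case (elim h)
    show ?case
    proof
      fix \<xi> :: real assume xi: "\<xi> \<in> {0..1}"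
      then have "\<bar>h * \<xi>\<bar> \<le> \<bar>h\<bar>" by (simp add: abs_mult mult_left_le)
      then have "(u has_vector_derivative G (t0 + h * \<xi>) (u (t0 + h * \<xi>))) (at (t0 + h * \<xi>))"
        using elim by (intro d(2)) (simp add: dist_norm)
      then have du: "((\<lambda>t. (u t - a) \<bullet> c) has_real_derivative G (t0 + h * \<xi>) (u (t0 + h * \<xi>)) \<bullet> c) (at (t0 + h * \<xi>))"
        unfolding has_vector_derivative_def has_field_derivative_def
        by (auto intro!: derivative_eq_intros simp: fun_eq_iff)
      have "((\<lambda>\<xi>. t0 + h * \<xi>) has_real_derivative h) (at \<xi> within {0..1})"
        by (auto intro!: derivative_eq_intros)
      from DERIV_chain2[OF du this]
      show "((\<lambda>\<xi>. (u (t0 + h * \<xi>) - a) \<bullet> c) has_real_derivative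
          h * (G (t0 + h * \<xi>) (u (t0 + h * \<xi>)) \<bullet> c)) (at \<xi> within {0..1})"
        by (simp add: mult.commute)
    qed
  qed
qed

section \<open>The local error\<close>

text \<open>The polynomials are fixed before \<open>w\<close>, so stages and exact solution can be
  compared through the same one.\<close>

lemma C_k_taylor_family:
  fixes F :: "'i \<Rightarrow> real \<times> 'a::euclidean_space \<Rightarrow> real"
  assumes "\<And>c. C_k k (F c)"
  obtains P where "\<And>c. real_polynomial_function (P c)"
    "\<And>c w. unif_O 1 (\<lambda>h \<xi>. norm (w h \<xi>)) \<Longrightarrow>
      unif_O k (\<lambda>h \<xi>. F c (p0 + (h * \<xi>, w h \<xi>)) - P c (h * \<xi>, w h \<xi>))"
proof -
  have "\<exists>P. real_polynomial_function P \<and> (\<forall>w. unif_O 1 (\<lambda>h \<xi>. norm (w h \<xi>)) \<longrightarrow>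
      unif_O k (\<lambda>h \<xi>. F c (p0 + (h * \<xi>, w h \<xi>)) - P (h * \<xi>, w h \<xi>)))" for c
  proof -
    obtain P C \<delta> where P: "real_polynomial_function P" "\<delta> > 0"
      "\<And>v. norm v \<le> \<delta> \<Longrightarrow> \<bar>F c (p0 + v) - P v\<bar> \<le> C * norm v ^ k"
      using C_k_taylor[OF assms[of c], of p0] by blast
    then show ?thesis using unif_O_taylor[OF P(2,3)] by blast
  qed
  then have "\<exists>P. \<forall>c. real_polynomial_function (P c) \<and> (\<forall>w. unif_O 1 (\<lambda>h \<xi>. norm (w h \<xi>)) \<longrightarrow>
      unif_O k (\<lambda>h \<xi>. F c (p0 + (h * \<xi>, w h \<xi>)) - P c (h * \<xi>, w h \<xi>)))"
    by (intro choice) blast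
  then show thesis using that by blast
qed

text \<open>Replacing \<open>F\<close> by \<open>P\<close> at both arguments costs O(h^k), and the
  difference of the values of \<open>P\<close> factors exactly.\<close>

lemma unif_O_linearization:
  fixes F P :: "real \<times> 'a::euclidean_space \<Rightarrow> real"
  assumes P: "real_polynomial_function P"
    and v: "unif_O k (\<lambda>h \<xi>. F (p0 + (h * \<xi>, v h \<xi>)) - P (h * \<xi>, v h \<xi>))" "graded_vec k v"
    and w: "unif_O k (\<lambda>h \<xi>. F (p0 + (h * \<xi>, w h \<xi>)) - P (h * \<xi>, w h \<xi>))" "graded_vec k w"
  shows "\<exists>q. (\<forall>b. graded k (q b)) \<and> unif_O k (\<lambda>h \<xi>. F (p0 + (h * \<xi>, v h \<xi>)) - F (p0 + (h * \<xi>, w h \<xi>)) -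
    (\<Sum>b\<in>Basis. q b h \<xi> * (v h \<xi> \<bullet> b - w h \<xi> \<bullet> b)))"
proof -
  obtain Q where Q: "\<And>v w. P v - P w = (\<Sum>b\<in>Basis. Q b v w * ((v - w) \<bullet> b))"
    "\<And>b k v w. graded_vec k v \<Longrightarrow> graded_vec k w \<Longrightarrow> graded k (\<lambda>h \<xi>. Q b (v h \<xi>) (w h \<xi>))"
    using real_polynomial_function_diff_factor[OF P] by blast
  \<comment> \<open>Both arguments have the same time component, so only the spatial basis vectors
    \<open>(0, b)\<close> contribute.\<close>
  define q where "q b h \<xi> = Q (0, b) (h * \<xi>, v h \<xi>) (h * \<xi>, w h \<xi>)" for b h \<xi>
  have q: "graded k (q b)" for b
    unfolding q_def by (intro Q(2) graded_vec_Pair v w)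
  have inj: "inj_on (\<lambda>i. (i, 0::'a)) (Basis :: real set)" "inj_on (\<lambda>i. (0::real, i)) (Basis :: 'a set)"
    by (auto simp: inj_on_def)
  have "P (h * \<xi>, v h \<xi>) - P (h * \<xi>, w h \<xi>) = (\<Sum>b\<in>Basis. q b h \<xi> * (v h \<xi> \<bullet> b - w h \<xi> \<bullet> b))" for h \<xi>
    unfolding Q(1) Basis_prod_def q_def
    by (subst sum.union_disjoint) (auto simp: sum.reindex[OF inj(1)] sum.reindex[OF inj(2)] inner_diff_left)
  moreover have "unif_O k (\<lambda>h \<xi>. (F (p0 + (h * \<xi>, v h \<xi>)) - P (h * \<xi>, v h \<xi>)) -
      (F (p0 + (h * \<xi>, w h \<xi>)) - P (h * \<xi>, w h \<xi>)))"
    by (rule unif_O_diff[OF v(1) w(1)])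
  ultimately have "unif_O k (\<lambda>h \<xi>. F (p0 + (h * \<xi>, v h \<xi>)) - F (p0 + (h * \<xi>, w h \<xi>)) -
      (\<Sum>b\<in>Basis. q b h \<xi> * (v h \<xi> \<bullet> b - w h \<xi> \<bullet> b)))"
    by (simp add: algebra_simps)
  then show ?thesis using q by blast
qed

lemma stage_polynomial_small:
  fixes y :: "real \<Rightarrow> nat \<Rightarrow> real"
  assumes M: "M \<ge> 1"
    and y: "\<forall>\<^sub>F h in at 0. \<forall>s\<le>M. \<bar>y h s\<bar> \<le> C * \<bar>h\<bar>"
  shows "unif_O 1 (\<lambda>h. poly (glb_interp M (y h)))"
proof -
  note P = glb_points_props[OF M]
  obtain D where D: "D \<ge> 0" "\<forall>\<^sub>F h in at 0. \<forall>i. \<bar>poly.coeff (glb_interp M (y h)) i\<bar> \<le> D * \<bar>h\<bar> ^ 1"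
  proof (rule coeff_unif_O[OF P(1), where d = "\<lambda>h. glb_interp M (y h)" and k = 1])
    have "Polynomial.degree (glb_interp M (y h)) < card (glb_points M)" for h
      using degree_glb_interp[OF M, of "y h"] P(2) by simp
    then show "\<forall>\<^sub>F h in at 0. Polynomial.degree (glb_interp M (y h)) < card (glb_points M)" by simp
    fix x assume "x \<in> glb_points M"
    then obtain s where s: "s \<le> M" "x = glb_node M s"
      using glb_node_bij(1)[OF M] by (metis atMost_iff bij_betw_imp_surj_on imageE)
    have "\<forall>\<^sub>F h in at 0. \<bar>poly (glb_interp M (y h)) x\<bar> \<le> C * \<bar>h\<bar> ^ 1"
      using y by eventually_elim (simp add: s glb_interp_node[OF M s(1)])
    then show "\<exists>C. \<forall>\<^sub>F h in at 0. \<bar>poly (glb_interp M (y h)) x\<bar> \<le> C * \<bar>h\<bar> ^ 1" by blast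
  qed auto
  then show ?thesis
    using degree_glb_interp[OF M] by (intro unif_O_coeff[where n = M, OF _ D]) auto
qed

text \<open>The smoothness 2 M is the order to which right-hand sides have to be approximated for
  superconvergence; no further derivative is taken.\<close>

lemma ader_local_error:
  fixes G :: "real \<Rightarrow> 'a::euclidean_space \<Rightarrow> 'a" and u :: "real \<Rightarrow> 'a"
  assumes M: "M \<ge> 1" and smooth: "C_k (2 * M) (\<lambda>(t, x). G t x)"
    and cont: "continuous_on UNIV (\<lambda>(t, x). G t x)"
    and lip: "\<And>t. L-lipschitz_on UNIV (G t)"
    and u: "\<forall>\<^sub>F t in nhds t0. (u has_vector_derivative G t (u t)) (at t)"
    and \<Phi>: "\<forall>\<^sub>F h in at 0. rk_step (M + 1) (ader_A M) (glb_weight M) (glb_node M) G t0 h (u t0) (\<Phi> h)"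
  shows "(\<lambda>h. norm (\<Phi> h - u (t0 + h))) \<in> O[at 0](\<lambda>h. h ^ (2 * M + 1))"
proof -
  let ?x = "u t0" and ?\<xi> = "glb_node M" and ?w = "glb_weight M" and ?A = "ader_A M"
  define stages where "stages h y \<longleftrightarrow> (\<forall>s<M + 1. y s = ?x + h *\<^sub>R (\<Sum>r<M + 1. (?A $$ (s, r)) *\<^sub>R G (t0 + ?\<xi> r * h) (y r)))"
    for h and y :: "nat \<Rightarrow> 'a"
  define step where "step h y = ?x + h *\<^sub>R (\<Sum>r<M + 1. ?w r *\<^sub>R G (t0 + ?\<xi> r * h) (y r))"
    for h and y :: "nat \<Rightarrow> 'a"
  \<comment> \<open>One stage vector for each \<open>h\<close> that produces the given
    \<open>\<Phi> h\<close>.\<close>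
  define y where "y h = (SOME y. stages h y \<and> \<Phi> h = step h y)" for h
  have y: "\<forall>\<^sub>F h in at 0. stages h (y h) \<and> \<Phi> h = step h (y h)"
    using \<Phi>
  proof eventually_elim
    case (elim h)
    then have "\<exists>y. stages h y \<and> \<Phi> h = step h y" unfolding rk_step_def stages_def step_def .
    then show ?case unfolding y_def by (rule someI_ex)
  qed
  define F where "F c p = (case p of (t, x) \<Rightarrow> G t x) \<bullet> c" for c and p :: "real \<times> 'a"
  define p0 where "p0 = (t0, ?x)"
  have F_p0: "F c (p0 + (s, x)) = G (t0 + s) (?x + x) \<bullet> c" for c s x by (simp add: F_def p0_def)
  have "C_k (2 * M) (F c)" for c unfolding F_def[abs_def] by (rule C_k_inner[OF smooth])
  then obtain P where P: "\<And>c. real_polynomial_function (P c)"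
    "\<And>c w. unif_O 1 (\<lambda>h \<xi>. norm (w h \<xi>)) \<Longrightarrow>
      unif_O (2 * M) (\<lambda>h \<xi>. F c (p0 + (h * \<xi>, w h \<xi>)) - P c (h * \<xi>, w h \<xi>))"
    using C_k_taylor_family by blast
  define z where "z h \<xi> = u (t0 + h * \<xi>) - ?x" for h \<xi>
  have z_small: "unif_O 1 (\<lambda>h \<xi>. norm (z h \<xi>))"
    unfolding z_def using eventually_nhds_x_imp_x[OF u] by (rule exact_solution_small)
  have z_der: "\<forall>\<^sub>F h in at 0. \<forall>\<xi>\<in>{0..1}. ((\<lambda>\<xi>. z h \<xi> \<bullet> c) has_real_derivative
      h * F c (p0 + (h * \<xi>, z h \<xi>))) (at \<xi> within {0..1})" for c
    using exact_solution_derivative[where G = G and u = u, OF u, of ?x c] by (simp add: z_def F_p0)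
  have z_graded: "graded_vec (2 * M) z"
    by (rule exact_solution_graded[where F = F and P = P, OF P(1) P(2) z_small _ z_der]) (auto simp: z_def)
  \<comment> \<open>Displacements from the initial value are interpolated, so that the families are
    O(h) and start near 0.\<close>
  define w where "w c h = glb_interp M (\<lambda>s. (y h s - ?x) \<bullet> c)" for c h
  define W where "W h \<xi> = (\<Sum>c\<in>Basis. poly (w c h) \<xi> *\<^sub>R c)" for h \<xi>
  have W_inner: "W h \<xi> \<bullet> c = poly (w c h) \<xi>" if "c \<in> Basis" for c h \<xi>
    using that by (simp add: W_def inner_sum_left inner_Basis if_distrib sum.delta cong: if_cong)
  have W_node: "W h (?\<xi> s) = y h s - ?x" if "s \<le> M" for h s
    by (rule euclidean_eqI) (simp add: W_inner w_def glb_interp_node[OF M that])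
  have deg: "Polynomial.degree (w c h) \<le> M" for c h
    unfolding w_def by (rule degree_glb_interp[OF M])
  have w_small: "unif_O 1 (\<lambda>h. poly (w c h))" if c: "c \<in> Basis" for c
  proof -
    obtain C where "\<forall>\<^sub>F h in at 0. \<forall>y. stages h y \<longrightarrow> (\<forall>s<M + 1. norm (y s - ?x) \<le> C * \<bar>h\<bar>)"
      using rk_stage_bound[OF lip cont, of "M + 1" ?x ?A t0 ?\<xi>] unfolding stages_def by blast
    then have "\<forall>\<^sub>F h in at 0. \<forall>s\<le>M. \<bar>(y h s - ?x) \<bullet> c\<bar> \<le> C * \<bar>h\<bar>"
      using y
    proof eventually_elim
      case (elim h)
      then show ?case using Basis_le_norm[OF c] by (auto intro: order_trans simp: less_Suc_eq_le)
    qed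
    then show ?thesis unfolding w_def by (rule stage_polynomial_small[OF M])
  qed
  have W_small: "unif_O 1 (\<lambda>h \<xi>. norm (W h \<xi>))"
    by (rule unif_O_norm) (simp only: W_inner w_small)
  define g where "g c h \<xi> = F c (p0 + (h * \<xi>, W h \<xi>))" for c h \<xi>
  have collocation: "\<forall>\<^sub>F h in at 0. \<forall>l\<le>M. (if l = 0 then poly (w c h) 0 else 0) +
      ?w l * (poly (pderiv (w c h)) (?\<xi> l) - h * g c h (?\<xi> l)) = 0"
    and step: "\<forall>\<^sub>F h in at 0. (\<Phi> h - ?x) \<bullet> c = poly (w c h) 1" for c
  proof -
    have g_node: "g c h (?\<xi> r) = G (t0 + ?\<xi> r * h) (y h r) \<bullet> c" if "r \<le> M" for h r
      by (simp add: g_def F_p0 W_node[OF that] mult.commute)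
    \<comment> \<open>The summand 0 is the initial value of the displacement, in the form the scalar
      collocation lemmas expect.\<close>
    have stage: "(y h s - ?x) \<bullet> c = 0 + h * (\<Sum>r\<le>M. ?A $$ (s, r) * g c h (?\<xi> r))"
      if "stages h (y h)" "s \<le> M" for h s
    proof -
      have "y h s - ?x = h *\<^sub>R (\<Sum>r\<le>M. (?A $$ (s, r)) *\<^sub>R G (t0 + ?\<xi> r * h) (y h r))"
        using that by (simp add: stages_def lessThan_Suc_atMost less_Suc_eq_le)
      then show ?thesis by (simp add: inner_sum_left g_node)
    qed
    have w0: "poly (w c h) 0 = (y h 0 - ?x) \<bullet> c" for h
      using glb_interp_node[OF M, of 0] glb_node_bij(2)[OF M] by (simp add: w_def)
    show "\<forall>\<^sub>F h in at 0. \<forall>l\<le>M. (if l = 0 then poly (w c h) 0 else 0) +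
      ?w l * (poly (pderiv (w c h)) (?\<xi> l) - h * g c h (?\<xi> l)) = 0"
      using y
    proof eventually_elim
      case (elim h)
      then have "\<And>s. s \<le> M \<Longrightarrow> (y h s - ?x) \<bullet> c = 0 + h * (\<Sum>r\<le>M. ?A $$ (s, r) * g c h (?\<xi> r))"
        using stage by blast
      from ader_stages_collocation[OF M _ this] show ?case
        unfolding w0 unfolding w_def by (simp only: diff_zero) blast
    qed
    show "\<forall>\<^sub>F h in at 0. (\<Phi> h - ?x) \<bullet> c = poly (w c h) 1"
      using y
    proof eventually_elim
      case (elim h)
      have "(\<Phi> h - ?x) \<bullet> c = 0 + h * (\<Sum>r\<le>M. ?w r * g c h (?\<xi> r))"
        using elim by (simp add: step_def lessThan_Suc_atMost inner_sum_left g_node)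
      moreover have "\<And>s. s \<le> M \<Longrightarrow> (y h s - ?x) \<bullet> c = 0 + h * (\<Sum>r\<le>M. ?A $$ (s, r) * g c h (?\<xi> r))"
        using stage elim by blast
      from ader_step_eq_interp[OF M this]
      have "0 + h * (\<Sum>r\<le>M. ?w r * g c h (?\<xi> r)) = poly (w c h) 1" by (simp only: w_def)
      ultimately show ?case by simp
    qed
  qed
  have node: "\<forall>\<^sub>F h in at 0. \<forall>l\<in>{1..M}. poly (pderiv (w c h)) (?\<xi> l) = h * g c h (?\<xi> l)" for c
    using collocation[of c]
  proof eventually_elim
    case (elim h)
    show ?case
    proof
      fix l assume "l \<in> {1..M}"
      then show "poly (pderiv (w c h)) (?\<xi> l) = h * g c h (?\<xi> l)"
        using elim[rule_format, of l] glb_weight_nonzero[OF M, of l] by auto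
    qed
  qed
  have node0: "\<forall>\<^sub>F h in at 0. poly (w c h) 0 + ?w 0 * (poly (pderiv (w c h)) 0 - h * g c h 0) = 0" for c
    using collocation[of c]
  proof eventually_elim
    case (elim h)
    then show ?case using elim[rule_format, of 0] by (simp add: glb_node_bij(2)[OF M])
  qed
  have g_graded: "graded j (g c)" if "graded_vec j W" "j \<le> 2 * M" for j c
    unfolding g_def by (rule graded_taylor[OF P(1) P(2)[OF W_small] that])
  \<comment> \<open>The bootstrap ends at M + 1, the last order reached from a right-hand side whose
    polynomial part has degree below M; this is just what \<open>graded_exact\<close> needs.\<close>
  have "graded_vec j W" if "j \<le> Suc M" for j
    using that
  proof (induction j)
    case 0
    show ?case unfolding graded_vec_def
      using unif_O_mono[OF w_small, of _ 0] by (auto simp: W_inner intro: unif_O_graded)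
  next
    case (Suc j)
    have "graded (Suc j) (\<lambda>h. poly (w c h))" if "c \<in> Basis" for c
    proof (rule collocation_graded_Suc[OF M _ deg node])
      show "graded j (g c)" using Suc M by (intro g_graded) auto
      show "unif_O 0 (\<lambda>h. poly (w c h))" using unif_O_mono[OF w_small[OF that], of 0] by simp
    qed (use Suc in auto)
    then show ?case by (simp add: graded_vec_def W_inner)
  qed
  then have "graded_vec (Suc M) W" by simp
  then have "\<forall>c\<in>Basis. \<exists>q. bounded_polys q \<and> (\<forall>h. h \<noteq> 0 \<longrightarrow> w c h = pcompose (q h) [:0, h:])"
    by (intro ballI graded_exact[OF M deg]) (simp add: graded_vec_def W_inner)
  then obtain \<omega> where \<omega>: "\<And>c. c \<in> Basis \<Longrightarrow> bounded_polys (\<omega> c)"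
    "\<And>c h. c \<in> Basis \<Longrightarrow> h \<noteq> 0 \<Longrightarrow> w c h = pcompose (\<omega> c h) [:0, h:]"
    using bchoice[of Basis "\<lambda>c q. bounded_polys q \<and> (\<forall>h. h \<noteq> 0 \<longrightarrow> w c h = pcompose (q h) [:0, h:])"]
    by blast
  \<comment> \<open>For nonzero \<open>h\<close> the stage polynomials equal polynomials in physical
    time, so the remainder is zero and the order jumps from M + 1 to 2 M.\<close>
  have W_graded: "graded_vec (2 * M) W"
    unfolding graded_vec_def
  proof
    fix c :: 'a assume c: "c \<in> Basis"
    have "\<forall>\<^sub>F h in at 0. \<forall>\<xi>\<in>{0..1}. W h \<xi> \<bullet> c - poly (\<omega> c h) (h * \<xi>) = 0"
      using eventually_at_nonzero
      by eventually_elim (simp add: W_inner[OF c] \<omega>(2)[OF c] poly_pcompose mult.commute)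
    from unif_O_cong[OF this] have "unif_O (2 * M) (\<lambda>h \<xi>. W h \<xi> \<bullet> c - poly (\<omega> c h) (h * \<xi>))"
      using unif_O_zero by blast
    then show "graded (2 * M) (\<lambda>h \<xi>. W h \<xi> \<bullet> c)" using \<omega>(1)[OF c] unfolding graded_def by blast
  qed
  have "\<forall>c. \<exists>q. (\<forall>b. graded (2 * M) (q b)) \<and>
      unif_O (2 * M) (\<lambda>h \<xi>. F c (p0 + (h * \<xi>, W h \<xi>)) - F c (p0 + (h * \<xi>, z h \<xi>)) -
        (\<Sum>b\<in>Basis. q b h \<xi> * (W h \<xi> \<bullet> b - z h \<xi> \<bullet> b)))"
    using unif_O_linearization[OF P(1) P(2)[OF W_small] W_graded P(2)[OF z_small] z_graded] by blast
  from choice[OF this] obtain q where q: "\<And>c b. graded (2 * M) (q c b)"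
    "\<And>c. unif_O (2 * M) (\<lambda>h \<xi>. F c (p0 + (h * \<xi>, W h \<xi>)) - F c (p0 + (h * \<xi>, z h \<xi>)) -
        (\<Sum>b\<in>Basis. q c b h \<xi> * (W h \<xi> \<bullet> b - z h \<xi> \<bullet> b)))"
    by blast
  have err: "unif_O (2 * M + 1) (\<lambda>h \<xi>. poly (w c h) 1 - z h 1 \<bullet> c)" if "c \<in> Basis" for c
  proof (rule superconvergence[OF M finite_Basis that \<omega>, where z = "\<lambda>c h \<xi>. z h \<xi> \<bullet> c" and gw = g
        and gz = "\<lambda>c h \<xi>. F c (p0 + (h * \<xi>, z h \<xi>))" and q = q])
    show "unif_O (2 * M) (\<lambda>h \<xi>. g c h \<xi> - F c (p0 + (h * \<xi>, z h \<xi>)) -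
        (\<Sum>b\<in>Basis. q c b h \<xi> * (poly (w b h) \<xi> - z h \<xi> \<bullet> b)))" for c
      using q(2)[of c] by (simp add: g_def W_inner cong: sum.cong)
    show "graded (2 * M) (\<lambda>h \<xi>. z h \<xi> \<bullet> c)" if "c \<in> Basis" for c
      using z_graded that by (simp add: graded_vec_def)
  qed (use z_der q(1) node node0 g_graded[OF W_graded] in \<open>auto simp: z_def\<close>)
  have "unif_O (2 * M + 1) (\<lambda>h \<xi>. norm (\<Phi> h - u (t0 + h)))"
  proof (rule unif_O_norm)
    fix c :: 'a assume c: "c \<in> Basis"
    have "\<forall>\<^sub>F h in at 0. \<forall>\<xi>\<in>{0..1::real}. (\<Phi> h - u (t0 + h)) \<bullet> c = poly (w c h) 1 - z h 1 \<bullet> c"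
      using step[of c] by eventually_elim (simp add: z_def inner_diff_left)
    from unif_O_cong[OF this] show "unif_O (2 * M + 1) (\<lambda>h \<xi>. (\<Phi> h - u (t0 + h)) \<bullet> c)"
      using err[OF c] by blast
  qed
  then obtain C where "\<forall>\<^sub>F h in at 0. \<forall>\<xi>\<in>{0..1::real}. \<bar>norm (\<Phi> h - u (t0 + h))\<bar> \<le> C * \<bar>h\<bar> ^ (2 * M + 1)"
    by (rule unif_O_E)
  then have "\<forall>\<^sub>F h in at 0. norm (norm (\<Phi> h - u (t0 + h))) \<le> C * norm (h ^ (2 * M + 1))"
    by eventually_elim (auto simp: power_abs abs_mult)
  then show ?thesis by (rule bigoI)
qed

theorem theorem3p8:
  fixes M S :: nat
  assumes "M \<ge> 1" and "S = M + 1"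
  shows "rk_of_order TYPE(real ^ 'q) S (ader_A M) (glb_weight M) (glb_node M) (2 * S - 2)"
  unfolding rk_of_order_def
\<comment> \<open>The smoothness 2 M depends on the method alone and equals the claimed order 2 S -
  2.\<close>
proof (intro exI[of _ "2 * M"] allI impI conjI)
  fix G :: "real \<Rightarrow> real ^ 'q \<Rightarrow> real ^ 'q" and L u t\<^sub>0
  assume G: "C_k (2 * M) (\<lambda>(t, x). G t x)" "continuous_on UNIV (\<lambda>(t, x). G t x)"
    "\<forall>t. L-lipschitz_on UNIV (G t)"
    and u: "\<forall>\<^sub>F t in nhds t\<^sub>0. (u has_vector_derivative G t (u t)) (at t)"
  show "\<forall>\<^sub>F h in at 0. \<exists>x'. rk_step S (ader_A M) (glb_weight M) (glb_node M) G t\<^sub>0 h (u t\<^sub>0) x'"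
    using G(3) by (intro rk_step_exists) blast
  fix \<Phi>
  assume "\<forall>\<^sub>F h in at 0. rk_step S (ader_A M) (glb_weight M) (glb_node M) G t\<^sub>0 h (u t\<^sub>0) (\<Phi> h)"
  then have "(\<lambda>h. norm (\<Phi> h - u (t\<^sub>0 + h))) \<in> O[at 0](\<lambda>h. h ^ (2 * M + 1))"
    using G u assms by (intro ader_local_error) auto
  moreover have "2 * S - 2 = 2 * M" using assms(2) by simp
  ultimately show "(\<lambda>h. norm (\<Phi> h - u (t\<^sub>0 + h))) \<in> O[at 0](\<lambda>h. h ^ (2 * S - 2 + 1))" by simp
qed

end
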